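(* Suppose that $\odot\colon(\mathcal M,\mathcal N)\to\mathcal L$ is any pairing of Mackey 2-functors $\mathcal M,\mathcal N,\mathcal L$ for a Cartesian spannable pair $(\mathbb G;\mathbb J)$. If $\odot$ satisfies the projection formulas for every $(i\colon H\to G)\in\mathbb J$ — that is, $\mathrm{Lp}^1_{X,Y}$ and $\mathrm{Rp}^1_{X,Y}$ are mutually inverse for all $X\in\mathcal M(G)$, $Y\in\mathcal N(H)$, and $\mathrm{Lp}^2_{Y,X}$ and $\mathrm{Rp}^2_{Y,X}$ are mutually inverse for all $X\in\mathcal N(G)$, $Y\in\mathcal M(H)$ — then $\odot$ is a $\mathbb J$-bimorphism. (Consequently, since conversely every $\mathbb J$-bimorphism satisfies the projection formulas, the projection formulas for the internal pairing $\odot$ are equivalent to the bimorphism condition for the corresponding external pairing $\boxdot$.)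
   Context: Fix a commutative ring $\Bbbk$. $\mathbb A$ denotes either $\mathsf{ADD}_\Bbbk$, the 2-category of (possibly large) additive $\Bbbk$-linear categories, $\Bbbk$-linear functors and natural transformations, or its full 2-subcategory $\mathsf{ADD}_\Bbbk^{ic}$ of idempotent complete ones. A spannable pair $(\mathbb G;\mathbb J)$ consists of: (1) an essentially small $(2,1)$-category $\mathbb G$ (Hom categories are small groupoids; up to equivalence only a small set of objects), which (2) is extensive (it has finite coproducts and for all $G,H$ the pseudofunctor $\mathbb G/G\times\mathbb G/H\to\mathbb G/(G\sqcup H)$, $(u,v)\mapsto u\sqcup v$, is a biequivalence); (3) a 2-full 2-subcategory $\mathbb J\subseteq\mathbb G$ containing all equivalences and closed under isomorphic 1-cells, such that (4) for $i\colon H\to G$ in $\mathbb J$ and any $u\colon K\to G$ there is a pseudopullback ("Mackey square") $p\colon P\to H$, $q\colon P\to K$, $\gamma\colon ip\overset{\sim}{\Rightarrow}uq$, with $q\in\mathbb J$; and (5) for every finite family $u_\ell\colon H_\ell\to G$, the induced $\sqcup_\ell H_\ell\to G$ is in $\mathbb J$ iff every $u_\ell$ is. The pair is Cartesian if moreover $\mathbb G$ has finite products and products of 1-morphisms in $\mathbb J$ are again in $\mathbb J$. A Mackey 2-functor for $(\mathbb G;\mathbb J)$ is a 2-functor $\mathcal M\colon\mathbb G^{op}\to\mathbb A$ (write $u^*=\mathcal M(u)$) such that: (1) it sends finite coproducts to direct sums; (2) for $i\in\mathbb J$, $i^*$ has a left adjoint $i_!$ and a right adjoint $i_*$; (3)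 for every Mackey square with $i,q\in\mathbb J$ the mates $\gamma_!\colon q_!p^*\Rightarrow u^*i_!$ and $(\gamma^{-1})_*\colon u^*i_*\Rightarrow q_*p^*$ are invertible; (4) $i_!\simeq i_*$ for $i\in\mathbb J$. Standing assumption: all Mackey 2-functors are rectified, i.e. come with chosen adjunctions $(i_!\dashv i^*,{}^\ell\eta,{}^\ell\varepsilon)$ and $(i^*\dashv i_*,{}^r\eta,{}^r\varepsilon)$ for $i\in\mathbb J$ with $i_!=i_*$ as functors, the pseudofunctors $i\mapsto i_!$ and $i\mapsto i_*$ on $\mathbb J$ equal, $(\gamma_!)^{-1}=(\gamma^{-1})_*$ for all Mackey squares, and ${}^r\varepsilon\circ{}^\ell\eta=\mathrm{id}$. A pairing $\odot\colon(\mathcal M,\mathcal N)\to\mathcal L$ is a pseudonatural transformation $\mathcal M\otimes\mathcal N\to\mathcal L$, where $(\mathcal M\otimes\mathcal N)(G)=\mathcal M(G)\otimes\mathcal N(G)$ is the tensor product in $\mathbb A$ classifying $\Bbbk$-bilinear functors; concretely, $\Bbbk$-bilinear functors $\odot_G\colon\mathcal M(G)\times\mathcal N(G)\to\mathcal L(G)$ with natural isomorphisms $\odot_u\colon u^*(X_1\odot_GX_2)\xrightarrow{\sim}u^*X_1\odot_Hu^*X_2$ for $u\colon H\to G$, compatible with identities, composition and 2-cells. Its external version is $X\boxdot Y:=\pi_1^*X\odot_{G_1\times G_2}\pi_2^*Y\in\mathcal L(G_1\times G_2)$ for $X\in\mathcal M(G_1)$, $Y\in\mathcal N(G_2)$ ($\pi_k$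 the projections), with isomorphisms $\boxdot_{u_1,u_2}\colon(u_1\times u_2)^*(X\boxdot Y)\cong u_1^*X\boxdot u_2^*Y$ induced by $\odot_{u_1\times u_2}$. The pairing is a ($\mathbb J$-)bimorphism if for all $i_1\colon H_1\to G_1$, $i_2\colon H_2\to G_2$ in $\mathbb J$ the right mate $(i_1)_*X\boxdot(i_2)_*Y\to(i_1\times i_2)_*(X\boxdot Y)$ of $\boxdot_{i_1,i_2}$ and the left mate $(i_1\times i_2)_!(X\boxdot Y)\to(i_1)_!X\boxdot(i_2)_!Y$ of $\boxdot_{i_1,i_2}^{-1}$ are mutually inverse (equivalently: all right mates are invertible; equivalently: all left mates are invertible). Projection maps: $\mathrm{Rp}^1_{X,Y}=i_*(i^*X\odot_H{}^r\varepsilon)\circ i_*(\odot_i)\circ{}^r\eta\colon X\odot_Gi_*Y\to i_*(i^*X\odot_HY)$ and $\mathrm{Rp}^2_{Y,X}=i_*({}^r\varepsilon\odot_Hi^*X)\circ i_*(\odot_i)\circ{}^r\eta\colon i_*Y\odot_GX\to i_*(Y\odot_Hi^*X)$; dually $\mathrm{Lp}^1_{X,Y}={}^\ell\varepsilon\circ i_!(\odot_i^{-1})\circ i_!(i^*X\odot_H{}^\ell\eta)\colon i_!(i^*X\odot_HY)\to X\odot_Gi_!Y$ and $\mathrm{Lp}^2_{Y,X}={}^\ell\varepsilon\circ i_!(\odot_i^{-1})\circ i_!({}^\ell\eta\odot_Hi^*X)\colon i_!(Y\odot_Hi^*X)\to i_!Y\odot_GX$. *)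

theory Defs
  imports "HOL-Algebra.Module"
begin

section \<open>Categories and functors\<close>

record ('a, 'm) cat =
  Ob :: "'a set"
  Arr :: "'m set"
  Dom :: "'m \<Rightarrow> 'a"
  Cod :: "'m \<Rightarrow> 'a"
  Idt :: "'a \<Rightarrow> 'm"
  Comp :: "'m \<Rightarrow> 'm \<Rightarrow> 'm"  (infixr "\<cdot>\<index>" 70)

definition Hom :: "('a, 'm, 'z) cat_scheme \<Rightarrow> 'a \<Rightarrow> 'a \<Rightarrow> 'm set" where
  "Hom C x y = {f \<in> Arr C. Dom C f = x \<and> Cod C f = y}"

locale category =
  fixes C :: "('a, 'm, 'z) cat_scheme" (structure)
  assumes Dom_Ob: "f \<in> Arr C \<Longrightarrow> Dom C f \<in> Ob C"
    and Cod_Ob: "f \<in> Arr C \<Longrightarrow> Cod C f \<in> Ob C"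
    and Idt_Hom: "x \<in> Ob C \<Longrightarrow> Idt C x \<in> Hom C x x"
    and Comp_Hom: "f \<in> Hom C x y \<Longrightarrow> g \<in> Hom C y z \<Longrightarrow> g \<cdot> f \<in> Hom C x z"
    and Comp_Idt: "f \<in> Hom C x y \<Longrightarrow> f \<cdot> Idt C x = f"
    and Idt_Comp: "f \<in> Hom C x y \<Longrightarrow> Idt C y \<cdot> f = f"
    and Comp_assoc: "f \<in> Hom C w x \<Longrightarrow> g \<in> Hom C x y \<Longrightarrow> h \<in> Hom C y z \<Longrightarrow>
                       (h \<cdot> g) \<cdot> f = h \<cdot> (g \<cdot> f)"

definition mutually_inverse :: "('a, 'm, 'z) cat_scheme \<Rightarrow> 'm \<Rightarrow> 'm \<Rightarrow> bool" where
  "mutually_inverse C f g \<longleftrightarrow>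
     f \<in> Arr C \<and> g \<in> Hom C (Cod C f) (Dom C f) \<and>
     g \<cdot>\<^bsub>C\<^esub> f = Idt C (Dom C f) \<and> f \<cdot>\<^bsub>C\<^esub> g = Idt C (Cod C f)"

definition iso_arr :: "('a, 'm, 'z) cat_scheme \<Rightarrow> 'm \<Rightarrow> bool" where
  "iso_arr C f \<longleftrightarrow> (\<exists>g. mutually_inverse C f g)"

definition inv_arr :: "('a, 'm, 'z) cat_scheme \<Rightarrow> 'm \<Rightarrow> 'm" where
  "inv_arr C f = (THE g. mutually_inverse C f g)"

record ('a, 'm, 'b, 'n) fctr =
  obj_map :: "'a \<Rightarrow> 'b"  (infixr "$o" 90)
  arr_map :: "'m \<Rightarrow> 'n"  (infixr "$a" 90)

definition is_functor ::
  "('a, 'm, 'y) cat_scheme \<Rightarrow> ('b, 'n, 'z) cat_scheme \<Rightarrow> ('a, 'm, 'b, 'n) fctr \<Rightarrow> bool" where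
  "is_functor C D F \<longleftrightarrow>
     (\<forall>x \<in> Ob C. F $o x \<in> Ob D \<and> F $a Idt C x = Idt D (F $o x)) \<and>
     (\<forall>x y. \<forall>f \<in> Hom C x y. F $a f \<in> Hom D (F $o x) (F $o y)) \<and>
     (\<forall>x y z. \<forall>f \<in> Hom C x y. \<forall>g \<in> Hom C y z.
        F $a (g \<cdot>\<^bsub>C\<^esub> f) = (F $a g) \<cdot>\<^bsub>D\<^esub> (F $a f))"

definition id_fctr :: "('a, 'm, 'a, 'm) fctr" where
  "id_fctr = \<lparr>obj_map = \<lambda>x. x, arr_map = \<lambda>f. f\<rparr>"

definition comp_fctr ::
  "('b, 'n, 'd, 'l) fctr \<Rightarrow> ('a, 'm, 'b, 'n) fctr \<Rightarrow> ('a, 'm, 'd, 'l) fctr" where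
  "comp_fctr G F = \<lparr>obj_map = \<lambda>x. G $o F $o x, arr_map = \<lambda>f. G $a F $a f\<rparr>"

text \<open>Equality of functors with source \<open>C\<close>: the values outside the carriers of \<open>C\<close> are junk.\<close>

definition eq_fctr ::
  "('a, 'm, 'z) cat_scheme \<Rightarrow> ('a, 'm, 'b, 'n) fctr \<Rightarrow> ('a, 'm, 'b, 'n) fctr \<Rightarrow> bool" where
  "eq_fctr C F G \<longleftrightarrow> (\<forall>x \<in> Ob C. F $o x = G $o x) \<and> (\<forall>f \<in> Arr C. F $a f = G $a f)"

definition nat_trans ::
  "('a, 'm, 'y) cat_scheme \<Rightarrow> ('b, 'n, 'z) cat_scheme \<Rightarrow>
   ('a, 'm, 'b, 'n) fctr \<Rightarrow> ('a, 'm, 'b, 'n) fctr \<Rightarrow> ('a \<Rightarrow> 'n) \<Rightarrow> bool" where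
  "nat_trans C D F G \<theta> \<longleftrightarrow>
     (\<forall>x \<in> Ob C. \<theta> x \<in> Hom D (F $o x) (G $o x)) \<and>
     (\<forall>x y. \<forall>f \<in> Hom C x y. \<theta> y \<cdot>\<^bsub>D\<^esub> (F $a f) = (G $a f) \<cdot>\<^bsub>D\<^esub> \<theta> x)"

definition naturally_isomorphic ::
  "('a, 'm, 'y) cat_scheme \<Rightarrow> ('b, 'n, 'z) cat_scheme \<Rightarrow>
   ('a, 'm, 'b, 'n) fctr \<Rightarrow> ('a, 'm, 'b, 'n) fctr \<Rightarrow> bool" where
  "naturally_isomorphic C D F G \<longleftrightarrow>
     (\<exists>\<theta>. nat_trans C D F G \<theta> \<and> (\<forall>x \<in> Ob C. iso_arr D (\<theta> x)))"

definition is_equivalence ::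
  "('a, 'm, 'y) cat_scheme \<Rightarrow> ('b, 'n, 'z) cat_scheme \<Rightarrow> ('a, 'm, 'b, 'n) fctr \<Rightarrow> bool" where
  "is_equivalence C D F \<longleftrightarrow>
     is_functor C D F \<and>
     (\<forall>x \<in> Ob C. \<forall>y \<in> Ob C. bij_betw (arr_map F) (Hom C x y) (Hom D (F $o x) (F $o y))) \<and>
     (\<forall>z \<in> Ob D. \<exists>x \<in> Ob C. \<exists>f \<in> Hom D (F $o x) z. iso_arr D f)"

definition adjunction ::
  "('a, 'm, 'y) cat_scheme \<Rightarrow> ('b, 'n, 'z) cat_scheme \<Rightarrow>
   ('a, 'm, 'b, 'n) fctr \<Rightarrow> ('b, 'n, 'a, 'm) fctr \<Rightarrow> ('a \<Rightarrow> 'm) \<Rightarrow> ('b \<Rightarrow> 'n) \<Rightarrow> bool" where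
  "adjunction C D L R \<eta> \<epsilon> \<longleftrightarrow>
     is_functor C D L \<and> is_functor D C R \<and>
     nat_trans C C id_fctr (comp_fctr R L) \<eta> \<and>
     nat_trans D D (comp_fctr L R) id_fctr \<epsilon> \<and>
     (\<forall>x \<in> Ob C. \<epsilon> (L $o x) \<cdot>\<^bsub>D\<^esub> (L $a \<eta> x) = Idt D (L $o x)) \<and>
     (\<forall>y \<in> Ob D. (R $a \<epsilon> y) \<cdot>\<^bsub>C\<^esub> \<eta> (R $o y) = Idt C (R $o y))"

definition pair_cat ::
  "('a, 'm, 'y) cat_scheme \<Rightarrow> ('b, 'n, 'z) cat_scheme \<Rightarrow> ('a \<times> 'b, 'm \<times> 'n) cat" where
  "pair_cat C D =
     \<lparr>Ob = Ob C \<times> Ob D, Arr = Arr C \<times> Arr D,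
      Dom = map_prod (Dom C) (Dom D), Cod = map_prod (Cod C) (Cod D),
      Idt = map_prod (Idt C) (Idt D),
      Comp = (\<lambda>(g, g') (f, f'). (g \<cdot>\<^bsub>C\<^esub> f, g' \<cdot>\<^bsub>D\<^esub> f'))\<rparr>"

definition list_cat :: "('a, 'm, 'z) cat_scheme list \<Rightarrow> ('a list, 'm list) cat" where
  "list_cat Cs =
     \<lparr>Ob = {xs. list_all2 (\<lambda>C x. x \<in> Ob C) Cs xs},
      Arr = {fs. list_all2 (\<lambda>C f. f \<in> Arr C) Cs fs},
      Dom = map2 Dom Cs, Cod = map2 Cod Cs, Idt = map2 Idt Cs,
      Comp = (\<lambda>gs fs. map2 (\<lambda>C (g, f). g \<cdot>\<^bsub>C\<^esub> f) Cs (zip gs fs))\<rparr>"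

text \<open>The pseudopullback (iso-comma) of two functors \<open>F : C \<rightarrow> E\<close> and \<open>G : D \<rightarrow> E\<close>.\<close>

definition iso_comma ::
  "('a, 'm) cat \<Rightarrow> ('b, 'n) cat \<Rightarrow> ('d, 'l) cat \<Rightarrow>
   ('a, 'm, 'd, 'l) fctr \<Rightarrow> ('b, 'n, 'd, 'l) fctr \<Rightarrow>
   ('a \<times> 'b \<times> 'l, ('a \<times> 'b \<times> 'l) \<times> ('a \<times> 'b \<times> 'l) \<times> 'm \<times> 'n) cat" where
  "iso_comma C D E F G =
     (let O' = {(a, b, \<phi>). a \<in> Ob C \<and> b \<in> Ob D \<and> \<phi> \<in> Hom E (F $o a) (G $o b) \<and> iso_arr E \<phi>} in
      \<lparr>Ob = O',
       Arr = {((a, b, \<phi>), (a', b', \<phi>'), f, g).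
                (a, b, \<phi>) \<in> O' \<and> (a', b', \<phi>') \<in> O' \<and> f \<in> Hom C a a' \<and> g \<in> Hom D b b' \<and>
                \<phi>' \<cdot>\<^bsub>E\<^esub> (F $a f) = (G $a g) \<cdot>\<^bsub>E\<^esub> \<phi>},
       Dom = (\<lambda>(s, t, f, g). s), Cod = (\<lambda>(s, t, f, g). t),
       Idt = (\<lambda>(a, b, \<phi>). ((a, b, \<phi>), (a, b, \<phi>), Idt C a, Idt D b)),
       Comp = (\<lambda>(s', t', f', g') (s, t, f, g). (s, t', f' \<cdot>\<^bsub>C\<^esub> f, g' \<cdot>\<^bsub>D\<^esub> g))\<rparr>)"


section \<open>Additive linear categories over a commutative ring\<close>

record ('a, 'm, 'k) lincat = "('a, 'm) cat" +
  Zero :: "'a \<Rightarrow> 'a \<Rightarrow> 'm"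
  Add :: "'m \<Rightarrow> 'm \<Rightarrow> 'm"
  Smult :: "'k \<Rightarrow> 'm \<Rightarrow> 'm"

text \<open>The multiplicative fields of the record are not used by the locale \<^locale>\<open>module\<close>.\<close>

definition hom_module :: "('a, 'm, 'k) lincat \<Rightarrow> 'a \<Rightarrow> 'a \<Rightarrow> ('k, 'm) module" where
  "hom_module C x y =
     \<lparr>carrier = Hom C x y, monoid.mult = (\<lambda>f g. undefined), one = undefined,
      zero = Zero C x y, add = Add C, smult = Smult C\<rparr>"

definition linear_category :: "'k ring \<Rightarrow> ('a, 'm, 'k) lincat \<Rightarrow> bool" where
  "linear_category k C \<longleftrightarrow>
     category C \<and>
     (\<forall>x \<in> Ob C. \<forall>y \<in> Ob C. module k (hom_module C x y)) \<and>
     (\<forall>x y z. \<forall>f \<in> Hom C x y. \<forall>f' \<in> Hom C x y. \<forall>g \<in> Hom C y z. \<forall>g' \<in> Hom C y z.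
        g \<cdot>\<^bsub>C\<^esub> Add C f f' = Add C (g \<cdot>\<^bsub>C\<^esub> f) (g \<cdot>\<^bsub>C\<^esub> f') \<and>
        Add C g g' \<cdot>\<^bsub>C\<^esub> f = Add C (g \<cdot>\<^bsub>C\<^esub> f) (g' \<cdot>\<^bsub>C\<^esub> f)) \<and>
     (\<forall>x y z. \<forall>f \<in> Hom C x y. \<forall>g \<in> Hom C y z. \<forall>r \<in> carrier k.
        g \<cdot>\<^bsub>C\<^esub> Smult C r f = Smult C r (g \<cdot>\<^bsub>C\<^esub> f) \<and>
        Smult C r g \<cdot>\<^bsub>C\<^esub> f = Smult C r (g \<cdot>\<^bsub>C\<^esub> f))"

definition is_zero_object :: "('a, 'm, 'k) lincat \<Rightarrow> 'a \<Rightarrow> bool" where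
  "is_zero_object C z \<longleftrightarrow>
     z \<in> Ob C \<and> (\<forall>x \<in> Ob C. (\<exists>!f. f \<in> Hom C x z) \<and> (\<exists>!f. f \<in> Hom C z x))"

definition is_biproduct :: "('a, 'm, 'k) lincat \<Rightarrow> 'a \<Rightarrow> 'a \<Rightarrow> 'a \<Rightarrow> bool" where
  "is_biproduct C x y s \<longleftrightarrow>
     s \<in> Ob C \<and>
     (\<exists>i \<in> Hom C x s. \<exists>j \<in> Hom C y s. \<exists>p \<in> Hom C s x. \<exists>q \<in> Hom C s y.
        p \<cdot>\<^bsub>C\<^esub> i = Idt C x \<and> q \<cdot>\<^bsub>C\<^esub> j = Idt C y \<and>
        p \<cdot>\<^bsub>C\<^esub> j = Zero C y x \<and> q \<cdot>\<^bsub>C\<^esub> i = Zero C x y \<and>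
        Add C (i \<cdot>\<^bsub>C\<^esub> p) (j \<cdot>\<^bsub>C\<^esub> q) = Idt C s)"

definition additive_category :: "'k ring \<Rightarrow> ('a, 'm, 'k) lincat \<Rightarrow> bool" where
  "additive_category k C \<longleftrightarrow>
     linear_category k C \<and> (\<exists>z. is_zero_object C z) \<and>
     (\<forall>x \<in> Ob C. \<forall>y \<in> Ob C. \<exists>s. is_biproduct C x y s)"

definition idempotent_complete :: "('a, 'm, 'z) cat_scheme \<Rightarrow> bool" where
  "idempotent_complete C \<longleftrightarrow>
     (\<forall>x \<in> Ob C. \<forall>e \<in> Hom C x x. e \<cdot>\<^bsub>C\<^esub> e = e \<longrightarrow>
        (\<exists>y \<in> Ob C. \<exists>r \<in> Hom C x y. \<exists>s \<in> Hom C y x. r \<cdot>\<^bsub>C\<^esub> s = Idt C y \<and> s \<cdot>\<^bsub>C\<^esub> r = e))"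

text \<open>The two possible target 2-categories. The second is a full 2-subcategory of the first, so
  they differ in their objects only.\<close>

datatype target = ADD | ADD_ic

fun target_object :: "target \<Rightarrow> 'k ring \<Rightarrow> ('a, 'm, 'k) lincat \<Rightarrow> bool" where
  "target_object ADD k C \<longleftrightarrow> additive_category k C"
| "target_object ADD_ic k C \<longleftrightarrow> additive_category k C \<and> idempotent_complete C"

definition linear_functor ::
  "'k ring \<Rightarrow> ('a, 'm, 'k) lincat \<Rightarrow> ('b, 'n, 'k) lincat \<Rightarrow> ('a, 'm, 'b, 'n) fctr \<Rightarrow> bool" where
  "linear_functor k C D F \<longleftrightarrow>
     is_functor C D F \<and>
     (\<forall>x y. \<forall>f \<in> Hom C x y. \<forall>g \<in> Hom C x y. F $a Add C f g = Add D (F $a f) (F $a g)) \<and>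
     (\<forall>x y. \<forall>f \<in> Hom C x y. \<forall>r \<in> carrier k. F $a Smult C r f = Smult D r (F $a f))"


section \<open>Strict 2-categories\<close>

text \<open>The objects of \<open>Cells2 T\<close> are the 1-cells of \<open>T\<close>; its composition is the vertical
  composition of 2-cells.\<close>

record ('o, 'c, 't) twocat =
  Cells1 :: "('o, 'c) cat"
  Cells2 :: "('c, 't) cat"
  HComp :: "'t \<Rightarrow> 't \<Rightarrow> 't"  (infixr "\<star>\<index>" 70)

abbreviation comp1 (infixr "\<circ>1\<index>" 75) where "comp1 T \<equiv> Comp (Cells1 T)"
abbreviation comp2 (infixr "\<cdot>2\<index>" 65) where "comp2 T \<equiv> Comp (Cells2 T)"
abbreviation "Obj T \<equiv> Ob (Cells1 T)"
abbreviation "Cell1 T \<equiv> Arr (Cells1 T)"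
abbreviation "Cell2 T \<equiv> Arr (Cells2 T)"
abbreviation "Hom1 T \<equiv> Hom (Cells1 T)"
abbreviation "Hom2 T \<equiv> Hom (Cells2 T)"
abbreviation "Dom1 T \<equiv> Dom (Cells1 T)"
abbreviation "Cod1 T \<equiv> Cod (Cells1 T)"
abbreviation "Id1 T \<equiv> Idt (Cells1 T)"
abbreviation "Id2 T \<equiv> Idt (Cells2 T)"

locale two_category =
  fixes T :: "('o, 'c, 't) twocat" (structure)
  assumes category1: "category (Cells1 T)"
    and category2: "category (Cells2 T)"
    and Ob_Cells2: "Ob (Cells2 T) = Cell1 T"
    and parallel: "\<alpha> \<in> Hom2 T f g \<Longrightarrow> Dom1 T f = Dom1 T g \<and> Cod1 T f = Cod1 T g"
    and HComp_Hom: "f \<in> Hom1 T X Y \<Longrightarrow> g \<in> Hom1 T Y Z \<Longrightarrow> \<alpha> \<in> Hom2 T f f' \<Longrightarrow> \<beta> \<in> Hom2 T g g' \<Longrightarrow>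
                      \<beta> \<star> \<alpha> \<in> Hom2 T (g \<circ>1 f) (g' \<circ>1 f')"
    and HComp_Id2: "f \<in> Hom1 T X Y \<Longrightarrow> g \<in> Hom1 T Y Z \<Longrightarrow> Id2 T g \<star> Id2 T f = Id2 T (g \<circ>1 f)"
    and interchange: "f \<in> Hom1 T X Y \<Longrightarrow> g \<in> Hom1 T Y Z \<Longrightarrow>
                        \<alpha> \<in> Hom2 T f f' \<Longrightarrow> \<alpha>' \<in> Hom2 T f' f'' \<Longrightarrow>
                        \<beta> \<in> Hom2 T g g' \<Longrightarrow> \<beta>' \<in> Hom2 T g' g'' \<Longrightarrow>
                        (\<beta>' \<cdot>2 \<beta>) \<star> (\<alpha>' \<cdot>2 \<alpha>) = (\<beta>' \<star> \<alpha>') \<cdot>2 (\<beta> \<star> \<alpha>)"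
    and HComp_unit_right: "f \<in> Hom1 T X Y \<Longrightarrow> \<alpha> \<in> Hom2 T f f' \<Longrightarrow> \<alpha> \<star> Id2 T (Id1 T X) = \<alpha>"
    and HComp_unit_left: "f \<in> Hom1 T X Y \<Longrightarrow> \<alpha> \<in> Hom2 T f f' \<Longrightarrow> Id2 T (Id1 T Y) \<star> \<alpha> = \<alpha>"
    and HComp_assoc: "f \<in> Hom1 T W X \<Longrightarrow> g \<in> Hom1 T X Y \<Longrightarrow> h \<in> Hom1 T Y Z \<Longrightarrow>
                        \<alpha> \<in> Hom2 T f f' \<Longrightarrow> \<beta> \<in> Hom2 T g g' \<Longrightarrow> \<delta> \<in> Hom2 T h h' \<Longrightarrow>
                        (\<delta> \<star> \<beta>) \<star> \<alpha> = \<delta> \<star> (\<beta> \<star> \<alpha>)"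

definition is_21_category :: "('o, 'c, 't) twocat \<Rightarrow> bool" where
  "is_21_category T \<longleftrightarrow> two_category T \<and> (\<forall>\<alpha> \<in> Cell2 T. iso_arr (Cells2 T) \<alpha>)"

definition lwhisker :: "('o, 'c, 't) twocat \<Rightarrow> 'c \<Rightarrow> 't \<Rightarrow> 't" where
  "lwhisker T g \<alpha> = Id2 T g \<star>\<^bsub>T\<^esub> \<alpha>"

definition rwhisker :: "('o, 'c, 't) twocat \<Rightarrow> 't \<Rightarrow> 'c \<Rightarrow> 't" where
  "rwhisker T \<alpha> f = \<alpha> \<star>\<^bsub>T\<^esub> Id2 T f"

definition hom_cat :: "('o, 'c, 't) twocat \<Rightarrow> 'o \<Rightarrow> 'o \<Rightarrow> ('c, 't) cat" where
  "hom_cat T X Y =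
     (Cells2 T)\<lparr>Ob := Hom1 T X Y, Arr := {\<alpha> \<in> Cell2 T. Dom (Cells2 T) \<alpha> \<in> Hom1 T X Y}\<rparr>"

definition post_fctr :: "('o, 'c, 't) twocat \<Rightarrow> 'c \<Rightarrow> ('c, 't, 'c, 't) fctr" where
  "post_fctr T p = \<lparr>obj_map = \<lambda>f. p \<circ>1\<^bsub>T\<^esub> f, arr_map = lwhisker T p\<rparr>"

definition isomorphic1 :: "('o, 'c, 't) twocat \<Rightarrow> 'c \<Rightarrow> 'c \<Rightarrow> bool" where
  "isomorphic1 T f g \<longleftrightarrow> (\<exists>\<alpha> \<in> Hom2 T f g. iso_arr (Cells2 T) \<alpha>)"

definition is_equivalence1 :: "('o, 'c, 't) twocat \<Rightarrow> 'c \<Rightarrow> bool" where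
  "is_equivalence1 T f \<longleftrightarrow>
     f \<in> Cell1 T \<and>
     (\<exists>g \<in> Hom1 T (Cod1 T f) (Dom1 T f).
        isomorphic1 T (g \<circ>1\<^bsub>T\<^esub> f) (Id1 T (Dom1 T f)) \<and>
        isomorphic1 T (f \<circ>1\<^bsub>T\<^esub> g) (Id1 T (Cod1 T f)))"

text \<open>The opposite 2-category: 1-cells are reversed, 2-cells are not.\<close>

definition op_twocat :: "('o, 'c, 't) twocat \<Rightarrow> ('o, 'c, 't) twocat" where
  "op_twocat T =
     \<lparr>Cells1 = (Cells1 T)\<lparr>Dom := Cod1 T, Cod := Dom1 T, Comp := (\<lambda>g f. f \<circ>1\<^bsub>T\<^esub> g)\<rparr>,
      Cells2 = Cells2 T, HComp = (\<lambda>\<beta> \<alpha>. \<alpha> \<star>\<^bsub>T\<^esub> \<beta>)\<rparr>"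

definition prod_twocat ::
  "('o, 'c, 't) twocat \<Rightarrow> ('p, 'd, 's) twocat \<Rightarrow> ('o \<times> 'p, 'c \<times> 'd, 't \<times> 's) twocat" where
  "prod_twocat S T =
     \<lparr>Cells1 = pair_cat (Cells1 S) (Cells1 T), Cells2 = pair_cat (Cells2 S) (Cells2 T),
      HComp = (\<lambda>(\<beta>, \<beta>') (\<alpha>, \<alpha>'). (\<beta> \<star>\<^bsub>S\<^esub> \<alpha>, \<beta>' \<star>\<^bsub>T\<^esub> \<alpha>'))\<rparr>"

text \<open>The pseudo-slice over \<open>G\<close>. A 1-cell \<open>(u, v, f, \<phi>)\<close> from \<open>u : X \<rightarrow> G\<close> to \<open>v : Y \<rightarrow> G\<close> consists
  of \<open>f : X \<rightarrow> Y\<close> and an invertible \<open>\<phi> : u \<Rightarrow> v f\<close>. A 2-cell \<open>(a, b, \<alpha>)\<close> is a 2-cell \<open>\<alpha>\<close>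
  between the underlying 1-cells of \<open>a\<close> and \<open>b\<close> that is compatible with the triangles.\<close>

definition slice ::
  "('o, 'c, 't) twocat \<Rightarrow> 'o \<Rightarrow>
   ('c, 'c \<times> 'c \<times> 'c \<times> 't, ('c \<times> 'c \<times> 'c \<times> 't) \<times> ('c \<times> 'c \<times> 'c \<times> 't) \<times> 't) twocat" where
  "slice T G =
     (let O' = {u \<in> Cell1 T. Cod1 T u = G};
          A' = {(u, v, f, \<phi>). u \<in> O' \<and> v \<in> O' \<and> f \<in> Hom1 T (Dom1 T u) (Dom1 T v) \<and>
                  \<phi> \<in> Hom2 T u (v \<circ>1\<^bsub>T\<^esub> f) \<and> iso_arr (Cells2 T) \<phi>};
          c = (\<lambda>(v', w, g, \<psi>) (u, v, f, \<phi>). (u, w, g \<circ>1\<^bsub>T\<^esub> f, rwhisker T \<psi> f \<cdot>2\<^bsub>T\<^esub> \<phi>))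
      in
      \<lparr>Cells1 =
         \<lparr>Ob = O', Arr = A',
          Dom = (\<lambda>(u, v, f, \<phi>). u), Cod = (\<lambda>(u, v, f, \<phi>). v),
          Idt = (\<lambda>u. (u, u, Id1 T (Dom1 T u), Id2 T u)), Comp = c\<rparr>,
       Cells2 =
         \<lparr>Ob = A',
          Arr = {((u, v, f, \<phi>), (u', v', f', \<phi>'), \<alpha>).
                   (u, v, f, \<phi>) \<in> A' \<and> (u', v', f', \<phi>') \<in> A' \<and> u = u' \<and> v = v' \<and>
                   \<alpha> \<in> Hom2 T f f' \<and> lwhisker T v \<alpha> \<cdot>2\<^bsub>T\<^esub> \<phi> = \<phi>'},
          Dom = (\<lambda>(a, b, \<alpha>). a), Cod = (\<lambda>(a, b, \<alpha>). b),
          Idt = (\<lambda>(u, v, f, \<phi>). ((u, v, f, \<phi>), (u, v, f, \<phi>), Id2 T f)),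
          Comp = (\<lambda>(b', d, \<beta>) (a, b, \<alpha>). (a, d, \<beta> \<cdot>2\<^bsub>T\<^esub> \<alpha>))\<rparr>,
       HComp = (\<lambda>(b, b', \<beta>) (a, a', \<alpha>). (c b a, c b' a', \<beta> \<star>\<^bsub>T\<^esub> \<alpha>))\<rparr>)"

text \<open>Biequivalence of a pseudofunctor, given by its action \<open>F0\<close>, \<open>F1\<close>, \<open>F2\<close> on cells: it is an
  equivalence on Hom categories and surjective on objects up to equivalence. The structural
  2-cells of the pseudofunctor play no role in this property.\<close>

definition biequivalence ::
  "('o, 'c, 't) twocat \<Rightarrow> ('p, 'd, 's) twocat \<Rightarrow>
   ('o \<Rightarrow> 'p) \<Rightarrow> ('c \<Rightarrow> 'd) \<Rightarrow> ('t \<Rightarrow> 's) \<Rightarrow> bool" where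
  "biequivalence S T F0 F1 F2 \<longleftrightarrow>
     (\<forall>X \<in> Obj S. F0 X \<in> Obj T) \<and>
     (\<forall>X \<in> Obj S. \<forall>Y \<in> Obj S.
        is_equivalence (hom_cat S X Y) (hom_cat T (F0 X) (F0 Y)) \<lparr>obj_map = F1, arr_map = F2\<rparr>) \<and>
     (\<forall>Z \<in> Obj T. \<exists>X \<in> Obj S. \<exists>f \<in> Hom1 T (F0 X) Z. is_equivalence1 T f)"


section \<open>Finite products and coproducts, pseudopullbacks\<close>

text \<open>All (co)limits are bicategorical, i.e. the comparison functors on Hom categories are
  equivalences. Strict (co)products are a special case.\<close>

definition is_product :: "('o, 'c, 't) twocat \<Rightarrow> 'o list \<Rightarrow> 'o \<Rightarrow> 'c list \<Rightarrow> bool" where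
  "is_product T Gs P ps \<longleftrightarrow>
     P \<in> Obj T \<and> list_all2 (\<lambda>p G. p \<in> Hom1 T P G) ps Gs \<and>
     (\<forall>X \<in> Obj T. is_equivalence (hom_cat T X P) (list_cat (map (hom_cat T X) Gs))
        \<lparr>obj_map = \<lambda>f. map (\<lambda>p. p \<circ>1\<^bsub>T\<^esub> f) ps, arr_map = \<lambda>\<alpha>. map (\<lambda>p. lwhisker T p \<alpha>) ps\<rparr>)"

abbreviation is_coproduct :: "('o, 'c, 't) twocat \<Rightarrow> 'o list \<Rightarrow> 'o \<Rightarrow> 'c list \<Rightarrow> bool" where
  "is_coproduct T \<equiv> is_product (op_twocat T)"

definition has_finite_products :: "('o, 'c, 't) twocat \<Rightarrow> bool" where
  "has_finite_products T \<longleftrightarrow> (\<forall>Gs. set Gs \<subseteq> Obj T \<longrightarrow> (\<exists>P ps. is_product T Gs P ps))"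

abbreviation has_finite_coproducts :: "('o, 'c, 't) twocat \<Rightarrow> bool" where
  "has_finite_coproducts T \<equiv> has_finite_products (op_twocat T)"

text \<open>A choice of binary products \<open>Prod G H\<close> of objects and \<open>ProdMap u v\<close> of 1-cells, with the
  2-cells \<open>Pr1Nat u v : Pr1 \<circ> (u \<times> v) \<Rightarrow> u \<circ> Pr1\<close> and \<open>Pr2Nat u v : Pr2 \<circ> (u \<times> v) \<Rightarrow> v \<circ> Pr2\<close>
  that characterize \<open>u \<times> v\<close> up to a unique invertible 2-cell. When applied to \<open>op_twocat T\<close>,
  the same data is a choice of binary coproducts in \<open>T\<close>.\<close>

record ('o, 'c, 't) prods =
  Prod :: "'o \<Rightarrow> 'o \<Rightarrow> 'o"
  Pr1 :: "'o \<Rightarrow> 'o \<Rightarrow> 'c"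
  Pr2 :: "'o \<Rightarrow> 'o \<Rightarrow> 'c"
  ProdMap :: "'c \<Rightarrow> 'c \<Rightarrow> 'c"
  Pr1Nat :: "'c \<Rightarrow> 'c \<Rightarrow> 't"
  Pr2Nat :: "'c \<Rightarrow> 'c \<Rightarrow> 't"

definition binary_products :: "('o, 'c, 't) twocat \<Rightarrow> ('o, 'c, 't) prods \<Rightarrow> bool" where
  "binary_products T S \<longleftrightarrow>
     (\<forall>G \<in> Obj T. \<forall>H \<in> Obj T. is_product T [G, H] (Prod S G H) [Pr1 S G H, Pr2 S G H]) \<and>
     (\<forall>G H G' H'. \<forall>u \<in> Hom1 T G G'. \<forall>v \<in> Hom1 T H H'.
        ProdMap S u v \<in> Hom1 T (Prod S G H) (Prod S G' H') \<and>
        Pr1Nat S u v \<in> Hom2 T (Pr1 S G' H' \<circ>1\<^bsub>T\<^esub> ProdMap S u v) (u \<circ>1\<^bsub>T\<^esub> Pr1 S G H) \<and>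
        Pr2Nat S u v \<in> Hom2 T (Pr2 S G' H' \<circ>1\<^bsub>T\<^esub> ProdMap S u v) (v \<circ>1\<^bsub>T\<^esub> Pr2 S G H) \<and>
        iso_arr (Cells2 T) (Pr1Nat S u v) \<and> iso_arr (Cells2 T) (Pr2Nat S u v))"

abbreviation binary_coproducts :: "('o, 'c, 't) twocat \<Rightarrow> ('o, 'c, 't) prods \<Rightarrow> bool" where
  "binary_coproducts T \<equiv> binary_products (op_twocat T)"

text \<open>The pseudofunctor \<open>(u, v) \<mapsto> u \<squnion> v\<close> from the product of the slices over \<open>G\<close> and \<open>H\<close> to the
  slice over \<open>G \<squnion> H\<close>. Here \<open>Pr1\<close>, \<open>Pr2\<close> are the coproduct inclusions, and
  \<open>Pr1Nat u v : (u \<squnion> v) \<circ> Pr1 \<Rightarrow> Pr1 \<circ> u\<close>. The triangle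
  \<open>u \<squnion> v \<Rightarrow> (u' \<squnion> v') \<circ> (f \<squnion> g)\<close> of the image of a pair of 1-cells, and the image \<open>\<alpha> \<squnion> \<beta>\<close> of a
  pair of 2-cells, are determined by their restrictions along the two inclusions.\<close>

definition sum_triangle ::
  "('o, 'c, 't) twocat \<Rightarrow> ('o, 'c, 't) prods \<Rightarrow>
   'c \<times> 'c \<times> 'c \<times> 't \<Rightarrow> 'c \<times> 'c \<times> 'c \<times> 't \<Rightarrow> 't \<Rightarrow> bool" where
  "sum_triangle T S = (\<lambda>(u, u', f, \<phi>) (v, v', g, \<psi>) \<chi>.
     (let X = Dom1 T u; Y = Dom1 T v; G = Cod1 T u; H = Cod1 T v;
          s = ProdMap S u v; s' = ProdMap S u' v'; t = ProdMap S f g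
      in \<chi> \<in> Hom2 T s (s' \<circ>1\<^bsub>T\<^esub> t) \<and>
         rwhisker T (Pr1Nat S u' v') f \<cdot>2\<^bsub>T\<^esub> lwhisker T s' (Pr1Nat S f g)
             \<cdot>2\<^bsub>T\<^esub> rwhisker T \<chi> (Pr1 S X Y)
           = lwhisker T (Pr1 S G H) \<phi> \<cdot>2\<^bsub>T\<^esub> Pr1Nat S u v \<and>
         rwhisker T (Pr2Nat S u' v') g \<cdot>2\<^bsub>T\<^esub> lwhisker T s' (Pr2Nat S f g)
             \<cdot>2\<^bsub>T\<^esub> rwhisker T \<chi> (Pr2 S X Y)
           = lwhisker T (Pr2 S G H) \<psi> \<cdot>2\<^bsub>T\<^esub> Pr2Nat S u v))"

definition sum_2cell ::
  "('o, 'c, 't) twocat \<Rightarrow> ('o, 'c, 't) prods \<Rightarrow> 'c \<Rightarrow> 'c \<Rightarrow> 'c \<Rightarrow> 'c \<Rightarrow> 't \<Rightarrow> 't \<Rightarrow> 't \<Rightarrow> bool" where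
  "sum_2cell T S f g f' g' \<alpha> \<beta> \<sigma> \<longleftrightarrow>
     (let X = Dom1 T f; Y = Dom1 T g; X' = Cod1 T f; Y' = Cod1 T g
      in \<sigma> \<in> Hom2 T (ProdMap S f g) (ProdMap S f' g') \<and>
         Pr1Nat S f' g' \<cdot>2\<^bsub>T\<^esub> rwhisker T \<sigma> (Pr1 S X Y)
           = lwhisker T (Pr1 S X' Y') \<alpha> \<cdot>2\<^bsub>T\<^esub> Pr1Nat S f g \<and>
         Pr2Nat S f' g' \<cdot>2\<^bsub>T\<^esub> rwhisker T \<sigma> (Pr2 S X Y)
           = lwhisker T (Pr2 S X' Y') \<beta> \<cdot>2\<^bsub>T\<^esub> Pr2Nat S f g)"

definition sum_map0 :: "('o, 'c, 't) prods \<Rightarrow> 'c \<times> 'c \<Rightarrow> 'c" where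
  "sum_map0 S = (\<lambda>(u, v). ProdMap S u v)"

definition sum_map1 ::
  "('o, 'c, 't) twocat \<Rightarrow> ('o, 'c, 't) prods \<Rightarrow>
   ('c \<times> 'c \<times> 'c \<times> 't) \<times> ('c \<times> 'c \<times> 'c \<times> 't) \<Rightarrow> 'c \<times> 'c \<times> 'c \<times> 't" where
  "sum_map1 T S = (\<lambda>((u, u', f, \<phi>), (v, v', g, \<psi>)).
     (ProdMap S u v, ProdMap S u' v', ProdMap S f g,
      THE \<chi>. sum_triangle T S (u, u', f, \<phi>) (v, v', g, \<psi>) \<chi>))"

definition sum_map2 ::
  "('o, 'c, 't) twocat \<Rightarrow> ('o, 'c, 't) prods \<Rightarrow>
   (('c \<times> 'c \<times> 'c \<times> 't) \<times> ('c \<times> 'c \<times> 'c \<times> 't) \<times> 't) \<times>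
   (('c \<times> 'c \<times> 'c \<times> 't) \<times> ('c \<times> 'c \<times> 'c \<times> 't) \<times> 't) \<Rightarrow>
   ('c \<times> 'c \<times> 'c \<times> 't) \<times> ('c \<times> 'c \<times> 'c \<times> 't) \<times> 't" where
  "sum_map2 T S = (\<lambda>(((u, u', f, \<phi>), a', \<alpha>), ((v, v', g, \<psi>), b', \<beta>)).
     (sum_map1 T S ((u, u', f, \<phi>), (v, v', g, \<psi>)), sum_map1 T S (a', b'),
      THE \<sigma>. sum_2cell T S f g (fst (snd (snd a'))) (fst (snd (snd b'))) \<alpha> \<beta> \<sigma>))"

text \<open>The choice of coproducts is irrelevant here, as they are unique up to equivalence.\<close>

definition extensive :: "('o, 'c, 't) twocat \<Rightarrow> bool" where
  "extensive T \<longleftrightarrow>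
     has_finite_coproducts T \<and>
     (\<exists>S. binary_coproducts T S \<and>
        (\<forall>G \<in> Obj T. \<forall>H \<in> Obj T.
           biequivalence (prod_twocat (slice T G) (slice T H)) (slice T (Prod S G H))
             (sum_map0 S) (sum_map1 T S) (sum_map2 T S)))"

text \<open>A Mackey square: a pseudopullback
  \<open>p : P \<rightarrow> H\<close>, \<open>q : P \<rightarrow> K\<close>, \<open>\<gamma> : i p \<Rightarrow> u q\<close> of \<open>i : H \<rightarrow> G\<close> and \<open>u : K \<rightarrow> G\<close>.\<close>

definition mackey_square ::
  "('o, 'c, 't) twocat \<Rightarrow> 'c \<Rightarrow> 'c \<Rightarrow> 'c \<Rightarrow> 'c \<Rightarrow> 't \<Rightarrow> bool" where
  "mackey_square T i u p q \<gamma> \<longleftrightarrow>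
     (\<exists>P H K G.
        i \<in> Hom1 T H G \<and> u \<in> Hom1 T K G \<and> p \<in> Hom1 T P H \<and> q \<in> Hom1 T P K \<and>
        \<gamma> \<in> Hom2 T (i \<circ>1\<^bsub>T\<^esub> p) (u \<circ>1\<^bsub>T\<^esub> q) \<and> iso_arr (Cells2 T) \<gamma> \<and>
        (\<forall>X \<in> Obj T.
           is_equivalence (hom_cat T X P)
             (iso_comma (hom_cat T X H) (hom_cat T X K) (hom_cat T X G) (post_fctr T i) (post_fctr T u))
             (let F0 = (\<lambda>f. (p \<circ>1\<^bsub>T\<^esub> f, q \<circ>1\<^bsub>T\<^esub> f, rwhisker T \<gamma> f)) in
              \<lparr>obj_map = F0,
               arr_map = (\<lambda>\<alpha>. (F0 (Dom (Cells2 T) \<alpha>), F0 (Cod (Cells2 T) \<alpha>),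
                                lwhisker T p \<alpha>, lwhisker T q \<alpha>))\<rparr>)))"


section \<open>Spannable pairs\<close>

text \<open>The 2-full 2-subcategory is given by its set \<open>J\<close> of 1-cells; it contains all objects since
  it contains all equivalences. Smallness conditions are void, as all carriers are sets.\<close>

definition spannable_pair :: "('o, 'c, 't) twocat \<Rightarrow> 'c set \<Rightarrow> bool" where
  "spannable_pair T J \<longleftrightarrow>
     is_21_category T \<and> extensive T \<and>
     J \<subseteq> Cell1 T \<and>
     (\<forall>i \<in> J. \<forall>j \<in> J. Dom1 T i = Cod1 T j \<longrightarrow> i \<circ>1\<^bsub>T\<^esub> j \<in> J) \<and>
     (\<forall>e. is_equivalence1 T e \<longrightarrow> e \<in> J) \<and>
     (\<forall>i \<in> J. \<forall>j. isomorphic1 T i j \<longrightarrow> j \<in> J) \<and>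
     (\<forall>i \<in> J. \<forall>u \<in> Cell1 T. Cod1 T u = Cod1 T i \<longrightarrow>
        (\<exists>p q \<gamma>. mackey_square T i u p q \<gamma> \<and> q \<in> J)) \<and>
     (\<forall>G \<in> Obj T. \<forall>us C js w.
        (\<forall>u \<in> set us. u \<in> Cell1 T \<and> Cod1 T u = G) \<and>
        is_coproduct T (map (Dom1 T) us) C js \<and> w \<in> Hom1 T C G \<and>
        list_all2 (\<lambda>j u. isomorphic1 T (w \<circ>1\<^bsub>T\<^esub> j) u) js us
        \<longrightarrow> (w \<in> J \<longleftrightarrow> set us \<subseteq> J))"

definition cartesian_spannable_pair ::
  "('o, 'c, 't) twocat \<Rightarrow> 'c set \<Rightarrow> ('o, 'c, 't) prods \<Rightarrow> bool" where
  "cartesian_spannable_pair T J S \<longleftrightarrow>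
     spannable_pair T J \<and> has_finite_products T \<and> binary_products T S \<and>
     (\<forall>i \<in> J. \<forall>j \<in> J. ProdMap S i j \<in> J)"


section \<open>Rectified Mackey 2-functors\<close>

record ('o, 'c, 't, 'a, 'm, 'k) two_functor =
  Val :: "'o \<Rightarrow> ('a, 'm, 'k) lincat"
  Pull :: "'c \<Rightarrow> ('a, 'm, 'a, 'm) fctr"
  Pull2 :: "'t \<Rightarrow> 'a \<Rightarrow> 'm"

text \<open>Strict contravariant 2-functors: \<open>u : H \<rightarrow> G\<close> is sent to \<open>Pull M u : M(G) \<rightarrow> M(H)\<close>, and a
  2-cell \<open>u \<Rightarrow> v\<close> to a natural transformation \<open>Pull M u \<Rightarrow> Pull M v\<close>.\<close>

definition is_two_functor ::
  "target \<Rightarrow> 'k ring \<Rightarrow> ('o, 'c, 't) twocat \<Rightarrow>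
   ('o, 'c, 't, 'a, 'm, 'k, 'z) two_functor_scheme \<Rightarrow> bool" where
  "is_two_functor A k T M \<longleftrightarrow>
     (\<forall>G \<in> Obj T. target_object A k (Val M G)) \<and>
     (\<forall>H G. \<forall>u \<in> Hom1 T H G. linear_functor k (Val M G) (Val M H) (Pull M u)) \<and>
     (\<forall>H G. \<forall>u \<in> Hom1 T H G. \<forall>v. \<forall>\<alpha> \<in> Hom2 T u v.
        nat_trans (Val M G) (Val M H) (Pull M u) (Pull M v) (Pull2 M \<alpha>)) \<and>
     (\<forall>G \<in> Obj T. eq_fctr (Val M G) (Pull M (Id1 T G)) id_fctr) \<and>
     (\<forall>K H G. \<forall>u \<in> Hom1 T H G. \<forall>v \<in> Hom1 T K H.
        eq_fctr (Val M G) (Pull M (u \<circ>1\<^bsub>T\<^esub> v)) (comp_fctr (Pull M v) (Pull M u))) \<and>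
     (\<forall>H G. \<forall>u \<in> Hom1 T H G. \<forall>X \<in> Ob (Val M G).
        Pull2 M (Id2 T u) X = Idt (Val M H) (Pull M u $o X)) \<and>
     (\<forall>H G. \<forall>u \<in> Hom1 T H G. \<forall>v w. \<forall>\<alpha> \<in> Hom2 T u v. \<forall>\<beta> \<in> Hom2 T v w. \<forall>X \<in> Ob (Val M G).
        Pull2 M (\<beta> \<cdot>2\<^bsub>T\<^esub> \<alpha>) X = Pull2 M \<beta> X \<cdot>\<^bsub>Val M H\<^esub> Pull2 M \<alpha> X) \<and>
     (\<forall>K H G. \<forall>u \<in> Hom1 T H G. \<forall>v \<in> Hom1 T K H. \<forall>u' v'.
        \<forall>\<alpha> \<in> Hom2 T u u'. \<forall>\<beta> \<in> Hom2 T v v'. \<forall>X \<in> Ob (Val M G).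
        Pull2 M (\<alpha> \<star>\<^bsub>T\<^esub> \<beta>) X = Pull2 M \<beta> (Pull M u' $o X) \<cdot>\<^bsub>Val M K\<^esub> (Pull M v $a Pull2 M \<alpha> X))"

record ('o, 'c, 't, 'a, 'm, 'k) mackey = "('o, 'c, 't, 'a, 'm, 'k) two_functor" +
  LPush :: "'c \<Rightarrow> ('a, 'm, 'a, 'm) fctr"
  LUnit :: "'c \<Rightarrow> 'a \<Rightarrow> 'm"
  LCounit :: "'c \<Rightarrow> 'a \<Rightarrow> 'm"
  RPush :: "'c \<Rightarrow> ('a, 'm, 'a, 'm) fctr"
  RUnit :: "'c \<Rightarrow> 'a \<Rightarrow> 'm"
  RCounit :: "'c \<Rightarrow> 'a \<Rightarrow> 'm"

text \<open>The base change maps \<open>\<gamma>\<^sub>! : q\<^sub>! p\<^sup>* \<Rightarrow> u\<^sup>* i\<^sub>!\<close> and \<open>(\<gamma>\<inverse>)\<^sub>* : u\<^sup>* i\<^sub>* \<Rightarrow> q\<^sub>* p\<^sup>*\<close> at an object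
  \<open>Y\<close> of \<open>M(H)\<close>, where \<open>\<gamma> : i p \<Rightarrow> u q\<close>.\<close>

definition left_base_change ::
  "('o, 'c, 't) twocat \<Rightarrow> ('o, 'c, 't, 'a, 'm, 'k) mackey \<Rightarrow>
   'c \<Rightarrow> 'c \<Rightarrow> 'c \<Rightarrow> 'c \<Rightarrow> 't \<Rightarrow> 'a \<Rightarrow> 'm" where
  "left_base_change T M i u p q \<gamma> Y =
     LCounit M q (Pull M u $o LPush M i $o Y) \<cdot>\<^bsub>Val M (Cod1 T q)\<^esub>
     (LPush M q $a Pull2 M \<gamma> (LPush M i $o Y)) \<cdot>\<^bsub>Val M (Cod1 T q)\<^esub>
     (LPush M q $a Pull M p $a LUnit M i Y)"

definition right_base_change ::
  "('o, 'c, 't) twocat \<Rightarrow> ('o, 'c, 't, 'a, 'm, 'k) mackey \<Rightarrow>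
   'c \<Rightarrow> 'c \<Rightarrow> 'c \<Rightarrow> 'c \<Rightarrow> 't \<Rightarrow> 'a \<Rightarrow> 'm" where
  "right_base_change T M i u p q \<gamma> Y =
     (RPush M q $a Pull M p $a RCounit M i Y) \<cdot>\<^bsub>Val M (Cod1 T q)\<^esub>
     (RPush M q $a Pull2 M (inv_arr (Cells2 T) \<gamma>) (RPush M i $o Y)) \<cdot>\<^bsub>Val M (Cod1 T q)\<^esub>
     RUnit M q (Pull M u $o RPush M i $o Y)"

definition mackey_2_functor ::
  "target \<Rightarrow> 'k ring \<Rightarrow> ('o, 'c, 't) twocat \<Rightarrow> 'c set \<Rightarrow>
   ('o, 'c, 't, 'a, 'm, 'k) mackey \<Rightarrow> bool" where
  "mackey_2_functor A k T J M \<longleftrightarrow>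
     is_two_functor A k T M \<and>
     (\<forall>Hs C js. is_coproduct T Hs C js \<longrightarrow>
        is_equivalence (Val M C) (list_cat (map (Val M) Hs))
          \<lparr>obj_map = \<lambda>X. map (\<lambda>j. Pull M j $o X) js, arr_map = \<lambda>f. map (\<lambda>j. Pull M j $a f) js\<rparr>) \<and>
     (\<forall>H G. \<forall>i \<in> J \<inter> Hom1 T H G.
        linear_functor k (Val M H) (Val M G) (LPush M i) \<and>
        adjunction (Val M H) (Val M G) (LPush M i) (Pull M i) (LUnit M i) (LCounit M i) \<and>
        linear_functor k (Val M H) (Val M G) (RPush M i) \<and>
        adjunction (Val M G) (Val M H) (Pull M i) (RPush M i) (RUnit M i) (RCounit M i)) \<and>
     (\<forall>i \<in> J. \<forall>u p. \<forall>q \<in> J. \<forall>\<gamma>. mackey_square T i u p q \<gamma> \<longrightarrow>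
        (\<forall>Y \<in> Ob (Val M (Dom1 T i)).
           iso_arr (Val M (Cod1 T q)) (left_base_change T M i u p q \<gamma> Y) \<and>
           iso_arr (Val M (Cod1 T q)) (right_base_change T M i u p q \<gamma> Y))) \<and>
     (\<forall>H G. \<forall>i \<in> J \<inter> Hom1 T H G.
        naturally_isomorphic (Val M H) (Val M G) (LPush M i) (RPush M i))"

text \<open>The structure of the pseudofunctors \<open>i \<mapsto> i\<^sub>!\<close> and \<open>i \<mapsto> i\<^sub>*\<close> on \<open>J\<close> (contravariant on 2-cells),
  i.e. the mates of the identities \<open>j\<^sup>* i\<^sup>* = (i j)\<^sup>*\<close> and of \<open>\<alpha>\<^sup>* : i\<^sup>* \<Rightarrow> i'\<^sup>*\<close>:
  \<open>(i j)\<^sub>! Y \<rightarrow> i\<^sub>! j\<^sub>! Y\<close>, \<open>i\<^sub>* j\<^sub>* Y \<rightarrow> (i j)\<^sub>* Y\<close>, \<open>\<alpha>\<^sub>! : i'\<^sub>! Y \<rightarrow> i\<^sub>! Y\<close> and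
  \<open>\<alpha>\<^sub>* : i'\<^sub>* Y \<rightarrow> i\<^sub>* Y\<close>.
  The unit structure is given by the counit \<open>id\<^sub>! X \<rightarrow> X\<close> and the unit \<open>X \<rightarrow> id\<^sub>* X\<close>.\<close>

definition LPush_comp ::
  "('o, 'c, 't) twocat \<Rightarrow> ('o, 'c, 't, 'a, 'm, 'k) mackey \<Rightarrow> 'c \<Rightarrow> 'c \<Rightarrow> 'a \<Rightarrow> 'm" where
  "LPush_comp T M i j Y =
     LCounit M (i \<circ>1\<^bsub>T\<^esub> j) (LPush M i $o LPush M j $o Y) \<cdot>\<^bsub>Val M (Cod1 T i)\<^esub>
     (LPush M (i \<circ>1\<^bsub>T\<^esub> j) $a Pull M j $a LUnit M i (LPush M j $o Y)) \<cdot>\<^bsub>Val M (Cod1 T i)\<^esub>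
     (LPush M (i \<circ>1\<^bsub>T\<^esub> j) $a LUnit M j Y)"

definition RPush_comp ::
  "('o, 'c, 't) twocat \<Rightarrow> ('o, 'c, 't, 'a, 'm, 'k) mackey \<Rightarrow> 'c \<Rightarrow> 'c \<Rightarrow> 'a \<Rightarrow> 'm" where
  "RPush_comp T M i j Y =
     (RPush M (i \<circ>1\<^bsub>T\<^esub> j) $a RCounit M j Y) \<cdot>\<^bsub>Val M (Cod1 T i)\<^esub>
     (RPush M (i \<circ>1\<^bsub>T\<^esub> j) $a Pull M j $a RCounit M i (RPush M j $o Y)) \<cdot>\<^bsub>Val M (Cod1 T i)\<^esub>
     RUnit M (i \<circ>1\<^bsub>T\<^esub> j) (RPush M i $o RPush M j $o Y)"

definition LPush_2cell ::
  "('o, 'c, 't) twocat \<Rightarrow> ('o, 'c, 't, 'a, 'm, 'k) mackey \<Rightarrow> 'c \<Rightarrow> 'c \<Rightarrow> 't \<Rightarrow> 'a \<Rightarrow> 'm" where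
  "LPush_2cell T M i i' \<alpha> Y =
     LCounit M i' (LPush M i $o Y) \<cdot>\<^bsub>Val M (Cod1 T i)\<^esub>
     (LPush M i' $a Pull2 M \<alpha> (LPush M i $o Y)) \<cdot>\<^bsub>Val M (Cod1 T i)\<^esub>
     (LPush M i' $a LUnit M i Y)"

definition RPush_2cell ::
  "('o, 'c, 't) twocat \<Rightarrow> ('o, 'c, 't, 'a, 'm, 'k) mackey \<Rightarrow> 'c \<Rightarrow> 'c \<Rightarrow> 't \<Rightarrow> 'a \<Rightarrow> 'm" where
  "RPush_2cell T M i i' \<alpha> Y =
     (RPush M i $a RCounit M i' Y) \<cdot>\<^bsub>Val M (Cod1 T i)\<^esub>
     (RPush M i $a Pull2 M \<alpha> (RPush M i' $o Y)) \<cdot>\<^bsub>Val M (Cod1 T i)\<^esub>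
     RUnit M i (RPush M i' $o Y)"

definition rectified_mackey_2_functor ::
  "target \<Rightarrow> 'k ring \<Rightarrow> ('o, 'c, 't) twocat \<Rightarrow> 'c set \<Rightarrow>
   ('o, 'c, 't, 'a, 'm, 'k) mackey \<Rightarrow> bool" where
  "rectified_mackey_2_functor A k T J M \<longleftrightarrow>
     mackey_2_functor A k T J M \<and>
     (\<forall>i \<in> J. eq_fctr (Val M (Dom1 T i)) (LPush M i) (RPush M i)) \<and>
     (\<forall>G \<in> Obj T. \<forall>X \<in> Ob (Val M G).
        mutually_inverse (Val M G) (LCounit M (Id1 T G) X) (RUnit M (Id1 T G) X)) \<and>
     (\<forall>i \<in> J. \<forall>j \<in> J. Dom1 T i = Cod1 T j \<longrightarrow>
        (\<forall>Y \<in> Ob (Val M (Dom1 T j)).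
           mutually_inverse (Val M (Cod1 T i)) (LPush_comp T M i j Y) (RPush_comp T M i j Y))) \<and>
     (\<forall>i \<in> J. \<forall>i' \<in> J. \<forall>\<alpha> \<in> Hom2 T i i'. \<forall>Y \<in> Ob (Val M (Dom1 T i)).
        LPush_2cell T M i i' \<alpha> Y = RPush_2cell T M i i' \<alpha> Y) \<and>
     (\<forall>i \<in> J. \<forall>u p. \<forall>q \<in> J. \<forall>\<gamma>. mackey_square T i u p q \<gamma> \<longrightarrow>
        (\<forall>Y \<in> Ob (Val M (Dom1 T i)).
           mutually_inverse (Val M (Cod1 T q))
             (left_base_change T M i u p q \<gamma> Y) (right_base_change T M i u p q \<gamma> Y))) \<and>
     (\<forall>i \<in> J. \<forall>Y \<in> Ob (Val M (Dom1 T i)).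
        RCounit M i Y \<cdot>\<^bsub>Val M (Dom1 T i)\<^esub> LUnit M i Y = Idt (Val M (Dom1 T i)) Y)"


section \<open>Pairings\<close>

record ('o, 'c, 'a, 'm, 'b, 'n, 'd, 'l) pairing =
  POb :: "'o \<Rightarrow> 'a \<Rightarrow> 'b \<Rightarrow> 'd"
  PArr :: "'o \<Rightarrow> 'm \<Rightarrow> 'n \<Rightarrow> 'l"
  PNat :: "'c \<Rightarrow> 'a \<Rightarrow> 'b \<Rightarrow> 'l"

definition bilinear_functor ::
  "'k ring \<Rightarrow> ('a, 'm, 'k) lincat \<Rightarrow> ('b, 'n, 'k) lincat \<Rightarrow> ('d, 'l, 'k) lincat \<Rightarrow>
   ('a \<Rightarrow> 'b \<Rightarrow> 'd) \<Rightarrow> ('m \<Rightarrow> 'n \<Rightarrow> 'l) \<Rightarrow> bool" where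
  "bilinear_functor k C D E B0 B1 \<longleftrightarrow>
     is_functor (pair_cat C D) E
       \<lparr>obj_map = \<lambda>(x, y). B0 x y, arr_map = \<lambda>(f, g). B1 f g\<rparr> \<and>
     (\<forall>x x' y y'. \<forall>f \<in> Hom C x x'. \<forall>f' \<in> Hom C x x'. \<forall>g \<in> Hom D y y'. \<forall>g' \<in> Hom D y y'.
        B1 (Add C f f') g = Add E (B1 f g) (B1 f' g) \<and>
        B1 f (Add D g g') = Add E (B1 f g) (B1 f g')) \<and>
     (\<forall>x x' y y'. \<forall>f \<in> Hom C x x'. \<forall>g \<in> Hom D y y'. \<forall>r \<in> carrier k.
        B1 (Smult C r f) g = Smult E r (B1 f g) \<and> B1 f (Smult D r g) = Smult E r (B1 f g))"

text \<open>A pseudonatural transformation out of the pointwise tensor product is spelled out through the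
  universal property of that tensor product: its components are bilinear functors. This is the same
  for both targets, since bilinear functors into an idempotent complete category also factor,
  essentially uniquely, through the idempotent completion of the tensor product.\<close>

definition is_pairing ::
  "'k ring \<Rightarrow> ('o, 'c, 't) twocat \<Rightarrow>
   ('o, 'c, 't, 'a, 'm, 'k) mackey \<Rightarrow> ('o, 'c, 't, 'b, 'n, 'k) mackey \<Rightarrow>
   ('o, 'c, 't, 'd, 'l, 'k) mackey \<Rightarrow> ('o, 'c, 'a, 'm, 'b, 'n, 'd, 'l) pairing \<Rightarrow> bool" where
  "is_pairing k T M N L B \<longleftrightarrow>
     (\<forall>G \<in> Obj T. bilinear_functor k (Val M G) (Val N G) (Val L G) (POb B G) (PArr B G)) \<and>
     (\<forall>H G. \<forall>u \<in> Hom1 T H G. \<forall>X \<in> Ob (Val M G). \<forall>Y \<in> Ob (Val N G).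
        PNat B u X Y \<in> Hom (Val L H) (Pull L u $o POb B G X Y) (POb B H (Pull M u $o X) (Pull N u $o Y)) \<and>
        iso_arr (Val L H) (PNat B u X Y)) \<and>
     (\<forall>H G. \<forall>u \<in> Hom1 T H G. \<forall>X X' Y Y'. \<forall>f \<in> Hom (Val M G) X X'. \<forall>g \<in> Hom (Val N G) Y Y'.
        PNat B u X' Y' \<cdot>\<^bsub>Val L H\<^esub> (Pull L u $a PArr B G f g) =
        PArr B H (Pull M u $a f) (Pull N u $a g) \<cdot>\<^bsub>Val L H\<^esub> PNat B u X Y) \<and>
     (\<forall>G \<in> Obj T. \<forall>X \<in> Ob (Val M G). \<forall>Y \<in> Ob (Val N G).
        PNat B (Id1 T G) X Y = Idt (Val L G) (POb B G X Y)) \<and>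
     (\<forall>K H G. \<forall>u \<in> Hom1 T H G. \<forall>v \<in> Hom1 T K H. \<forall>X \<in> Ob (Val M G). \<forall>Y \<in> Ob (Val N G).
        PNat B (u \<circ>1\<^bsub>T\<^esub> v) X Y =
        PNat B v (Pull M u $o X) (Pull N u $o Y) \<cdot>\<^bsub>Val L K\<^esub> (Pull L v $a PNat B u X Y)) \<and>
     (\<forall>H G. \<forall>u \<in> Hom1 T H G. \<forall>v. \<forall>\<alpha> \<in> Hom2 T u v. \<forall>X \<in> Ob (Val M G). \<forall>Y \<in> Ob (Val N G).
        PNat B v X Y \<cdot>\<^bsub>Val L H\<^esub> Pull2 L \<alpha> (POb B G X Y) =
        PArr B H (Pull2 M \<alpha> X) (Pull2 N \<alpha> Y) \<cdot>\<^bsub>Val L H\<^esub> PNat B u X Y)"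

definition Rp1 ::
  "('o, 'c, 't) twocat \<Rightarrow>
   ('o, 'c, 't, 'a, 'm, 'k) mackey \<Rightarrow> ('o, 'c, 't, 'b, 'n, 'k) mackey \<Rightarrow>
   ('o, 'c, 't, 'd, 'l, 'k) mackey \<Rightarrow> ('o, 'c, 'a, 'm, 'b, 'n, 'd, 'l) pairing \<Rightarrow>
   'c \<Rightarrow> 'a \<Rightarrow> 'b \<Rightarrow> 'l" where
  "Rp1 T M N L B i X Y =
     (let H = Dom1 T i; G = Cod1 T i in
      (RPush L i $a PArr B H (Idt (Val M H) (Pull M i $o X)) (RCounit N i Y)) \<cdot>\<^bsub>Val L G\<^esub>
      (RPush L i $a PNat B i X (RPush N i $o Y)) \<cdot>\<^bsub>Val L G\<^esub>
      RUnit L i (POb B G X (RPush N i $o Y)))"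

definition Rp2 ::
  "('o, 'c, 't) twocat \<Rightarrow>
   ('o, 'c, 't, 'a, 'm, 'k) mackey \<Rightarrow> ('o, 'c, 't, 'b, 'n, 'k) mackey \<Rightarrow>
   ('o, 'c, 't, 'd, 'l, 'k) mackey \<Rightarrow> ('o, 'c, 'a, 'm, 'b, 'n, 'd, 'l) pairing \<Rightarrow>
   'c \<Rightarrow> 'a \<Rightarrow> 'b \<Rightarrow> 'l" where
  "Rp2 T M N L B i Y X =
     (let H = Dom1 T i; G = Cod1 T i in
      (RPush L i $a PArr B H (RCounit M i Y) (Idt (Val N H) (Pull N i $o X))) \<cdot>\<^bsub>Val L G\<^esub>
      (RPush L i $a PNat B i (RPush M i $o Y) X) \<cdot>\<^bsub>Val L G\<^esub>
      RUnit L i (POb B G (RPush M i $o Y) X))"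

definition Lp1 ::
  "('o, 'c, 't) twocat \<Rightarrow>
   ('o, 'c, 't, 'a, 'm, 'k) mackey \<Rightarrow> ('o, 'c, 't, 'b, 'n, 'k) mackey \<Rightarrow>
   ('o, 'c, 't, 'd, 'l, 'k) mackey \<Rightarrow> ('o, 'c, 'a, 'm, 'b, 'n, 'd, 'l) pairing \<Rightarrow>
   'c \<Rightarrow> 'a \<Rightarrow> 'b \<Rightarrow> 'l" where
  "Lp1 T M N L B i X Y =
     (let H = Dom1 T i; G = Cod1 T i in
      LCounit L i (POb B G X (LPush N i $o Y)) \<cdot>\<^bsub>Val L G\<^esub>
      (LPush L i $a inv_arr (Val L H) (PNat B i X (LPush N i $o Y))) \<cdot>\<^bsub>Val L G\<^esub>
      (LPush L i $a PArr B H (Idt (Val M H) (Pull M i $o X)) (LUnit N i Y)))"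

definition Lp2 ::
  "('o, 'c, 't) twocat \<Rightarrow>
   ('o, 'c, 't, 'a, 'm, 'k) mackey \<Rightarrow> ('o, 'c, 't, 'b, 'n, 'k) mackey \<Rightarrow>
   ('o, 'c, 't, 'd, 'l, 'k) mackey \<Rightarrow> ('o, 'c, 'a, 'm, 'b, 'n, 'd, 'l) pairing \<Rightarrow>
   'c \<Rightarrow> 'a \<Rightarrow> 'b \<Rightarrow> 'l" where
  "Lp2 T M N L B i Y X =
     (let H = Dom1 T i; G = Cod1 T i in
      LCounit L i (POb B G (LPush M i $o Y) X) \<cdot>\<^bsub>Val L G\<^esub>
      (LPush L i $a inv_arr (Val L H) (PNat B i (LPush M i $o Y) X)) \<cdot>\<^bsub>Val L G\<^esub>
      (LPush L i $a PArr B H (LUnit M i Y) (Idt (Val N H) (Pull N i $o X))))"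

definition projection_formulas ::
  "('o, 'c, 't) twocat \<Rightarrow> 'c set \<Rightarrow>
   ('o, 'c, 't, 'a, 'm, 'k) mackey \<Rightarrow> ('o, 'c, 't, 'b, 'n, 'k) mackey \<Rightarrow>
   ('o, 'c, 't, 'd, 'l, 'k) mackey \<Rightarrow> ('o, 'c, 'a, 'm, 'b, 'n, 'd, 'l) pairing \<Rightarrow> bool" where
  "projection_formulas T J M N L B \<longleftrightarrow>
     (\<forall>H G. \<forall>i \<in> J \<inter> Hom1 T H G.
        (\<forall>X \<in> Ob (Val M G). \<forall>Y \<in> Ob (Val N H).
           mutually_inverse (Val L G) (Lp1 T M N L B i X Y) (Rp1 T M N L B i X Y)) \<and>
        (\<forall>X \<in> Ob (Val N G). \<forall>Y \<in> Ob (Val M H).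
           mutually_inverse (Val L G) (Lp2 T M N L B i Y X) (Rp2 T M N L B i Y X)))"

text \<open>The external pairing; \<open>ExtOb\<close> and \<open>ExtArr\<close> give its values on \<open>M(G1) \<times> N(G2)\<close>.\<close>

definition ExtOb ::
  "('o, 'c, 't) prods \<Rightarrow>
   ('o, 'c, 't, 'a, 'm, 'k) mackey \<Rightarrow> ('o, 'c, 't, 'b, 'n, 'k) mackey \<Rightarrow>
   ('o, 'c, 'a, 'm, 'b, 'n, 'd, 'l) pairing \<Rightarrow> 'o \<Rightarrow> 'o \<Rightarrow> 'a \<Rightarrow> 'b \<Rightarrow> 'd" where
  "ExtOb S M N B G1 G2 X Y =
     POb B (Prod S G1 G2) (Pull M (Pr1 S G1 G2) $o X) (Pull N (Pr2 S G1 G2) $o Y)"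

definition ExtArr ::
  "('o, 'c, 't) prods \<Rightarrow>
   ('o, 'c, 't, 'a, 'm, 'k) mackey \<Rightarrow> ('o, 'c, 't, 'b, 'n, 'k) mackey \<Rightarrow>
   ('o, 'c, 'a, 'm, 'b, 'n, 'd, 'l) pairing \<Rightarrow> 'o \<Rightarrow> 'o \<Rightarrow> 'm \<Rightarrow> 'n \<Rightarrow> 'l" where
  "ExtArr S M N B G1 G2 f g =
     PArr B (Prod S G1 G2) (Pull M (Pr1 S G1 G2) $a f) (Pull N (Pr2 S G1 G2) $a g)"

text \<open>The isomorphism from the pullback along \<open>u1 \<times> u2\<close> of the external product of \<open>X\<close> and \<open>Y\<close> to
  the external product of \<open>u1\<^sup>* X\<close> and \<open>u2\<^sup>* Y\<close>.\<close>

definition ExtNat ::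
  "('o, 'c, 't) twocat \<Rightarrow> ('o, 'c, 't) prods \<Rightarrow>
   ('o, 'c, 't, 'a, 'm, 'k) mackey \<Rightarrow> ('o, 'c, 't, 'b, 'n, 'k) mackey \<Rightarrow>
   ('o, 'c, 't, 'd, 'l, 'k) mackey \<Rightarrow> ('o, 'c, 'a, 'm, 'b, 'n, 'd, 'l) pairing \<Rightarrow>
   'c \<Rightarrow> 'c \<Rightarrow> 'a \<Rightarrow> 'b \<Rightarrow> 'l" where
  "ExtNat T S M N L B u1 u2 X Y =
     (let H1 = Dom1 T u1; G1 = Cod1 T u1; H2 = Dom1 T u2; G2 = Cod1 T u2; P = Prod S H1 H2 in
      PArr B P (Pull2 M (Pr1Nat S u1 u2) X) (Pull2 N (Pr2Nat S u1 u2) Y) \<cdot>\<^bsub>Val L P\<^esub>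
      PNat B (ProdMap S u1 u2) (Pull M (Pr1 S G1 G2) $o X) (Pull N (Pr2 S G1 G2) $o Y))"

definition right_mate ::
  "('o, 'c, 't) twocat \<Rightarrow> ('o, 'c, 't) prods \<Rightarrow>
   ('o, 'c, 't, 'a, 'm, 'k) mackey \<Rightarrow> ('o, 'c, 't, 'b, 'n, 'k) mackey \<Rightarrow>
   ('o, 'c, 't, 'd, 'l, 'k) mackey \<Rightarrow> ('o, 'c, 'a, 'm, 'b, 'n, 'd, 'l) pairing \<Rightarrow>
   'c \<Rightarrow> 'c \<Rightarrow> 'a \<Rightarrow> 'b \<Rightarrow> 'l" where
  "right_mate T S M N L B i1 i2 X Y =
     (let H1 = Dom1 T i1; G1 = Cod1 T i1; H2 = Dom1 T i2; G2 = Cod1 T i2;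
          i = ProdMap S i1 i2; Q = Prod S G1 G2 in
      (RPush L i $a ExtArr S M N B H1 H2 (RCounit M i1 X) (RCounit N i2 Y)) \<cdot>\<^bsub>Val L Q\<^esub>
      (RPush L i $a ExtNat T S M N L B i1 i2 (RPush M i1 $o X) (RPush N i2 $o Y)) \<cdot>\<^bsub>Val L Q\<^esub>
      RUnit L i (ExtOb S M N B G1 G2 (RPush M i1 $o X) (RPush N i2 $o Y)))"

definition left_mate ::
  "('o, 'c, 't) twocat \<Rightarrow> ('o, 'c, 't) prods \<Rightarrow>
   ('o, 'c, 't, 'a, 'm, 'k) mackey \<Rightarrow> ('o, 'c, 't, 'b, 'n, 'k) mackey \<Rightarrow>
   ('o, 'c, 't, 'd, 'l, 'k) mackey \<Rightarrow> ('o, 'c, 'a, 'm, 'b, 'n, 'd, 'l) pairing \<Rightarrow>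
   'c \<Rightarrow> 'c \<Rightarrow> 'a \<Rightarrow> 'b \<Rightarrow> 'l" where
  "left_mate T S M N L B i1 i2 X Y =
     (let H1 = Dom1 T i1; G1 = Cod1 T i1; H2 = Dom1 T i2; G2 = Cod1 T i2;
          i = ProdMap S i1 i2; P = Prod S H1 H2; Q = Prod S G1 G2 in
      LCounit L i (ExtOb S M N B G1 G2 (LPush M i1 $o X) (LPush N i2 $o Y)) \<cdot>\<^bsub>Val L Q\<^esub>
      (LPush L i $a inv_arr (Val L P)
         (ExtNat T S M N L B i1 i2 (LPush M i1 $o X) (LPush N i2 $o Y))) \<cdot>\<^bsub>Val L Q\<^esub>
      (LPush L i $a ExtArr S M N B H1 H2 (LUnit M i1 X) (LUnit N i2 Y)))"

definition is_bimorphism ::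
  "('o, 'c, 't) twocat \<Rightarrow> 'c set \<Rightarrow> ('o, 'c, 't) prods \<Rightarrow>
   ('o, 'c, 't, 'a, 'm, 'k) mackey \<Rightarrow> ('o, 'c, 't, 'b, 'n, 'k) mackey \<Rightarrow>
   ('o, 'c, 't, 'd, 'l, 'k) mackey \<Rightarrow> ('o, 'c, 'a, 'm, 'b, 'n, 'd, 'l) pairing \<Rightarrow> bool" where
  "is_bimorphism T J S M N L B \<longleftrightarrow>
     (\<forall>H1 G1 H2 G2. \<forall>i1 \<in> J \<inter> Hom1 T H1 G1. \<forall>i2 \<in> J \<inter> Hom1 T H2 G2.
        \<forall>X \<in> Ob (Val M H1). \<forall>Y \<in> Ob (Val N H2).
        mutually_inverse (Val L (Prod S G1 G2))
          (left_mate T S M N L B i1 i2 X Y) (right_mate T S M N L B i1 i2 X Y))"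

end

theory Submission
  imports Defs
begin

text \<open>Let \<open>i : H \<rightarrow> G\<close> be in \<open>J\<close>. A morphism \<open>e : i\<^sup>* X \<rightarrow> Z\<close> has a transpose \<open>X \<rightarrow> i\<^sub>* Z\<close>, and \<open>h : Z \<rightarrow> i\<^sup>* X\<close> has a
  transpose \<open>i\<^sub>! Z \<rightarrow> X\<close>. Say that \<open>(e, h)\<close> presents \<open>X\<close> as a pushforward of \<open>Z\<close> along \<open>i\<close> if these transposes
  are mutually inverse. Both sides of the theorem have this form. The projection formulas say that
  \<open>X \<odot> i\<^sub>* Y\<close> is presented as a pushforward of \<open>i\<^sup>* X \<odot> Y\<close> along \<open>i\<close> by the pair built from \<open>\<odot>\<^sub>i\<close>, the counit
  for \<open>e\<close> and the unit for \<open>h\<close>, and symmetrically. The pairing is a bimorphism if \<open>(i1)\<^sub>* X \<box> (i2)\<^sub>* Y\<close> is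
  presented as a pushforward of \<open>X \<box> Y\<close> along \<open>i1 \<times> i2\<close> by the corresponding pair.

  Presentations compose, are transported along 2-cells and along isomorphisms of \<open>X\<close> and of \<open>Z\<close>, and
  are preserved by base change along Mackey squares; any two presentations of a pushforward differ
  by a unique isomorphism. That the left and the right half are compatible with these operations
  simultaneously is due to rectification, and this is why the mates come out mutually inverse and
  not merely invertible. Given this calculus (locale \<open>pushforwards\<close>), the two
  implications are short:

  Assume the projection formulas. The square of \<open>i1 \<times> 1\<close> over \<open>i1\<close> and that of \<open>1 \<times> i2\<close> over \<open>i2\<close> are Mackey
  squares (\<open>mackey_square_projection\<close>). By base change, \<open>\<pi>1\<^sup>* (i1)\<^sub>* X\<close> is a pushforward along \<open>i1 \<times> 1\<close> and
  \<open>\<pi>2\<^sup>* (i2)\<^sub>* Y\<close> one along \<open>1 \<times> i2\<close>. Applying both projection formulas and composing presents their product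
  as a pushforward along \<open>(i1 \<times> 1)(1 \<times> i2) \<cong> i1 \<times> i2\<close> (\<open>bimorphism_if_projections\<close>).

  Assume that the pairing is a bimorphism. Then \<open>X \<box> i\<^sub>* Y\<close> is a pushforward along \<open>1 \<times> i\<close>. The pullback of
  the diagonal of \<open>G\<close> along \<open>1 \<times> i\<close> is the graph \<open>(i, 1)\<close> of \<open>i\<close> (\<open>mackey_square_graph\<close>), and restricting
  to the diagonal gives that \<open>X \<odot> i\<^sub>* Y\<close> is a pushforward of \<open>i\<^sup>* X \<odot> Y\<close> along \<open>i\<close>
  (\<open>projection1_if_bimorphism\<close>).

  In both cases the presentation obtained is the prescribed one by naturality and by equations
  between 2-cells of \<open>T\<close>. Each such verification is needed for \<open>e\<close> and, dually, for \<open>h\<close>. To do it once,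
  \<open>(e, h)\<close> is treated as a single arrow of the double of a category, and the calculus is set up for
  2-functors with values in these doubles.\<close>

section \<open>Categories\<close>

text \<open>Arrows are typed by membership in \<open>Arr\<close> and equations for \<open>Dom\<close> and \<open>Cod\<close> instead of by
  Hom sets: a rule such as associativity then has side conditions without extra variables, and
  rewriting can settle them.\<close>

lemma mem_Hom [simp]: "f \<in> Hom C x y \<longleftrightarrow> f \<in> Arr C \<and> Dom C f = x \<and> Cod C f = y"
  by (simp add: Hom_def)

context
  fixes C :: "('a, 'm, 'z) cat_scheme" (structure)
  assumes C: "category C"
begin

interpretation category C by (rule C)

lemma Dom_in_Ob [simp]: "f \<in> Arr C \<Longrightarrow> Dom C f \<in> Ob C"
  and Cod_in_Ob [simp]: "f \<in> Arr C \<Longrightarrow> Cod C f \<in> Ob C"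
  by (auto intro: Dom_Ob Cod_Ob)

lemma Idt_arr [simp]:
  assumes "x \<in> Ob C" shows "Idt C x \<in> Arr C" "Dom C (Idt C x) = x" "Cod C (Idt C x) = x"
  using Idt_Hom[OF assms] by auto

lemma comp_arr [simp]:
  assumes "f \<in> Arr C" "g \<in> Arr C" "Dom C g = Cod C f"
  shows "g \<cdot> f \<in> Arr C" "Dom C (g \<cdot> f) = Dom C f" "Cod C (g \<cdot> f) = Cod C g"
  using Comp_Hom[of f "Dom C f" "Cod C f" g "Cod C g"] assms by auto

lemma comp_idt [simp]: "f \<in> Arr C \<Longrightarrow> Dom C f = x \<Longrightarrow> f \<cdot> Idt C x = f"
  using Comp_Idt[of f x "Cod C f"] by auto

lemma idt_comp [simp]: "f \<in> Arr C \<Longrightarrow> Cod C f = x \<Longrightarrow> Idt C x \<cdot> f = f"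
  using Idt_Comp[of f "Dom C f" x] by auto

lemma comp_assoc [simp]:
  "f \<in> Arr C \<Longrightarrow> g \<in> Arr C \<Longrightarrow> h \<in> Arr C \<Longrightarrow> Dom C g = Cod C f \<Longrightarrow> Dom C h = Cod C g \<Longrightarrow>
     (h \<cdot> g) \<cdot> f = h \<cdot> (g \<cdot> f)"
  using Comp_assoc[of f "Dom C f" "Cod C f" g "Cod C g" h "Cod C h"] by auto

lemma inverse_unique:
  assumes "mutually_inverse C f g" "mutually_inverse C f h" shows "g = h"
proof -
  have "g = (h \<cdot> f) \<cdot> g" using assms unfolding mutually_inverse_def by auto
  also have "\<dots> = h \<cdot> (f \<cdot> g)" using assms unfolding mutually_inverse_def by (intro comp_assoc) auto
  also have "\<dots> = h" using assms unfolding mutually_inverse_def by auto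
  finally show ?thesis .
qed

lemma inv_arr_eqI: "mutually_inverse C f g \<Longrightarrow> inv_arr C f = g"
  unfolding inv_arr_def using inverse_unique by blast

lemma mutually_inverse_inv_arr: "iso_arr C f \<Longrightarrow> mutually_inverse C f (inv_arr C f)"
  unfolding iso_arr_def using inv_arr_eqI by metis

lemma mutually_inverse_sym: "mutually_inverse C f g \<longleftrightarrow> mutually_inverse C g f"
  unfolding mutually_inverse_def by auto

lemma iso_is_arr: "iso_arr C f \<Longrightarrow> f \<in> Arr C"
  unfolding iso_arr_def mutually_inverse_def by auto

lemma inv_arr_props [simp]:
  assumes "iso_arr C f"
  shows "inv_arr C f \<in> Arr C" "Dom C (inv_arr C f) = Cod C f" "Cod C (inv_arr C f) = Dom C f"
    "inv_arr C f \<cdot> f = Idt C (Dom C f)" "f \<cdot> inv_arr C f = Idt C (Cod C f)"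
    "iso_arr C (inv_arr C f)" "inv_arr C (inv_arr C f) = f"
proof -
  note m = mutually_inverse_inv_arr[OF assms]
  then show "inv_arr C f \<in> Arr C" "Dom C (inv_arr C f) = Cod C f" "Cod C (inv_arr C f) = Dom C f"
    "inv_arr C f \<cdot> f = Idt C (Dom C f)" "f \<cdot> inv_arr C f = Idt C (Cod C f)"
    unfolding mutually_inverse_def by auto
  have m': "mutually_inverse C (inv_arr C f) f" using m mutually_inverse_sym by blast
  then show "iso_arr C (inv_arr C f)" unfolding iso_arr_def by blast
  show "inv_arr C (inv_arr C f) = f" by (rule inv_arr_eqI[OF m'])
qed

lemma inv_arr_cancel [simp]:
  assumes "iso_arr C f" "x \<in> Arr C"
  shows "Cod C x = Dom C f \<Longrightarrow> inv_arr C f \<cdot> (f \<cdot> x) = x"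
    and "Cod C x = Cod C f \<Longrightarrow> f \<cdot> (inv_arr C f \<cdot> x) = x"
  using assms iso_is_arr[OF assms(1)] by (simp_all flip: comp_assoc)

text \<open>Composites are associated to the right by rewriting, so an equation between short composites
  has to be extended by a tail before it applies inside a longer one.\<close>

lemma comp_eq_extend:
  assumes "a \<cdot> b = c" "a \<in> Arr C" "b \<in> Arr C" "x \<in> Arr C" "Dom C a = Cod C b" "Dom C b = Cod C x"
  shows "a \<cdot> (b \<cdot> x) = c \<cdot> x"
  using assms by (simp flip: comp_assoc)

lemma comp_left_cancel:
  assumes "f \<cdot> x = f \<cdot> y" "iso_arr C f" "x \<in> Arr C" "y \<in> Arr C" "Cod C x = Dom C f" "Cod C y = Dom C f"
  shows "x = y"
  using assms by (metis inv_arr_cancel(1))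

lemma comp_right_cancel:
  assumes "x \<cdot> f = y \<cdot> f" "iso_arr C f" "x \<in> Arr C" "y \<in> Arr C" "Dom C x = Cod C f" "Dom C y = Cod C f"
  shows "x = y"
proof -
  have "x \<cdot> (f \<cdot> inv_arr C f) = y \<cdot> (f \<cdot> inv_arr C f)"
    using assms iso_is_arr[OF assms(2)] by (simp del: inv_arr_props(5) flip: comp_assoc)
  then show ?thesis using assms by simp
qed

lemma mutually_inverse_comp:
  assumes "mutually_inverse C f f'" "mutually_inverse C g g'" "Dom C g = Cod C f"
  shows "mutually_inverse C (g \<cdot> f) (f' \<cdot> g')"
proof -
  have [simp]: "f \<in> Arr C" "f' \<in> Arr C" "g \<in> Arr C" "g' \<in> Arr C" "Dom C f' = Cod C f"
    "Cod C f' = Dom C f" "Dom C g' = Cod C g" "Cod C g' = Cod C f" "Dom C g = Cod C f"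
    using assms unfolding mutually_inverse_def by auto
  have "g' \<cdot> (g \<cdot> f) = f" "f \<cdot> (f' \<cdot> g') = g'"
    using assms unfolding mutually_inverse_def by (auto simp flip: comp_assoc)
  then show ?thesis using assms unfolding mutually_inverse_def by simp
qed

lemma inv_arr_comp:
  assumes "iso_arr C f" "iso_arr C g" "Dom C g = Cod C f"
  shows "inv_arr C (g \<cdot> f) = inv_arr C f \<cdot> inv_arr C g"
  by (rule inv_arr_eqI) (use assms in \<open>simp add: mutually_inverse_comp mutually_inverse_inv_arr\<close>)

text \<open>Naturality of a family of isomorphisms carries over to the inverses through this conjugation.\<close>

lemma inv_arr_square:
  assumes "a \<cdot> x = y \<cdot> b" "iso_arr C a" "iso_arr C b" "x \<in> Arr C" "y \<in> Arr C"
    "Cod C x = Dom C a" "Dom C x = Dom C b" "Dom C y = Cod C b" "Cod C y = Cod C a"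
  shows "x \<cdot> inv_arr C b = inv_arr C a \<cdot> y"
proof -
  have [simp]: "a \<in> Arr C" "b \<in> Arr C" using assms iso_is_arr by auto
  have "x \<cdot> inv_arr C b = inv_arr C a \<cdot> ((a \<cdot> x) \<cdot> inv_arr C b)" using assms(2-) C by simp
  also have "\<dots> = inv_arr C a \<cdot> y" unfolding assms(1) using assms(2-) C by simp
  finally show ?thesis .
qed

lemma iso_arr_comp [simp]:
  "iso_arr C f \<Longrightarrow> iso_arr C g \<Longrightarrow> Dom C g = Cod C f \<Longrightarrow> iso_arr C (g \<cdot> f)"
  using mutually_inverse_comp unfolding iso_arr_def by blast

end


section \<open>Whiskering in a 2-category\<close>

abbreviation "Dom2 T \<equiv> Dom (Cells2 T)"
abbreviation "Cod2 T \<equiv> Cod (Cells2 T)"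

context two_category
begin

lemmas [simp] = category1 category2 Ob_Cells2

lemma cell2_arr [simp]:
  assumes "\<alpha> \<in> Cell2 T"
  shows "Dom2 T \<alpha> \<in> Cell1 T" "Cod2 T \<alpha> \<in> Cell1 T"
    "Dom1 T (Cod2 T \<alpha>) = Dom1 T (Dom2 T \<alpha>)" "Cod1 T (Cod2 T \<alpha>) = Cod1 T (Dom2 T \<alpha>)"
  using Dom_in_Ob[OF category2 assms] Cod_in_Ob[OF category2 assms]
    parallel[of \<alpha> "Dom2 T \<alpha>" "Cod2 T \<alpha>"] assms by auto

text \<open>Horizontal composition is used only through whiskering. Rewriting brings whiskered cells to a normal
  form in which left whiskers stand inside right whiskers and composites of 1-cells are split up;
  the exchange law is the only rule that is left to be applied by hand.\<close>

lemma HComp_arr: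
  assumes "\<alpha> \<in> Cell2 T" "\<beta> \<in> Cell2 T" "Dom1 T (Dom2 T \<beta>) = Cod1 T (Dom2 T \<alpha>)"
  shows "\<beta> \<star> \<alpha> \<in> Cell2 T" "Dom2 T (\<beta> \<star> \<alpha>) = Dom2 T \<beta> \<circ>1 Dom2 T \<alpha>"
    "Cod2 T (\<beta> \<star> \<alpha>) = Cod2 T \<beta> \<circ>1 Cod2 T \<alpha>"
  using HComp_Hom[of "Dom2 T \<alpha>" _ _ "Dom2 T \<beta>" _ \<alpha> "Cod2 T \<alpha>" \<beta> "Cod2 T \<beta>"] assms by auto

lemma lwhisker_arr [simp]:
  assumes "\<alpha> \<in> Cell2 T" "g \<in> Cell1 T" "Dom1 T g = Cod1 T (Dom2 T \<alpha>)"
  shows "lwhisker T g \<alpha> \<in> Cell2 T" "Dom2 T (lwhisker T g \<alpha>) = g \<circ>1 Dom2 T \<alpha>"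
    "Cod2 T (lwhisker T g \<alpha>) = g \<circ>1 Cod2 T \<alpha>"
  unfolding lwhisker_def using assms HComp_arr by auto

lemma rwhisker_arr [simp]:
  assumes "\<alpha> \<in> Cell2 T" "f \<in> Cell1 T" "Dom1 T (Dom2 T \<alpha>) = Cod1 T f"
  shows "rwhisker T \<alpha> f \<in> Cell2 T" "Dom2 T (rwhisker T \<alpha> f) = Dom2 T \<alpha> \<circ>1 f"
    "Cod2 T (rwhisker T \<alpha> f) = Cod2 T \<alpha> \<circ>1 f"
  unfolding rwhisker_def using assms HComp_arr by auto

lemma interchange':
  assumes "\<alpha> \<in> Cell2 T" "\<alpha>' \<in> Cell2 T" "\<beta> \<in> Cell2 T" "\<beta>' \<in> Cell2 T"
    "Cod2 T \<alpha> = Dom2 T \<alpha>'" "Cod2 T \<beta> = Dom2 T \<beta>'" "Dom1 T (Dom2 T \<beta>) = Cod1 T (Dom2 T \<alpha>)"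
  shows "(\<beta>' \<cdot>2 \<beta>) \<star> (\<alpha>' \<cdot>2 \<alpha>) = (\<beta>' \<star> \<alpha>') \<cdot>2 (\<beta> \<star> \<alpha>)"
  by (rule interchange[of "Dom2 T \<alpha>" _ _ "Dom2 T \<beta>" _ \<alpha> "Dom2 T \<alpha>'" \<alpha>' "Cod2 T \<alpha>'" \<beta> "Dom2 T \<beta>'" \<beta>' "Cod2 T \<beta>'"])
    (use assms in auto)

lemma lwhisker_comp [simp]:
  assumes "\<alpha> \<in> Cell2 T" "\<alpha>' \<in> Cell2 T" "Dom2 T \<alpha>' = Cod2 T \<alpha>" "g \<in> Cell1 T" "Dom1 T g = Cod1 T (Dom2 T \<alpha>)"
  shows "lwhisker T g (\<alpha>' \<cdot>2 \<alpha>) = lwhisker T g \<alpha>' \<cdot>2 lwhisker T g \<alpha>"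
  using interchange'[of \<alpha> \<alpha>' "Id2 T g" "Id2 T g"] assms unfolding lwhisker_def by simp

lemma rwhisker_comp [simp]:
  assumes "\<alpha> \<in> Cell2 T" "\<alpha>' \<in> Cell2 T" "Dom2 T \<alpha>' = Cod2 T \<alpha>" "f \<in> Cell1 T" "Dom1 T (Dom2 T \<alpha>) = Cod1 T f"
  shows "rwhisker T (\<alpha>' \<cdot>2 \<alpha>) f = rwhisker T \<alpha>' f \<cdot>2 rwhisker T \<alpha> f"
  using interchange'[of "Id2 T f" "Id2 T f" \<alpha> \<alpha>'] assms unfolding rwhisker_def by simp

lemma HComp_Id2' [simp]:
  assumes "f \<in> Cell1 T" "g \<in> Cell1 T" "Dom1 T g = Cod1 T f"
  shows "Id2 T g \<star> Id2 T f = Id2 T (g \<circ>1 f)"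
  by (rule HComp_Id2) (use assms in auto)

lemma whisker_Id2 [simp]:
  assumes "f \<in> Cell1 T" "g \<in> Cell1 T" "Dom1 T g = Cod1 T f"
  shows "lwhisker T g (Id2 T f) = Id2 T (g \<circ>1 f)" "rwhisker T (Id2 T g) f = Id2 T (g \<circ>1 f)"
  using assms by (simp_all add: lwhisker_def rwhisker_def)

lemma HComp_assoc':
  assumes "\<alpha> \<in> Cell2 T" "\<beta> \<in> Cell2 T" "\<delta> \<in> Cell2 T" "Dom1 T (Dom2 T \<beta>) = Cod1 T (Dom2 T \<alpha>)"
    "Dom1 T (Dom2 T \<delta>) = Cod1 T (Dom2 T \<beta>)"
  shows "(\<delta> \<star> \<beta>) \<star> \<alpha> = \<delta> \<star> (\<beta> \<star> \<alpha>)"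
  by (rule HComp_assoc[of "Dom2 T \<alpha>" _ _ "Dom2 T \<beta>" _ "Dom2 T \<delta>" _ \<alpha> "Cod2 T \<alpha>" \<beta> "Cod2 T \<beta>" \<delta> "Cod2 T \<delta>"])
    (use assms in auto)

lemma lwhisker_lwhisker [simp]:
  assumes "\<alpha> \<in> Cell2 T" "g \<in> Cell1 T" "h \<in> Cell1 T" "Dom1 T g = Cod1 T (Dom2 T \<alpha>)" "Dom1 T h = Cod1 T g"
  shows "lwhisker T (h \<circ>1 g) \<alpha> = lwhisker T h (lwhisker T g \<alpha>)"
  using assms HComp_assoc'[of \<alpha> "Id2 T g" "Id2 T h"] by (simp add: lwhisker_def)

lemma rwhisker_rwhisker [simp]:
  assumes "\<alpha> \<in> Cell2 T" "f \<in> Cell1 T" "g \<in> Cell1 T" "Dom1 T (Dom2 T \<alpha>) = Cod1 T f" "Dom1 T f = Cod1 T g"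
  shows "rwhisker T \<alpha> (f \<circ>1 g) = rwhisker T (rwhisker T \<alpha> f) g"
  using assms HComp_assoc'[of "Id2 T g" "Id2 T f" \<alpha>] by (simp add: rwhisker_def)

lemma lwhisker_rwhisker [simp]:
  assumes "\<alpha> \<in> Cell2 T" "f \<in> Cell1 T" "g \<in> Cell1 T" "Dom1 T (Dom2 T \<alpha>) = Cod1 T f"
    "Dom1 T g = Cod1 T (Dom2 T \<alpha>)"
  shows "lwhisker T g (rwhisker T \<alpha> f) = rwhisker T (lwhisker T g \<alpha>) f"
  using assms HComp_assoc'[of "Id2 T f" \<alpha> "Id2 T g"] by (simp add: lwhisker_def rwhisker_def)

lemma whisker_Id1 [simp]:
  assumes "\<alpha> \<in> Cell2 T"
  shows "Cod1 T (Dom2 T \<alpha>) = Y \<Longrightarrow> lwhisker T (Id1 T Y) \<alpha> = \<alpha>"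
    and "Dom1 T (Dom2 T \<alpha>) = X \<Longrightarrow> rwhisker T \<alpha> (Id1 T X) = \<alpha>"
  unfolding lwhisker_def rwhisker_def
  using HComp_unit_left[of "Dom2 T \<alpha>" "Dom1 T (Dom2 T \<alpha>)" "Cod1 T (Dom2 T \<alpha>)" \<alpha> "Cod2 T \<alpha>"]
    HComp_unit_right[of "Dom2 T \<alpha>" "Dom1 T (Dom2 T \<alpha>)" "Cod1 T (Dom2 T \<alpha>)" \<alpha> "Cod2 T \<alpha>"] assms
  by auto

lemma whisker_exchange:
  assumes "\<alpha> \<in> Cell2 T" "\<beta> \<in> Cell2 T" "Dom1 T (Dom2 T \<beta>) = Cod1 T (Dom2 T \<alpha>)"
    "Dom2 T \<alpha> = f" "Cod2 T \<alpha> = f'" "Dom2 T \<beta> = g" "Cod2 T \<beta> = g'"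
  shows "rwhisker T \<beta> f' \<cdot>2 lwhisker T g \<alpha> = lwhisker T g' \<alpha> \<cdot>2 rwhisker T \<beta> f"
proof -
  have "Dom1 T g = Cod1 T f" "Dom1 T g' = Cod1 T f'" "f \<in> Cell1 T" "f' \<in> Cell1 T" "g \<in> Cell1 T" "g' \<in> Cell1 T"
    using assms by auto
  then show ?thesis
    using assms interchange'[of \<alpha> "Id2 T f'" "Id2 T g" \<beta>] interchange'[of "Id2 T f" \<alpha> \<beta> "Id2 T g'"]
    unfolding lwhisker_def rwhisker_def by simp
qed

lemma Id1_is_equivalence1:
  assumes "G \<in> Obj T"
  shows "is_equivalence1 T (Id1 T G)"
proof -
  have "mutually_inverse (Cells2 T) (Id2 T (Id1 T G)) (Id2 T (Id1 T G))"
    using assms by (simp add: mutually_inverse_def)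
  then have "isomorphic1 T (Id1 T G) (Id1 T G)"
    using assms unfolding isomorphic1_def iso_arr_def by (intro bexI[of _ "Id2 T (Id1 T G)"]) auto
  then show ?thesis
    using assms unfolding is_equivalence1_def by (intro conjI bexI[of _ "Id1 T G"]) simp_all
qed

end

locale two_one_category = two_category +
  assumes iso2 [simp]: "\<alpha> \<in> Cell2 T \<Longrightarrow> iso_arr (Cells2 T) \<alpha>"
begin

lemma lwhisker_inv [simp]:
  assumes "\<alpha> \<in> Cell2 T" "g \<in> Cell1 T" "Dom1 T g = Cod1 T (Dom2 T \<alpha>)"
  shows "lwhisker T g (inv_arr (Cells2 T) \<alpha>) = inv_arr (Cells2 T) (lwhisker T g \<alpha>)"
  by (rule sym, rule inv_arr_eqI)
    (use assms in \<open>simp_all add: mutually_inverse_def flip: lwhisker_comp\<close>)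

lemma rwhisker_inv [simp]:
  assumes "\<alpha> \<in> Cell2 T" "f \<in> Cell1 T" "Dom1 T (Dom2 T \<alpha>) = Cod1 T f"
  shows "rwhisker T (inv_arr (Cells2 T) \<alpha>) f = inv_arr (Cells2 T) (rwhisker T \<alpha> f)"
  by (rule sym, rule inv_arr_eqI)
    (use assms in \<open>simp_all add: mutually_inverse_def flip: rwhisker_comp\<close>)

end

lemma two_one_categoryI: "is_21_category T \<Longrightarrow> two_one_category T"
  unfolding is_21_category_def two_one_category_def two_one_category_axioms_def by blast


section \<open>Products and Mackey squares in a (2,1)-category\<close>

text \<open>The equivalence of Hom categories in \<^const>\<open>is_product\<close> for two factors, in elementary terms:
  lifting of 1-cells up to 2-cells, which are invertible in a (2,1)-category, and unique lifting of
  2-cells.\<close>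

definition product_cone :: "('o, 'c, 't) twocat \<Rightarrow> 'c \<Rightarrow> 'c \<Rightarrow> bool" where
  "product_cone T p q \<longleftrightarrow>
     p \<in> Cell1 T \<and> q \<in> Cell1 T \<and> Dom1 T p = Dom1 T q \<and>
     (\<forall>a \<in> Cell1 T. \<forall>b \<in> Cell1 T. Dom1 T a = Dom1 T b \<and> Cod1 T a = Cod1 T p \<and> Cod1 T b = Cod1 T q \<longrightarrow>
        (\<exists>f \<in> Hom1 T (Dom1 T a) (Dom1 T p). \<exists>\<alpha> \<in> Hom2 T (p \<circ>1\<^bsub>T\<^esub> f) a. \<exists>\<beta>. \<beta> \<in> Hom2 T (q \<circ>1\<^bsub>T\<^esub> f) b)) \<and>
     (\<forall>f \<in> Cell1 T. \<forall>g \<in> Cell1 T. Dom1 T f = Dom1 T g \<and> Cod1 T f = Dom1 T p \<and> Cod1 T g = Dom1 T p \<longrightarrow>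
        (\<forall>\<alpha> \<in> Hom2 T (p \<circ>1\<^bsub>T\<^esub> f) (p \<circ>1\<^bsub>T\<^esub> g). \<forall>\<beta> \<in> Hom2 T (q \<circ>1\<^bsub>T\<^esub> f) (q \<circ>1\<^bsub>T\<^esub> g).
           \<exists>!\<sigma>. \<sigma> \<in> Hom2 T f g \<and> lwhisker T p \<sigma> = \<alpha> \<and> lwhisker T q \<sigma> = \<beta>))"

context two_one_category
begin

lemmas extend2 = comp_eq_extend[OF category2]

lemma product_cone_lift:
  assumes "product_cone T p q" "a \<in> Cell1 T" "b \<in> Cell1 T" "Dom1 T a = Dom1 T b"
    "Cod1 T a = Cod1 T p" "Cod1 T b = Cod1 T q"
  obtains f \<alpha> \<beta> where "f \<in> Cell1 T" "Dom1 T f = Dom1 T a" "Cod1 T f = Dom1 T p"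
    "\<alpha> \<in> Cell2 T" "Dom2 T \<alpha> = p \<circ>1 f" "Cod2 T \<alpha> = a"
    "\<beta> \<in> Cell2 T" "Dom2 T \<beta> = q \<circ>1 f" "Cod2 T \<beta> = b"
proof -
  have "\<exists>f \<in> Hom1 T (Dom1 T a) (Dom1 T p). \<exists>\<alpha> \<in> Hom2 T (p \<circ>1 f) a. \<exists>\<beta>. \<beta> \<in> Hom2 T (q \<circ>1 f) b"
    using assms(1)[unfolded product_cone_def] assms(2-) by blast
  then show thesis using that by auto
qed

lemma product_cone_cell:
  assumes "product_cone T p q" "f \<in> Cell1 T" "g \<in> Cell1 T" "Dom1 T f = Dom1 T g"
    "Cod1 T f = Dom1 T p" "Cod1 T g = Dom1 T p"
    "\<alpha> \<in> Cell2 T" "Dom2 T \<alpha> = p \<circ>1 f" "Cod2 T \<alpha> = p \<circ>1 g"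
    "\<beta> \<in> Cell2 T" "Dom2 T \<beta> = q \<circ>1 f" "Cod2 T \<beta> = q \<circ>1 g"
  obtains \<sigma> where "\<sigma> \<in> Cell2 T" "Dom2 T \<sigma> = f" "Cod2 T \<sigma> = g" "lwhisker T p \<sigma> = \<alpha>" "lwhisker T q \<sigma> = \<beta>"
proof -
  have "\<alpha> \<in> Hom2 T (p \<circ>1 f) (p \<circ>1 g)" "\<beta> \<in> Hom2 T (q \<circ>1 f) (q \<circ>1 g)" using assms by auto
  then have "\<exists>\<sigma>. \<sigma> \<in> Hom2 T f g \<and> lwhisker T p \<sigma> = \<alpha> \<and> lwhisker T q \<sigma> = \<beta>"
    using assms(1)[unfolded product_cone_def] assms(2-6) by blast
  then show thesis using that by auto
qed

lemma product_cone_eqI: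
  assumes "product_cone T p q" "\<sigma> \<in> Cell2 T" "\<tau> \<in> Cell2 T" "Dom2 T \<sigma> = Dom2 T \<tau>" "Cod2 T \<sigma> = Cod2 T \<tau>"
    "Cod1 T (Dom2 T \<tau>) = Dom1 T p" "lwhisker T p \<sigma> = lwhisker T p \<tau>" "lwhisker T q \<sigma> = lwhisker T q \<tau>"
  shows "\<sigma> = \<tau>"
proof -
  have p: "p \<in> Cell1 T" "q \<in> Cell1 T" "Dom1 T p = Dom1 T q"
    using assms(1) unfolding product_cone_def by auto
  have "\<exists>!\<sigma>'. \<sigma>' \<in> Hom2 T (Dom2 T \<tau>) (Cod2 T \<tau>) \<and> lwhisker T p \<sigma>' = lwhisker T p \<tau>
          \<and> lwhisker T q \<sigma>' = lwhisker T q \<tau>"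
    using assms(1)[unfolded product_cone_def] assms(2-6) p by simp
  then show ?thesis using assms by auto
qed

lemma product_cone_commute:
  assumes pq: "product_cone T p q" shows "product_cone T q p"
proof -
  have p: "p \<in> Cell1 T" "q \<in> Cell1 T" "Dom1 T p = Dom1 T q"
    using pq unfolding product_cone_def by auto
  show ?thesis
    unfolding product_cone_def
  proof (intro conjI ballI impI; (elim conjE)?)
    fix a b assume a: "a \<in> Cell1 T" "b \<in> Cell1 T" "Dom1 T a = Dom1 T b" "Cod1 T a = Cod1 T q" "Cod1 T b = Cod1 T p"
    obtain f \<alpha> \<beta> where "f \<in> Cell1 T" "Dom1 T f = Dom1 T b" "Cod1 T f = Dom1 T p"
      "\<alpha> \<in> Cell2 T" "Dom2 T \<alpha> = p \<circ>1 f" "Cod2 T \<alpha> = b"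
      "\<beta> \<in> Cell2 T" "Dom2 T \<beta> = q \<circ>1 f" "Cod2 T \<beta> = a"
      using product_cone_lift[OF pq a(2,1) a(3)[symmetric] a(5,4)] .
    then have "f \<in> Hom1 T (Dom1 T a) (Dom1 T q)" "\<beta> \<in> Hom2 T (q \<circ>1 f) a" "\<alpha> \<in> Hom2 T (p \<circ>1 f) b"
      using a p by auto
    then show "\<exists>f\<in>Hom1 T (Dom1 T a) (Dom1 T q). \<exists>\<alpha>\<in>Hom2 T (q \<circ>1 f) a. \<exists>\<beta>. \<beta> \<in> Hom2 T (p \<circ>1 f) b"
      by blast
  next
    fix f g \<beta> \<alpha>
    assume f: "f \<in> Cell1 T" "g \<in> Cell1 T" "Dom1 T f = Dom1 T g" "Cod1 T f = Dom1 T q" "Cod1 T g = Dom1 T q"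
      and \<alpha>: "\<beta> \<in> Hom2 T (q \<circ>1 f) (q \<circ>1 g)" "\<alpha> \<in> Hom2 T (p \<circ>1 f) (p \<circ>1 g)"
    have "\<exists>!\<sigma>. \<sigma> \<in> Hom2 T f g \<and> lwhisker T p \<sigma> = \<alpha> \<and> lwhisker T q \<sigma> = \<beta>"
      using pq f \<alpha> p unfolding product_cone_def by (simp del: mem_Hom)
    then show "\<exists>!\<sigma>. \<sigma> \<in> Hom2 T f g \<and> lwhisker T q \<sigma> = \<beta> \<and> lwhisker T p \<sigma> = \<alpha>"
      by (simp only: conj_commute)
  qed (use p in auto)
qed

lemma product_cone_if_is_product:
  assumes "is_product T [G, H] P [p, q]"
  shows "product_cone T p q"
proof -
  let ?F = "\<lambda>X. \<lparr>obj_map = \<lambda>f. map (\<lambda>p. p \<circ>1 f) [p, q], arr_map = \<lambda>\<alpha>. map (\<lambda>p. lwhisker T p \<alpha>) [p, q]\<rparr>"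
  have p: "p \<in> Cell1 T" "q \<in> Cell1 T" "Dom1 T p = P" "Dom1 T q = P" "Cod1 T p = G" "Cod1 T q = H"
    using assms unfolding is_product_def by auto
  have eq: "is_equivalence (hom_cat T X P) (list_cat (map (hom_cat T X) [G, H])) (?F X)"
    if "X \<in> Obj T" for X
    using assms that unfolding is_product_def by blast
  show ?thesis
    unfolding product_cone_def
  proof (intro conjI ballI impI; (elim conjE)?)
    fix a b assume a: "a \<in> Cell1 T" "b \<in> Cell1 T" "Dom1 T a = Dom1 T b" "Cod1 T a = Cod1 T p" "Cod1 T b = Cod1 T q"
    have "[a, b] \<in> Ob (list_cat (map (hom_cat T (Dom1 T a)) [G, H]))"
      using a p by (simp add: list_cat_def hom_cat_def)
    then obtain f h where f: "f \<in> Ob (hom_cat T (Dom1 T a) P)"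
      and h: "h \<in> Hom (list_cat (map (hom_cat T (Dom1 T a)) [G, H])) (?F (Dom1 T a) $o f) [a, b]"
      using eq[of "Dom1 T a"] a unfolding is_equivalence_def by (metis Dom_in_Ob category1)
    then obtain \<alpha> \<beta> where "h = [\<alpha>, \<beta>]" by (auto simp: list_cat_def list_all2_Cons1)
    then show "\<exists>f\<in>Hom1 T (Dom1 T a) (Dom1 T p). \<exists>\<alpha>\<in>Hom2 T (p \<circ>1 f) a. \<exists>\<beta>. \<beta> \<in> Hom2 T (q \<circ>1 f) b"
      using f h p by (auto simp: list_cat_def hom_cat_def)
  next
    fix f g \<alpha> \<beta>
    assume f: "f \<in> Cell1 T" "g \<in> Cell1 T" "Dom1 T f = Dom1 T g" "Cod1 T f = Dom1 T p" "Cod1 T g = Dom1 T p"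
      and \<alpha>: "\<alpha> \<in> Hom2 T (p \<circ>1 f) (p \<circ>1 g)" "\<beta> \<in> Hom2 T (q \<circ>1 f) (q \<circ>1 g)"
    let ?X = "Dom1 T g" and ?L = "list_cat (map (hom_cat T (Dom1 T g)) [G, H])"
    have b: "bij_betw (arr_map (?F ?X)) (Hom (hom_cat T ?X P) f g) (Hom ?L (?F ?X $o f) (?F ?X $o g))"
      using eq[of ?X] f p unfolding is_equivalence_def by (simp add: hom_cat_def)
    have h: "Hom (hom_cat T ?X P) f g = Hom2 T f g"
      using f p by (auto simp: hom_cat_def)
    have "[\<alpha>, \<beta>] \<in> Hom ?L (?F ?X $o f) (?F ?X $o g)"
      using f \<alpha> p by (auto simp: list_cat_def hom_cat_def)
    then have "[\<alpha>, \<beta>] \<in> arr_map (?F ?X) ` Hom2 T f g"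
      using b unfolding bij_betw_def h by blast
    then obtain \<sigma> where "\<sigma> \<in> Hom2 T f g" "[lwhisker T p \<sigma>, lwhisker T q \<sigma>] = [\<alpha>, \<beta>]"
      by (auto simp del: mem_Hom)
    moreover have "\<sigma>' = \<sigma>" if "\<sigma>' \<in> Hom2 T f g" "[lwhisker T p \<sigma>', lwhisker T q \<sigma>'] = [\<alpha>, \<beta>]" for \<sigma>'
      using b calculation that unfolding bij_betw_def h inj_on_def by (simp del: mem_Hom)
    ultimately show "\<exists>!\<sigma>. \<sigma> \<in> Hom2 T f g \<and> lwhisker T p \<sigma> = \<alpha> \<and> lwhisker T q \<sigma> = \<beta>"
      by (metis list.inject)
  qed (use p in auto)
qed

lemma iso_arr_hom_cat:
  assumes "\<alpha> \<in> Cell2 T" "Dom2 T \<alpha> \<in> Hom1 T X Y"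
  shows "iso_arr (hom_cat T X Y) \<alpha>"
proof -
  have "mutually_inverse (hom_cat T X Y) \<alpha> (inv_arr (Cells2 T) \<alpha>)"
    using assms by (simp add: mutually_inverse_def hom_cat_def)
  then show ?thesis unfolding iso_arr_def by blast
qed

text \<open>The three last premises are essential surjectivity, fullness and faithfulness of the comparison
  functor into the iso-comma category. The square is given through the inverse \<open>\<nu>\<close> of its 2-cell, which has the
  direction of the 2-cells \<^const>\<open>Pr1Nat\<close> and \<^const>\<open>Pr2Nat\<close> that occur below.\<close>

lemma mackey_squareI:
  assumes c: "i \<in> Cell1 T" "u \<in> Cell1 T" "p \<in> Cell1 T" "q \<in> Cell1 T" "Cod1 T u = Cod1 T i"
      "Dom1 T q = Dom1 T p" "Cod1 T p = Dom1 T i" "Cod1 T q = Dom1 T u"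
      "\<nu> \<in> Cell2 T" "Dom2 T \<nu> = u \<circ>1 q" "Cod2 T \<nu> = i \<circ>1 p"
    and lift: "\<And>a b \<phi>. a \<in> Cell1 T \<Longrightarrow> b \<in> Cell1 T \<Longrightarrow> Dom1 T a = Dom1 T b \<Longrightarrow> Cod1 T a = Dom1 T i \<Longrightarrow>
      Cod1 T b = Dom1 T u \<Longrightarrow> \<phi> \<in> Cell2 T \<Longrightarrow> Dom2 T \<phi> = i \<circ>1 a \<Longrightarrow> Cod2 T \<phi> = u \<circ>1 b \<Longrightarrow>
      \<exists>f\<in>Hom1 T (Dom1 T b) (Dom1 T p). \<exists>\<alpha>\<in>Hom2 T (p \<circ>1 f) a. \<exists>\<beta>\<in>Hom2 T (q \<circ>1 f) b.
        \<phi> \<cdot>2 lwhisker T i \<alpha> \<cdot>2 rwhisker T \<nu> f = lwhisker T u \<beta>"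
    and cell: "\<And>f g \<alpha> \<beta>. f \<in> Cell1 T \<Longrightarrow> g \<in> Cell1 T \<Longrightarrow> Dom1 T f = Dom1 T g \<Longrightarrow> Cod1 T f = Dom1 T p \<Longrightarrow>
      Cod1 T g = Dom1 T p \<Longrightarrow> \<alpha> \<in> Cell2 T \<Longrightarrow> Dom2 T \<alpha> = p \<circ>1 f \<Longrightarrow> Cod2 T \<alpha> = p \<circ>1 g \<Longrightarrow>
      \<beta> \<in> Cell2 T \<Longrightarrow> Dom2 T \<beta> = q \<circ>1 f \<Longrightarrow> Cod2 T \<beta> = q \<circ>1 g \<Longrightarrow>
      lwhisker T i \<alpha> \<cdot>2 rwhisker T \<nu> f = rwhisker T \<nu> g \<cdot>2 lwhisker T u \<beta> \<Longrightarrow>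
      \<exists>\<sigma>\<in>Hom2 T f g. lwhisker T p \<sigma> = \<alpha> \<and> lwhisker T q \<sigma> = \<beta>"
    and unique: "\<And>\<sigma> \<tau>. \<sigma> \<in> Cell2 T \<Longrightarrow> \<tau> \<in> Cell2 T \<Longrightarrow> Dom2 T \<sigma> = Dom2 T \<tau> \<Longrightarrow> Cod2 T \<sigma> = Cod2 T \<tau> \<Longrightarrow>
      Cod1 T (Dom2 T \<tau>) = Dom1 T p \<Longrightarrow>
      lwhisker T p \<sigma> = lwhisker T p \<tau> \<Longrightarrow> lwhisker T q \<sigma> = lwhisker T q \<tau> \<Longrightarrow> \<sigma> = \<tau>"
  shows "mackey_square T i u p q (inv_arr (Cells2 T) \<nu>)"
proof -
  let ?\<gamma> = "inv_arr (Cells2 T) \<nu>"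
  let ?P = "Dom1 T p" and ?H = "Dom1 T i" and ?K = "Dom1 T u" and ?G = "Cod1 T i"
  let ?Fo = "\<lambda>f. (p \<circ>1 f, q \<circ>1 f, rwhisker T ?\<gamma> f)"
  let ?F = "\<lparr>obj_map = ?Fo, arr_map = (\<lambda>\<alpha>. (?Fo (Dom2 T \<alpha>), ?Fo (Cod2 T \<alpha>), lwhisker T p \<alpha>, lwhisker T q \<alpha>))\<rparr>"
  have "is_equivalence (hom_cat T X ?P)
      (iso_comma (hom_cat T X ?H) (hom_cat T X ?K) (hom_cat T X ?G) (post_fctr T i) (post_fctr T u)) ?F"
    (is "is_equivalence ?A ?B _") if X: "X \<in> Obj T" for X
  proof -
    have obB: "(a, b, \<phi>) \<in> Ob ?B \<longleftrightarrow> a \<in> Hom1 T X ?H \<and> b \<in> Hom1 T X ?K \<and> \<phi> \<in> Hom2 T (i \<circ>1 a) (u \<circ>1 b)" for a b \<phi>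
      using c iso_arr_hom_cat[of \<phi> X ?G]
      by (auto simp: iso_comma_def hom_cat_def[of T X] Let_def post_fctr_def)
    have homB: "(s, t, \<alpha>, \<beta>) \<in> Hom ?B (a, b, \<phi>) (a', b', \<phi>') \<longleftrightarrow>
        s = (a, b, \<phi>) \<and> t = (a', b', \<phi>') \<and> (a, b, \<phi>) \<in> Ob ?B \<and> (a', b', \<phi>') \<in> Ob ?B \<and>
        \<alpha> \<in> Hom2 T a a' \<and> \<beta> \<in> Hom2 T b b' \<and> \<phi>' \<cdot>2 lwhisker T i \<alpha> = lwhisker T u \<beta> \<cdot>2 \<phi>"
      for s t \<alpha> \<beta> a b \<phi> a' b' \<phi>'
      by (auto simp: iso_comma_def hom_cat_def Let_def post_fctr_def)
    have homA: "Hom ?A f g = {\<alpha> \<in> Hom2 T f g. f \<in> Hom1 T X ?P}" for f g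
      by (auto simp: hom_cat_def)
    have exch: "rwhisker T ?\<gamma> g \<cdot>2 lwhisker T i (lwhisker T p \<alpha>) = lwhisker T u (lwhisker T q \<alpha>) \<cdot>2 rwhisker T ?\<gamma> f"
      if "\<alpha> \<in> Hom2 T f g" "f \<in> Hom1 T X ?P" for \<alpha> f g
      using whisker_exchange[of \<alpha> ?\<gamma> f g "i \<circ>1 p" "u \<circ>1 q"] that c by simp
    have FOb: "?Fo f \<in> Ob ?B" if "f \<in> Hom1 T X ?P" for f
      using that c unfolding obB by simp
    have FHom: "(?Fo f, ?Fo g, lwhisker T p \<alpha>, lwhisker T q \<alpha>) \<in> Hom ?B (?Fo f) (?Fo g)"
      if "\<alpha> \<in> Hom2 T f g" "f \<in> Hom1 T X ?P" for f g \<alpha>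
    proof -
      have "g \<in> Hom1 T X ?P" using that cell2_arr[of \<alpha>] by auto
      then show ?thesis
        using that c FOb[of f] FOb[of g] exch[OF that] unfolding homB by simp
    qed
    have "is_functor ?A ?B ?F"
      unfolding is_functor_def
    proof (intro conjI ballI allI)
      fix f assume "f \<in> Ob ?A"
      then have f: "f \<in> Hom1 T X ?P" by (simp add: hom_cat_def)
      then show "?F $o f \<in> Ob ?B" using FOb by simp
      show "?F $a Idt ?A f = Idt ?B (?F $o f)"
        using f c by (simp add: iso_comma_def Let_def hom_cat_def)
    next
      fix f g \<alpha> assume "\<alpha> \<in> Hom ?A f g"
      then show "?F $a \<alpha> \<in> Hom ?B (?F $o f) (?F $o g)"
        unfolding homA using FHom[of \<alpha> f g] by (auto simp del: mem_Hom) (simp add: mem_Hom)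
    next
      fix f g h \<alpha> \<beta> assume "\<alpha> \<in> Hom ?A f g" "\<beta> \<in> Hom ?A g h"
      then show "?F $a (\<beta> \<cdot>\<^bsub>?A\<^esub> \<alpha>) = (?F $a \<beta>) \<cdot>\<^bsub>?B\<^esub> (?F $a \<alpha>)"
        unfolding homA using c by (auto simp: iso_comma_def Let_def hom_cat_def)
    qed
    moreover have "bij_betw (arr_map ?F) (Hom ?A f g) (Hom ?B (?F $o f) (?F $o g))"
      if "f \<in> Ob ?A" "g \<in> Ob ?A" for f g
      unfolding bij_betw_def
    proof
      have f: "f \<in> Hom1 T X ?P" "g \<in> Hom1 T X ?P" using that by (simp_all add: hom_cat_def)
      show "inj_on (arr_map ?F) (Hom ?A f g)"
        unfolding inj_on_def homA using unique f by auto
      show "arr_map ?F ` Hom ?A f g = Hom ?B (?F $o f) (?F $o g)"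
      proof
        show "arr_map ?F ` Hom ?A f g \<subseteq> Hom ?B (?F $o f) (?F $o g)"
          using calculation unfolding is_functor_def by blast
        show "Hom ?B (?F $o f) (?F $o g) \<subseteq> arr_map ?F ` Hom ?A f g"
        proof
          fix w assume w: "w \<in> Hom ?B (?F $o f) (?F $o g)"
          obtain s t \<alpha> \<beta> where "w = (s, t, \<alpha>, \<beta>)" by (metis surj_pair)
          with w have w: "w = (?Fo f, ?Fo g, \<alpha>, \<beta>)"
            and \<alpha>: "\<alpha> \<in> Hom2 T (p \<circ>1 f) (p \<circ>1 g)" "\<beta> \<in> Hom2 T (q \<circ>1 f) (q \<circ>1 g)"
            and e: "rwhisker T ?\<gamma> g \<cdot>2 lwhisker T i \<alpha> = lwhisker T u \<beta> \<cdot>2 rwhisker T ?\<gamma> f"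
            using homB[of s t \<alpha> \<beta>] by (auto simp del: mem_Hom)
          have "lwhisker T i \<alpha> \<cdot>2 rwhisker T \<nu> f
                = rwhisker T \<nu> g \<cdot>2 ((rwhisker T ?\<gamma> g \<cdot>2 lwhisker T i \<alpha>) \<cdot>2 rwhisker T \<nu> f)"
            using f c \<alpha> by simp
          also have "\<dots> = rwhisker T \<nu> g \<cdot>2 lwhisker T u \<beta>"
            unfolding e using f c \<alpha> by simp
          finally obtain \<sigma> where "\<sigma> \<in> Hom2 T f g" "lwhisker T p \<sigma> = \<alpha>" "lwhisker T q \<sigma> = \<beta>"
            using cell[of f g \<alpha> \<beta>] f \<alpha> by auto
          then show "w \<in> arr_map ?F ` Hom ?A f g"
            unfolding w homA using f by force
        qed
      qed
    qed
    moreover have "\<exists>f \<in> Ob ?A. \<exists>w \<in> Hom ?B (?F $o f) z. iso_arr ?B w" if "z \<in> Ob ?B" for z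
    proof -
      obtain a b \<phi> where z: "z = (a, b, \<phi>)" by (metis surj_pair)
      with that have a: "a \<in> Hom1 T X ?H" "b \<in> Hom1 T X ?K" "\<phi> \<in> Hom2 T (i \<circ>1 a) (u \<circ>1 b)"
        using obB by blast+
      obtain f \<alpha> \<beta> where f: "f \<in> Hom1 T X ?P" and \<alpha>: "\<alpha> \<in> Hom2 T (p \<circ>1 f) a" "\<beta> \<in> Hom2 T (q \<circ>1 f) b"
        and e: "\<phi> \<cdot>2 lwhisker T i \<alpha> \<cdot>2 rwhisker T \<nu> f = lwhisker T u \<beta>"
        using lift[of a b \<phi>] a by auto
      note e' = extend2[OF e]
      have e1: "\<phi> \<cdot>2 lwhisker T i \<alpha> = lwhisker T u \<beta> \<cdot>2 rwhisker T ?\<gamma> f"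
        unfolding e[symmetric] using f \<alpha> a c by simp
      have e2: "rwhisker T ?\<gamma> f \<cdot>2 lwhisker T i (inv_arr (Cells2 T) \<alpha>) = lwhisker T u (inv_arr (Cells2 T) \<beta>) \<cdot>2 \<phi>"
      proof (rule comp_left_cancel[OF category2, of "lwhisker T u \<beta>"])
        have "lwhisker T u \<beta> \<cdot>2 (rwhisker T ?\<gamma> f \<cdot>2 lwhisker T i (inv_arr (Cells2 T) \<alpha>))
           = (\<phi> \<cdot>2 lwhisker T i \<alpha>) \<cdot>2 lwhisker T i (inv_arr (Cells2 T) \<alpha>)"
          unfolding e1 using f \<alpha> a c by simp
        then show "lwhisker T u \<beta> \<cdot>2 (rwhisker T ?\<gamma> f \<cdot>2 lwhisker T i (inv_arr (Cells2 T) \<alpha>))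
           = lwhisker T u \<beta> \<cdot>2 (lwhisker T u (inv_arr (Cells2 T) \<beta>) \<cdot>2 \<phi>)"
          using f \<alpha> a c by simp
      qed (use f \<alpha> a c in simp_all)
      let ?w = "(?Fo f, z, \<alpha>, \<beta>)" and ?w' = "(z, ?Fo f, inv_arr (Cells2 T) \<alpha>, inv_arr (Cells2 T) \<beta>)"
      have w: "?w \<in> Hom ?B (?Fo f) z" "?w' \<in> Hom ?B z (?Fo f)"
        using that FOb[OF f] \<alpha> e1 e2 unfolding z homB by simp_all
      have "mutually_inverse ?B ?w ?w'"
        using w \<alpha> f a c unfolding mutually_inverse_def z
        by (auto simp: iso_comma_def Let_def hom_cat_def)
      then have "iso_arr ?B ?w" unfolding iso_arr_def by blast
      moreover have "f \<in> Ob ?A" using f by (simp add: hom_cat_def)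
      moreover have "?w \<in> Hom ?B (?F $o f) z" using w(1) by (simp only: fctr.simps)
      ultimately show ?thesis by blast
    qed
    ultimately show ?thesis unfolding is_equivalence_def by blast
  qed
  then show ?thesis
    unfolding mackey_square_def Let_def using c
    by (intro exI[of _ ?P] exI[of _ ?H] exI[of _ ?K] exI[of _ ?G]) simp
qed

text \<open>The square with sides \<open>i\<close>, \<open>\<pi>1\<close> and \<open>q = i \<times> 1\<close>: a 1-cell into \<open>Q\<close> is a pair of components. A
  factorization of the first one through \<open>i\<close> and the unchanged second one are the same as a 1-cell
  into \<open>P\<close>, because \<open>\<delta>\<close> identifies the second components of \<open>P\<close> and \<open>Q\<close>.\<close>

lemma mackey_square_projection:
  assumes P: "product_cone T p q'" and Q: "product_cone T \<pi>1 \<pi>2"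
    and c: "i \<in> Cell1 T" "Dom1 T i = Cod1 T p" "Cod1 T \<pi>1 = Cod1 T i" "Cod1 T \<pi>2 = Cod1 T q'"
      "q \<in> Cell1 T" "Dom1 T q = Dom1 T p" "Cod1 T q = Dom1 T \<pi>1"
      "\<nu> \<in> Cell2 T" "Dom2 T \<nu> = \<pi>1 \<circ>1 q" "Cod2 T \<nu> = i \<circ>1 p"
      "\<delta> \<in> Cell2 T" "Dom2 T \<delta> = \<pi>2 \<circ>1 q" "Cod2 T \<delta> = q'"
  shows "mackey_square T i \<pi>1 p q (inv_arr (Cells2 T) \<nu>)"
proof -
  have p: "p \<in> Cell1 T" "q' \<in> Cell1 T" "Dom1 T q' = Dom1 T p"
    "\<pi>1 \<in> Cell1 T" "\<pi>2 \<in> Cell1 T" "Dom1 T \<pi>2 = Dom1 T \<pi>1"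
    using P Q unfolding product_cone_def by auto
  have exch1: "rwhisker T \<nu> g \<cdot>2 lwhisker T \<pi>1 (lwhisker T q \<sigma>) = lwhisker T i (lwhisker T p \<sigma>) \<cdot>2 rwhisker T \<nu> f"
    and exch2: "rwhisker T \<delta> g \<cdot>2 lwhisker T \<pi>2 (lwhisker T q \<sigma>) = lwhisker T q' \<sigma> \<cdot>2 rwhisker T \<delta> f"
    if "\<sigma> \<in> Cell2 T" "Dom2 T \<sigma> = f" "Cod2 T \<sigma> = g" "f \<in> Cell1 T" "g \<in> Cell1 T"
      "Cod1 T f = Dom1 T p" "Dom1 T g = Dom1 T f" "Cod1 T g = Dom1 T p" for \<sigma> f g
    using whisker_exchange[of \<sigma> \<nu> f g "\<pi>1 \<circ>1 q" "i \<circ>1 p"] whisker_exchange[of \<sigma> \<delta> f g "\<pi>2 \<circ>1 q" q']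
      that p c by simp_all
  show ?thesis
  proof (rule mackey_squareI)
    fix a b \<phi>
    assume a: "a \<in> Cell1 T" "b \<in> Cell1 T" "Dom1 T a = Dom1 T b" "Cod1 T a = Dom1 T i" "Cod1 T b = Dom1 T \<pi>1"
      "\<phi> \<in> Cell2 T" "Dom2 T \<phi> = i \<circ>1 a" "Cod2 T \<phi> = \<pi>1 \<circ>1 b"
    obtain f \<alpha> \<beta>' where f: "f \<in> Cell1 T" "Dom1 T f = Dom1 T a" "Cod1 T f = Dom1 T p"
      and \<alpha>: "\<alpha> \<in> Cell2 T" "Dom2 T \<alpha> = p \<circ>1 f" "Cod2 T \<alpha> = a"
        "\<beta>' \<in> Cell2 T" "Dom2 T \<beta>' = q' \<circ>1 f" "Cod2 T \<beta>' = \<pi>2 \<circ>1 b"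
      by (rule product_cone_lift[OF P, of a "\<pi>2 \<circ>1 b"]) (use a p c in simp_all)
    obtain \<beta> where \<beta>: "\<beta> \<in> Cell2 T" "Dom2 T \<beta> = q \<circ>1 f" "Cod2 T \<beta> = b"
        "lwhisker T \<pi>1 \<beta> = \<phi> \<cdot>2 lwhisker T i \<alpha> \<cdot>2 rwhisker T \<nu> f"
        "lwhisker T \<pi>2 \<beta> = \<beta>' \<cdot>2 rwhisker T \<delta> f"
      by (rule product_cone_cell[OF Q, of "q \<circ>1 f" b "\<phi> \<cdot>2 lwhisker T i \<alpha> \<cdot>2 rwhisker T \<nu> f" "\<beta>' \<cdot>2 rwhisker T \<delta> f"])
        (use a p c f \<alpha> in simp_all)
    show "\<exists>f\<in>Hom1 T (Dom1 T b) (Dom1 T p). \<exists>\<alpha>\<in>Hom2 T (p \<circ>1 f) a. \<exists>\<beta>\<in>Hom2 T (q \<circ>1 f) b.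
        \<phi> \<cdot>2 lwhisker T i \<alpha> \<cdot>2 rwhisker T \<nu> f = lwhisker T \<pi>1 \<beta>"
      by (rule bexI[of _ f], rule bexI[of _ \<alpha>], rule bexI[of _ \<beta>]) (use f a \<alpha> \<beta> in simp_all)
  next
    fix f g \<alpha> \<beta>
    assume f: "f \<in> Cell1 T" "g \<in> Cell1 T" "Dom1 T f = Dom1 T g" "Cod1 T f = Dom1 T p" "Cod1 T g = Dom1 T p"
      and \<alpha>: "\<alpha> \<in> Cell2 T" "Dom2 T \<alpha> = p \<circ>1 f" "Cod2 T \<alpha> = p \<circ>1 g"
        "\<beta> \<in> Cell2 T" "Dom2 T \<beta> = q \<circ>1 f" "Cod2 T \<beta> = q \<circ>1 g"
      and e: "lwhisker T i \<alpha> \<cdot>2 rwhisker T \<nu> f = rwhisker T \<nu> g \<cdot>2 lwhisker T \<pi>1 \<beta>"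
    obtain \<sigma> where \<sigma>: "\<sigma> \<in> Cell2 T" "Dom2 T \<sigma> = f" "Cod2 T \<sigma> = g" "lwhisker T p \<sigma> = \<alpha>"
      "lwhisker T q' \<sigma> = rwhisker T \<delta> g \<cdot>2 lwhisker T \<pi>2 \<beta> \<cdot>2 inv_arr (Cells2 T) (rwhisker T \<delta> f)"
      by (rule product_cone_cell[OF P, of f g \<alpha> "rwhisker T \<delta> g \<cdot>2 lwhisker T \<pi>2 \<beta> \<cdot>2 inv_arr (Cells2 T) (rwhisker T \<delta> f)"])
        (use f p c \<alpha> in simp_all)
    have "lwhisker T q \<sigma> = \<beta>"
    proof (rule product_cone_eqI[OF Q])
      show "lwhisker T \<pi>1 (lwhisker T q \<sigma>) = lwhisker T \<pi>1 \<beta>"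
        by (rule comp_left_cancel[OF category2, of "rwhisker T \<nu> g"])
          (use e exch1[OF \<sigma>(1-3)] f \<sigma> p c \<alpha> in simp_all)
      show "lwhisker T \<pi>2 (lwhisker T q \<sigma>) = lwhisker T \<pi>2 \<beta>"
        by (rule comp_left_cancel[OF category2, of "rwhisker T \<delta> g"])
          (use exch2[OF \<sigma>(1-3)] f \<sigma> p c \<alpha> in simp_all)
    qed (use f p c \<alpha> \<sigma> in simp_all)
    then show "\<exists>\<sigma>\<in>Hom2 T f g. lwhisker T p \<sigma> = \<alpha> \<and> lwhisker T q \<sigma> = \<beta>"
      by (intro bexI[of _ \<sigma>]) (use \<sigma> in simp_all)
  next
    fix \<sigma> \<tau>
    assume \<sigma>: "\<sigma> \<in> Cell2 T" "\<tau> \<in> Cell2 T" "Dom2 T \<sigma> = Dom2 T \<tau>" "Cod2 T \<sigma> = Cod2 T \<tau>"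
      "Cod1 T (Dom2 T \<tau>) = Dom1 T p" "lwhisker T p \<sigma> = lwhisker T p \<tau>" "lwhisker T q \<sigma> = lwhisker T q \<tau>"
    have \<sigma>': "Cod1 T (Dom2 T \<sigma>) = Dom1 T p" using \<sigma> by simp
    have "(lwhisker T q' \<sigma> \<cdot>2 rwhisker T \<delta> (Dom2 T \<tau>)) \<cdot>2 inv_arr (Cells2 T) (rwhisker T \<delta> (Dom2 T \<tau>))
        = (lwhisker T q' \<tau> \<cdot>2 rwhisker T \<delta> (Dom2 T \<tau>)) \<cdot>2 inv_arr (Cells2 T) (rwhisker T \<delta> (Dom2 T \<tau>))"
      using exch2[of \<tau> "Dom2 T \<tau>" "Cod2 T \<tau>"] exch2[of \<sigma> "Dom2 T \<tau>" "Cod2 T \<tau>"] \<sigma> by simp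
    then have "lwhisker T q' \<sigma> = lwhisker T q' \<tau>" using \<sigma> \<sigma>' p c by simp
    then show "\<sigma> = \<tau>" using product_cone_eqI[OF P] \<sigma> by blast
  qed (use p c in simp_all)
qed

text \<open>The graph \<open>p = (i, 1) : H \<rightarrow> G \<times> H\<close> is the pullback of the diagonal \<open>d\<close> of \<open>G\<close> along \<open>t = 1 \<times> i\<close>. The
  cells \<open>\<delta>1\<close>, \<open>\<delta>2\<close> make \<open>d\<close> a diagonal, \<open>\<kappa>\<close>, \<open>\<rho>\<close> make \<open>p\<close> a graph, and the last two assumptions say that
  \<open>\<gamma>\<close> is the evident comparison. Given \<open>a\<close> into \<open>G \<times> H\<close> and \<open>b\<close> into \<open>G\<close> with \<open>t a \<cong> d b\<close>, both components
  of \<open>t a\<close> are identified with \<open>b\<close>; so \<open>b\<close> and the first component of \<open>a\<close> are isomorphic to the image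
  under \<open>i\<close> of the second component, and \<open>a\<close> is recovered from the latter alone.\<close>

lemma mackey_square_graph:
  assumes Q: "product_cone T \<pi>1 \<pi>2" and R: "product_cone T p1 p2"
    and c: "i \<in> Cell1 T" "Cod1 T \<pi>1 = Cod1 T i" "Cod1 T \<pi>2 = Cod1 T i" "Cod1 T p1 = Cod1 T i" "Cod1 T p2 = Dom1 T i"
      "t \<in> Cell1 T" "Dom1 T t = Dom1 T p1" "Cod1 T t = Dom1 T \<pi>1"
      "d \<in> Cell1 T" "Dom1 T d = Cod1 T i" "Cod1 T d = Dom1 T \<pi>1"
      "p \<in> Cell1 T" "Dom1 T p = Dom1 T i" "Cod1 T p = Dom1 T p1"
    and n: "\<nu>1 \<in> Cell2 T" "Dom2 T \<nu>1 = \<pi>1 \<circ>1 t" "Cod2 T \<nu>1 = p1"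
      "\<nu>2 \<in> Cell2 T" "Dom2 T \<nu>2 = \<pi>2 \<circ>1 t" "Cod2 T \<nu>2 = i \<circ>1 p2"
      "\<delta>1 \<in> Cell2 T" "Dom2 T \<delta>1 = \<pi>1 \<circ>1 d" "Cod2 T \<delta>1 = Id1 T (Cod1 T i)"
      "\<delta>2 \<in> Cell2 T" "Dom2 T \<delta>2 = \<pi>2 \<circ>1 d" "Cod2 T \<delta>2 = Id1 T (Cod1 T i)"
      "\<kappa> \<in> Cell2 T" "Dom2 T \<kappa> = p1 \<circ>1 p" "Cod2 T \<kappa> = i"
      "\<rho> \<in> Cell2 T" "Dom2 T \<rho> = p2 \<circ>1 p" "Cod2 T \<rho> = Id1 T (Dom1 T i)"
      "\<gamma> \<in> Cell2 T" "Dom2 T \<gamma> = d \<circ>1 i" "Cod2 T \<gamma> = t \<circ>1 p"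
    and e1: "\<kappa> \<cdot>2 rwhisker T \<nu>1 p \<cdot>2 lwhisker T \<pi>1 \<gamma> = rwhisker T \<delta>1 i"
    and e2: "lwhisker T i \<rho> \<cdot>2 rwhisker T \<nu>2 p \<cdot>2 lwhisker T \<pi>2 \<gamma> = rwhisker T \<delta>2 i"
  shows "mackey_square T t d p i (inv_arr (Cells2 T) \<gamma>)"
proof -
  have p: "p1 \<in> Cell1 T" "p2 \<in> Cell1 T" "Dom1 T p2 = Dom1 T p1"
    "\<pi>1 \<in> Cell1 T" "\<pi>2 \<in> Cell1 T" "Dom1 T \<pi>2 = Dom1 T \<pi>1"
    using Q R unfolding product_cone_def by auto
  have e1': "rwhisker T \<kappa> f \<cdot>2 rwhisker T (rwhisker T \<nu>1 p) f \<cdot>2 rwhisker T (lwhisker T \<pi>1 \<gamma>) f = rwhisker T (rwhisker T \<delta>1 i) f"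
    and e2': "rwhisker T (lwhisker T i \<rho>) f \<cdot>2 rwhisker T (rwhisker T \<nu>2 p) f \<cdot>2 rwhisker T (lwhisker T \<pi>2 \<gamma>) f = rwhisker T (rwhisker T \<delta>2 i) f"
    if "f \<in> Cell1 T" "Cod1 T f = Dom1 T i" for f
    unfolding e1[symmetric] e2[symmetric] using that p c n by simp_all
  have x1: "rwhisker T \<nu>1 g \<cdot>2 lwhisker T \<pi>1 (lwhisker T t \<alpha>) = lwhisker T p1 \<alpha> \<cdot>2 rwhisker T \<nu>1 f"
    and x2: "rwhisker T \<nu>2 g \<cdot>2 lwhisker T \<pi>2 (lwhisker T t \<alpha>) = lwhisker T i (lwhisker T p2 \<alpha>) \<cdot>2 rwhisker T \<nu>2 f"
    if "\<alpha> \<in> Cell2 T" "Dom2 T \<alpha> = f" "Cod2 T \<alpha> = g" "f \<in> Cell1 T" "g \<in> Cell1 T"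
      "Cod1 T f = Dom1 T p1" for \<alpha> f g
    using whisker_exchange[of \<alpha> \<nu>1 f g "\<pi>1 \<circ>1 t" p1] whisker_exchange[of \<alpha> \<nu>2 f g "\<pi>2 \<circ>1 t" "i \<circ>1 p2"] that p c n by simp_all
  have y1: "rwhisker T \<delta>1 g \<cdot>2 lwhisker T \<pi>1 (lwhisker T d \<beta>) = \<beta> \<cdot>2 rwhisker T \<delta>1 f"
    and y2: "rwhisker T \<delta>2 g \<cdot>2 lwhisker T \<pi>2 (lwhisker T d \<beta>) = \<beta> \<cdot>2 rwhisker T \<delta>2 f"
    if "\<beta> \<in> Cell2 T" "Dom2 T \<beta> = f" "Cod2 T \<beta> = g" "f \<in> Cell1 T" "g \<in> Cell1 T"
      "Cod1 T f = Cod1 T i" for \<beta> f g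
    using whisker_exchange[of \<beta> \<delta>1 f g "\<pi>1 \<circ>1 d" "Id1 T (Cod1 T i)"] whisker_exchange[of \<beta> \<delta>2 f g "\<pi>2 \<circ>1 d" "Id1 T (Cod1 T i)"] that p c n by simp_all
  have z1: "rwhisker T \<kappa> g \<cdot>2 lwhisker T p1 (lwhisker T p \<sigma>) = lwhisker T i \<sigma> \<cdot>2 rwhisker T \<kappa> f"
    and z2: "rwhisker T \<rho> g \<cdot>2 lwhisker T p2 (lwhisker T p \<sigma>) = \<sigma> \<cdot>2 rwhisker T \<rho> f"
    if "\<sigma> \<in> Cell2 T" "Dom2 T \<sigma> = f" "Cod2 T \<sigma> = g" "f \<in> Cell1 T" "g \<in> Cell1 T"
      "Cod1 T f = Dom1 T i" for \<sigma> f g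
    using whisker_exchange[of \<sigma> \<kappa> f g "p1 \<circ>1 p" i] whisker_exchange[of \<sigma> \<rho> f g "p2 \<circ>1 p" "Id1 T (Dom1 T i)"] that p c n by simp_all
  show ?thesis
  proof (rule mackey_squareI)
    fix a b \<phi>
    assume a: "a \<in> Cell1 T" "b \<in> Cell1 T" "Dom1 T a = Dom1 T b" "Cod1 T a = Dom1 T t" "Cod1 T b = Dom1 T d"
      "\<phi> \<in> Cell2 T" "Dom2 T \<phi> = t \<circ>1 a" "Cod2 T \<phi> = d \<circ>1 b"
    \<comment> \<open>The 1-cell to be constructed is the second component of \<open>a\<close>; \<open>\<beta>\<close> is read off from \<open>\<pi>2 \<phi>\<close>, and then
      the first component of \<open>\<alpha>\<close> is forced by \<open>\<pi>1 \<phi>\<close>.\<close>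
    define f where "f = p2 \<circ>1 a"
    define \<beta> where "\<beta> = rwhisker T \<delta>2 b \<cdot>2 lwhisker T \<pi>2 \<phi> \<cdot>2 inv_arr (Cells2 T) (rwhisker T \<nu>2 a)"
    have f: "f \<in> Cell1 T" "Dom1 T f = Dom1 T b" "Cod1 T f = Dom1 T i"
      unfolding f_def using a p c by simp_all
    have fe: "i \<circ>1 (p2 \<circ>1 a) = i \<circ>1 f" "p2 \<circ>1 a = f" by (simp_all add: f_def)
    have \<beta>: "\<beta> \<in> Cell2 T" "Dom2 T \<beta> = i \<circ>1 f" "Cod2 T \<beta> = b"
      unfolding \<beta>_def using a p c n fe by simp_all
    obtain \<alpha> where \<alpha>: "\<alpha> \<in> Cell2 T" "Dom2 T \<alpha> = p \<circ>1 f" "Cod2 T \<alpha> = a"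
      and \<alpha>1: "lwhisker T p1 \<alpha> = rwhisker T \<nu>1 a \<cdot>2 inv_arr (Cells2 T) (lwhisker T \<pi>1 \<phi>)
          \<cdot>2 inv_arr (Cells2 T) (rwhisker T \<delta>1 b) \<cdot>2 \<beta> \<cdot>2 rwhisker T \<kappa> f"
      and \<alpha>2: "lwhisker T p2 \<alpha> = rwhisker T \<rho> f"
      by (rule product_cone_cell[OF R, of "p \<circ>1 f" a "rwhisker T \<nu>1 a \<cdot>2 inv_arr (Cells2 T) (lwhisker T \<pi>1 \<phi>)
          \<cdot>2 inv_arr (Cells2 T) (rwhisker T \<delta>1 b) \<cdot>2 \<beta> \<cdot>2 rwhisker T \<kappa> f" "rwhisker T \<rho> f"])
        (use f \<beta> a p c n fe in simp_all)
    have "\<phi> \<cdot>2 lwhisker T t \<alpha> \<cdot>2 rwhisker T \<gamma> f = lwhisker T d \<beta>"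
    proof (rule product_cone_eqI[OF Q])
      have w1: "lwhisker T \<pi>1 (lwhisker T t \<alpha>) = inv_arr (Cells2 T) (lwhisker T \<pi>1 \<phi>)
          \<cdot>2 inv_arr (Cells2 T) (rwhisker T \<delta>1 b) \<cdot>2 \<beta> \<cdot>2 rwhisker T \<kappa> f \<cdot>2 rwhisker T \<nu>1 (p \<circ>1 f)"
        by (rule comp_left_cancel[OF category2, of "rwhisker T \<nu>1 a"])
          (use x1[OF \<alpha>] \<alpha>1 a p c n f \<beta> \<alpha> in simp_all)
      show "lwhisker T \<pi>1 (\<phi> \<cdot>2 lwhisker T t \<alpha> \<cdot>2 rwhisker T \<gamma> f) = lwhisker T \<pi>1 (lwhisker T d \<beta>)"
        by (rule comp_left_cancel[OF category2, of "rwhisker T \<delta>1 b"])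
          (use w1 y1[OF \<beta>] e1'[of f] a p c n f \<beta> \<alpha> in simp_all)
      have w2: "lwhisker T \<pi>2 (lwhisker T t \<alpha>) = inv_arr (Cells2 T) (rwhisker T \<nu>2 a)
          \<cdot>2 rwhisker T (lwhisker T i \<rho>) f \<cdot>2 rwhisker T \<nu>2 (p \<circ>1 f)"
        by (rule comp_left_cancel[OF category2, of "rwhisker T \<nu>2 a"])
          (use x2[OF \<alpha>] \<alpha>2 fe a p c n f \<beta> \<alpha> in simp_all)
      show "lwhisker T \<pi>2 (\<phi> \<cdot>2 lwhisker T t \<alpha> \<cdot>2 rwhisker T \<gamma> f) = lwhisker T \<pi>2 (lwhisker T d \<beta>)"
        by (rule comp_left_cancel[OF category2, of "rwhisker T \<delta>2 b"])
          (use w2 y2[OF \<beta>] e2'[of f, symmetric] a p c n f \<beta>(1) \<alpha> fe in \<open>simp_all add: \<beta>_def\<close>)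
    qed (use a p c n f \<beta> \<alpha> in simp_all)
    then show "\<exists>f\<in>Hom1 T (Dom1 T b) (Dom1 T p). \<exists>\<alpha>\<in>Hom2 T (p \<circ>1 f) a. \<exists>\<beta>\<in>Hom2 T (i \<circ>1 f) b.
        \<phi> \<cdot>2 lwhisker T t \<alpha> \<cdot>2 rwhisker T \<gamma> f = lwhisker T d \<beta>"
      by (intro bexI[of _ f] bexI[of _ \<alpha>] bexI[of _ \<beta>]) (use a c f \<alpha> \<beta> in simp_all)
  next
    fix f g \<alpha> \<beta>
    assume f: "f \<in> Cell1 T" "g \<in> Cell1 T" "Dom1 T f = Dom1 T g" "Cod1 T f = Dom1 T p" "Cod1 T g = Dom1 T p"
      and \<alpha>: "\<alpha> \<in> Cell2 T" "Dom2 T \<alpha> = p \<circ>1 f" "Cod2 T \<alpha> = p \<circ>1 g"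
        "\<beta> \<in> Cell2 T" "Dom2 T \<beta> = i \<circ>1 f" "Cod2 T \<beta> = i \<circ>1 g"
      and e: "lwhisker T t \<alpha> \<cdot>2 rwhisker T \<gamma> f = rwhisker T \<gamma> g \<cdot>2 lwhisker T d \<beta>"
    \<comment> \<open>Since \<open>p2 p\<close> is the identity up to \<open>\<rho>\<close>, the second component of \<open>\<alpha>\<close> determines \<open>\<sigma>\<close>.\<close>
    define \<sigma> where "\<sigma> = rwhisker T \<rho> g \<cdot>2 lwhisker T p2 \<alpha> \<cdot>2 inv_arr (Cells2 T) (rwhisker T \<rho> f)"
    have \<sigma>: "\<sigma> \<in> Cell2 T" "Dom2 T \<sigma> = f" "Cod2 T \<sigma> = g"
      unfolding \<sigma>_def using f \<alpha> p c n by simp_all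
    have \<rho>\<sigma>: "rwhisker T \<rho> g \<cdot>2 lwhisker T p2 \<alpha> = \<sigma> \<cdot>2 rwhisker T \<rho> f"
      unfolding \<sigma>_def using f \<alpha> p c n by simp
    have l1: "lwhisker T \<pi>1 (lwhisker T t \<alpha>) \<cdot>2 rwhisker T (lwhisker T \<pi>1 \<gamma>) f
        = rwhisker T (lwhisker T \<pi>1 \<gamma>) g \<cdot>2 lwhisker T \<pi>1 (lwhisker T d \<beta>)"
      and l2: "lwhisker T \<pi>2 (lwhisker T t \<alpha>) \<cdot>2 rwhisker T (lwhisker T \<pi>2 \<gamma>) f
        = rwhisker T (lwhisker T \<pi>2 \<gamma>) g \<cdot>2 lwhisker T \<pi>2 (lwhisker T d \<beta>)"
      using arg_cong[OF e, of "lwhisker T \<pi>1"] arg_cong[OF e, of "lwhisker T \<pi>2"] f \<alpha> p c n by simp_all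
    have i\<sigma>: "lwhisker T i \<sigma> = \<beta>"
    proof -
      have i\<rho>\<sigma>: "lwhisker T i \<sigma> \<cdot>2 rwhisker T (lwhisker T i \<rho>) f
          = rwhisker T (lwhisker T i \<rho>) g \<cdot>2 lwhisker T i (lwhisker T p2 \<alpha>)"
        using arg_cong[OF \<rho>\<sigma>, of "lwhisker T i"] f \<alpha> \<sigma> p c n by simp
      have "lwhisker T i \<sigma> \<cdot>2 rwhisker T (rwhisker T \<delta>2 i) f
          = lwhisker T i \<sigma> \<cdot>2 rwhisker T (lwhisker T i \<rho>) f \<cdot>2 rwhisker T \<nu>2 (p \<circ>1 f) \<cdot>2 rwhisker T (lwhisker T \<pi>2 \<gamma>) f"
        using e2'[of f, symmetric] f \<alpha> \<sigma> p c n by simp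
      also have "\<dots> = rwhisker T (lwhisker T i \<rho>) g \<cdot>2 lwhisker T i (lwhisker T p2 \<alpha>) \<cdot>2 rwhisker T \<nu>2 (p \<circ>1 f)
            \<cdot>2 rwhisker T (lwhisker T \<pi>2 \<gamma>) f"
        using extend2[OF i\<rho>\<sigma>] f \<alpha> \<sigma> p c n by simp
      also have "\<dots> = rwhisker T (lwhisker T i \<rho>) g \<cdot>2 rwhisker T \<nu>2 (p \<circ>1 g) \<cdot>2 lwhisker T \<pi>2 (lwhisker T t \<alpha>)
            \<cdot>2 rwhisker T (lwhisker T \<pi>2 \<gamma>) f"
        using extend2[OF x2[OF \<alpha>(1-3)], of "rwhisker T (lwhisker T \<pi>2 \<gamma>) f"] f \<alpha> \<sigma> p c n by simp
      also have "\<dots> = (rwhisker T (lwhisker T i \<rho>) g \<cdot>2 rwhisker T (rwhisker T \<nu>2 p) g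
            \<cdot>2 rwhisker T (lwhisker T \<pi>2 \<gamma>) g) \<cdot>2 lwhisker T \<pi>2 (lwhisker T d \<beta>)"
        using l2 f \<alpha> \<sigma> p c n by simp
      also have "\<dots> = \<beta> \<cdot>2 rwhisker T (rwhisker T \<delta>2 i) f"
        unfolding e2'[of g, OF f(2) f(5)[unfolded c]] using y2[OF \<alpha>(4-6)] f \<alpha> p c n by simp
      finally show ?thesis
        by (rule comp_right_cancel[OF category2]) (use f \<alpha> \<sigma> p c n in simp_all)
    qed
    have "lwhisker T p \<sigma> = \<alpha>"
    proof (rule product_cone_eqI[OF R])
      show "lwhisker T p2 (lwhisker T p \<sigma>) = lwhisker T p2 \<alpha>"
        by (rule comp_left_cancel[OF category2, of "rwhisker T \<rho> g"])
          (use z2[OF \<sigma>] \<rho>\<sigma> f \<alpha> \<sigma> p c n in simp_all)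
      let ?r = "rwhisker T (rwhisker T \<nu>1 p) f \<cdot>2 rwhisker T (lwhisker T \<pi>1 \<gamma>) f"
      have "(rwhisker T \<kappa> g \<cdot>2 lwhisker T p1 (lwhisker T p \<sigma>)) \<cdot>2 ?r = \<beta> \<cdot>2 rwhisker T \<kappa> f \<cdot>2 ?r"
        unfolding z1[OF \<sigma> f(1,2) f(4)[unfolded c]] i\<sigma> using f \<alpha> \<sigma> p c n by simp
      also have "\<dots> = (rwhisker T \<kappa> g \<cdot>2 rwhisker T (rwhisker T \<nu>1 p) g
            \<cdot>2 rwhisker T (lwhisker T \<pi>1 \<gamma>) g) \<cdot>2 lwhisker T \<pi>1 (lwhisker T d \<beta>)"
        unfolding e1'[of g, OF f(2) f(5)[unfolded c]] using e1'[of f] y1[OF \<alpha>(4-6)] f \<alpha> p c n by simp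
      also have "\<dots> = rwhisker T \<kappa> g \<cdot>2 rwhisker T \<nu>1 (p \<circ>1 g) \<cdot>2 lwhisker T \<pi>1 (lwhisker T t \<alpha>)
            \<cdot>2 rwhisker T (lwhisker T \<pi>1 \<gamma>) f"
        using l1 f \<alpha> p c n by simp
      also have "\<dots> = (rwhisker T \<kappa> g \<cdot>2 lwhisker T p1 \<alpha>) \<cdot>2 ?r"
        using extend2[OF x1[OF \<alpha>(1-3)], of "rwhisker T (lwhisker T \<pi>1 \<gamma>) f"] f \<alpha> p c n by simp
      finally have "rwhisker T \<kappa> g \<cdot>2 lwhisker T p1 (lwhisker T p \<sigma>) = rwhisker T \<kappa> g \<cdot>2 lwhisker T p1 \<alpha>"
        by (rule comp_right_cancel[OF category2]) (use f \<alpha> \<sigma> p c n in simp_all)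
      then show "lwhisker T p1 (lwhisker T p \<sigma>) = lwhisker T p1 \<alpha>"
        by (rule comp_left_cancel[OF category2]) (use f \<alpha> \<sigma> p c n in simp_all)
    qed (use f \<alpha> \<sigma> p c n in simp_all)
    then show "\<exists>\<sigma>\<in>Hom2 T f g. lwhisker T p \<sigma> = \<alpha> \<and> lwhisker T i \<sigma> = \<beta>"
      using i\<sigma> by (intro bexI[of _ \<sigma>]) (use \<sigma> in simp_all)
  next
    fix \<sigma> \<tau>
    assume \<sigma>: "\<sigma> \<in> Cell2 T" "\<tau> \<in> Cell2 T" "Dom2 T \<sigma> = Dom2 T \<tau>" "Cod2 T \<sigma> = Cod2 T \<tau>"
      "Cod1 T (Dom2 T \<tau>) = Dom1 T p" "lwhisker T p \<sigma> = lwhisker T p \<tau>" "lwhisker T i \<sigma> = lwhisker T i \<tau>"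
    have "\<sigma> \<cdot>2 rwhisker T \<rho> (Dom2 T \<tau>) = \<tau> \<cdot>2 rwhisker T \<rho> (Dom2 T \<tau>)"
      using z2[of \<tau> "Dom2 T \<tau>" "Cod2 T \<tau>"] z2[of \<sigma> "Dom2 T \<tau>" "Cod2 T \<tau>"] \<sigma> c by simp
    then show "\<sigma> = \<tau>"
      by (rule comp_right_cancel[OF category2]) (use \<sigma> c n p in simp_all)
  qed (use p c n in simp_all)
qed

end


section \<open>A calculus of pushforwards\<close>

text \<open>The part of a strict 2-functor that the calculations use, without any linear structure, so that it
  also applies to the doubled categories below.\<close>

locale indexed_category = two_one_category T
  for T :: "('o, 'c, 't) twocat" (structure) +
  fixes V :: "'o \<Rightarrow> ('a, 'm, 'z) cat_scheme" and P :: "'c \<Rightarrow> ('a, 'm, 'a, 'm) fctr" and P2 :: "'t \<Rightarrow> 'a \<Rightarrow> 'm"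
  assumes V_category [simp]: "G \<in> Obj T \<Longrightarrow> category (V G)"
    and P_ob [simp]: "u \<in> Cell1 T \<Longrightarrow> X \<in> Ob (V (Cod1 T u)) \<Longrightarrow> Dom1 T u = H \<Longrightarrow> P u $o X \<in> Ob (V H)"
    and P_arr [simp]: "u \<in> Cell1 T \<Longrightarrow> f \<in> Arr (V (Cod1 T u)) \<Longrightarrow> Dom1 T u = H \<Longrightarrow> P u $a f \<in> Arr (V H)"
    and P_Dom [simp]: "u \<in> Cell1 T \<Longrightarrow> f \<in> Arr (V (Cod1 T u)) \<Longrightarrow> Dom1 T u = H \<Longrightarrow>
      Dom (V H) (P u $a f) = P u $o Dom (V (Cod1 T u)) f"
    and P_Cod [simp]: "u \<in> Cell1 T \<Longrightarrow> f \<in> Arr (V (Cod1 T u)) \<Longrightarrow> Dom1 T u = H \<Longrightarrow>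
      Cod (V H) (P u $a f) = P u $o Cod (V (Cod1 T u)) f"
    and P_Idt [simp]: "u \<in> Cell1 T \<Longrightarrow> Cod1 T u = G \<Longrightarrow> X \<in> Ob (V G) \<Longrightarrow>
      P u $a Idt (V G) X = Idt (V (Dom1 T u)) (P u $o X)"
    and P_Comp [simp]: "u \<in> Cell1 T \<Longrightarrow> Cod1 T u = G \<Longrightarrow> f \<in> Arr (V G) \<Longrightarrow> g \<in> Arr (V G) \<Longrightarrow>
      Dom (V G) g = Cod (V G) f \<Longrightarrow>
      P u $a (g \<cdot>\<^bsub>V G\<^esub> f) = (P u $a g) \<cdot>\<^bsub>V (Dom1 T u)\<^esub> (P u $a f)"
    and P_Id1 [simp]: "G \<in> Obj T \<Longrightarrow> X \<in> Ob (V G) \<Longrightarrow> P (Id1 T G) $o X = X"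
      "G \<in> Obj T \<Longrightarrow> f \<in> Arr (V G) \<Longrightarrow> P (Id1 T G) $a f = f"
    and P_comp1 [simp]: "u \<in> Cell1 T \<Longrightarrow> v \<in> Cell1 T \<Longrightarrow> Dom1 T u = Cod1 T v \<Longrightarrow> X \<in> Ob (V (Cod1 T u)) \<Longrightarrow>
      P (u \<circ>1 v) $o X = P v $o P u $o X"
      "u \<in> Cell1 T \<Longrightarrow> v \<in> Cell1 T \<Longrightarrow> Dom1 T u = Cod1 T v \<Longrightarrow> f \<in> Arr (V (Cod1 T u)) \<Longrightarrow>
      P (u \<circ>1 v) $a f = P v $a P u $a f"
    and P2_arr [simp]: "\<alpha> \<in> Cell2 T \<Longrightarrow> Dom1 T (Dom2 T \<alpha>) = H \<Longrightarrow> X \<in> Ob (V (Cod1 T (Dom2 T \<alpha>))) \<Longrightarrow> P2 \<alpha> X \<in> Arr (V H)"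
      "\<alpha> \<in> Cell2 T \<Longrightarrow> Dom1 T (Dom2 T \<alpha>) = H \<Longrightarrow> X \<in> Ob (V (Cod1 T (Dom2 T \<alpha>))) \<Longrightarrow>
        Dom (V H) (P2 \<alpha> X) = P (Dom2 T \<alpha>) $o X"
      "\<alpha> \<in> Cell2 T \<Longrightarrow> Dom1 T (Dom2 T \<alpha>) = H \<Longrightarrow> X \<in> Ob (V (Cod1 T (Dom2 T \<alpha>))) \<Longrightarrow>
        Cod (V H) (P2 \<alpha> X) = P (Cod2 T \<alpha>) $o X"
    and P2_natural: "\<alpha> \<in> Cell2 T \<Longrightarrow> Dom1 T (Dom2 T \<alpha>) = H \<Longrightarrow> f \<in> Arr (V (Cod1 T (Dom2 T \<alpha>))) \<Longrightarrow>
      Dom2 T \<alpha> = u \<Longrightarrow> Cod2 T \<alpha> = v \<Longrightarrow> Dom (V (Cod1 T (Dom2 T \<alpha>))) f = X \<Longrightarrow> Cod (V (Cod1 T (Dom2 T \<alpha>))) f = Y \<Longrightarrow>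
      P2 \<alpha> Y \<cdot>\<^bsub>V H\<^esub> (P u $a f) = (P v $a f) \<cdot>\<^bsub>V H\<^esub> P2 \<alpha> X"
    and P2_comp [simp]: "\<alpha> \<in> Cell2 T \<Longrightarrow> \<beta> \<in> Cell2 T \<Longrightarrow> Dom2 T \<beta> = Cod2 T \<alpha> \<Longrightarrow> X \<in> Ob (V (Cod1 T (Dom2 T \<alpha>))) \<Longrightarrow>
      P2 (\<beta> \<cdot>2 \<alpha>) X = P2 \<beta> X \<cdot>\<^bsub>V (Dom1 T (Dom2 T \<alpha>))\<^esub> P2 \<alpha> X"
    and P2_Id2 [simp]: "u \<in> Cell1 T \<Longrightarrow> X \<in> Ob (V (Cod1 T u)) \<Longrightarrow> P2 (Id2 T u) X = Idt (V (Dom1 T u)) (P u $o X)"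
    and P2_lwhisker [simp]: "u \<in> Cell1 T \<Longrightarrow> \<alpha> \<in> Cell2 T \<Longrightarrow> Dom1 T u = Cod1 T (Dom2 T \<alpha>) \<Longrightarrow> X \<in> Ob (V (Cod1 T u)) \<Longrightarrow>
      P2 (lwhisker T u \<alpha>) X = P2 \<alpha> (P u $o X)"
    and P2_rwhisker [simp]: "u \<in> Cell1 T \<Longrightarrow> \<alpha> \<in> Cell2 T \<Longrightarrow> Dom1 T (Dom2 T \<alpha>) = Cod1 T u \<Longrightarrow> X \<in> Ob (V (Cod1 T (Dom2 T \<alpha>))) \<Longrightarrow>
      P2 (rwhisker T \<alpha> u) X = P u $a P2 \<alpha> X"

text \<open>Pushforwards by their universal property instead of by chosen adjoints. An arrow of \<open>V G\<close> is to be
  thought of as a pair of opposite morphisms and \<open>U G\<close> as the set of pairs of mutually inverse ones.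
  \<open>pushfwd i Z A w\<close> says that \<open>w = (e, h)\<close> from \<open>i\<^sup>* A\<close> to \<open>Z\<close> makes \<open>A\<close> a left and a right pushforward of \<open>Z\<close>,
  in the sense that the transposes \<open>A \<rightarrow> i\<^sub>* Z\<close> of \<open>e\<close> and \<open>i\<^sub>! Z \<rightarrow> A\<close> of \<open>h\<close> are mutually inverse. The
  assumptions are the closure properties from which both implications are derived; those on
  identities, composition, 2-cells and base change are what rectification provides.\<close>

locale pushforwards = indexed_category T V P P2
  for T :: "('o, 'c, 't) twocat" (structure) and V :: "'o \<Rightarrow> ('a, 'm) cat" and P P2 +
  fixes J :: "'c set" and U :: "'o \<Rightarrow> 'm set" and pushfwd :: "'c \<Rightarrow> 'a \<Rightarrow> 'a \<Rightarrow> 'm \<Rightarrow> bool"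
  assumes J_Cell1 [simp]: "i \<in> J \<Longrightarrow> i \<in> Cell1 T"
    and J_Id1 [simp]: "G \<in> Obj T \<Longrightarrow> Id1 T G \<in> J"
    and J_comp [simp]: "i \<in> J \<Longrightarrow> j \<in> J \<Longrightarrow> Dom1 T i = Cod1 T j \<Longrightarrow> i \<circ>1 j \<in> J"
    and U_Arr [simp]: "a \<in> U G \<Longrightarrow> G \<in> Obj T \<Longrightarrow> a \<in> Arr (V G)"
    and U_Idt [simp]: "G \<in> Obj T \<Longrightarrow> X \<in> Ob (V G) \<Longrightarrow> Idt (V G) X \<in> U G"
    and U_comp [simp]: "G \<in> Obj T \<Longrightarrow> a \<in> U G \<Longrightarrow> b \<in> U G \<Longrightarrow> Dom (V G) b = Cod (V G) a \<Longrightarrow> b \<cdot>\<^bsub>V G\<^esub> a \<in> U G"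
    and U_P [simp]: "u \<in> Cell1 T \<Longrightarrow> a \<in> U (Cod1 T u) \<Longrightarrow> Dom1 T u = H \<Longrightarrow> P u $a a \<in> U H"
    and U_P2 [simp]: "\<alpha> \<in> Cell2 T \<Longrightarrow> Dom1 T (Dom2 T \<alpha>) = H \<Longrightarrow> X \<in> Ob (V (Cod1 T (Dom2 T \<alpha>))) \<Longrightarrow> P2 \<alpha> X \<in> U H"
    and pushfwdD: "pushfwd i Z A w \<Longrightarrow> i \<in> J" "pushfwd i Z A w \<Longrightarrow> Z \<in> Ob (V (Dom1 T i))"
      "pushfwd i Z A w \<Longrightarrow> A \<in> Ob (V (Cod1 T i))" "pushfwd i Z A w \<Longrightarrow> w \<in> Arr (V (Dom1 T i))"
      "pushfwd i Z A w \<Longrightarrow> Dom (V (Dom1 T i)) w = P i $o A" "pushfwd i Z A w \<Longrightarrow> Cod (V (Dom1 T i)) w = Z"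
    and pushfwd_unique: "pushfwd i Z A w \<Longrightarrow> pushfwd i Z A' w' \<Longrightarrow>
      \<exists>a \<in> U (Cod1 T i). Dom (V (Cod1 T i)) a = A \<and> Cod (V (Cod1 T i)) a = A' \<and> w = w' \<cdot>\<^bsub>V (Dom1 T i)\<^esub> (P i $a a)"
    and pushfwd_source: "i \<in> J \<Longrightarrow> a \<in> U (Cod1 T i) \<Longrightarrow> Dom (V (Cod1 T i)) a = A \<Longrightarrow> Cod (V (Cod1 T i)) a = A' \<Longrightarrow>
      w \<in> Arr (V (Dom1 T i)) \<Longrightarrow> Dom (V (Dom1 T i)) w = P i $o A' \<Longrightarrow>
      pushfwd i Z A (w \<cdot>\<^bsub>V (Dom1 T i)\<^esub> (P i $a a)) \<longleftrightarrow> pushfwd i Z A' w"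
    and pushfwd_target: "pushfwd i Z A w \<Longrightarrow> z \<in> U (Dom1 T i) \<Longrightarrow> Dom (V (Dom1 T i)) z = Z \<Longrightarrow> Cod (V (Dom1 T i)) z = Z' \<Longrightarrow>
      pushfwd i Z' A (z \<cdot>\<^bsub>V (Dom1 T i)\<^esub> w)"
    and pushfwd_Id1: "G \<in> Obj T \<Longrightarrow> A \<in> Ob (V G) \<Longrightarrow> pushfwd (Id1 T G) A A (Idt (V G) A)"
    and pushfwd_comp: "pushfwd j Z A w \<Longrightarrow> pushfwd i A A' w' \<Longrightarrow> Dom1 T i = Cod1 T j \<Longrightarrow>
      pushfwd (i \<circ>1 j) Z A' (w \<cdot>\<^bsub>V (Dom1 T j)\<^esub> (P j $a w'))"
    and pushfwd_2cell: "pushfwd i Z A w \<Longrightarrow> i' \<in> J \<Longrightarrow> \<alpha> \<in> Cell2 T \<Longrightarrow> Dom2 T \<alpha> = i' \<Longrightarrow> Cod2 T \<alpha> = i \<Longrightarrow>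
      pushfwd i' Z A (w \<cdot>\<^bsub>V (Dom1 T i)\<^esub> P2 \<alpha> A)"
    and pushfwd_base_change: "pushfwd i Z A w \<Longrightarrow> mackey_square T i u p q (inv_arr (Cells2 T) \<gamma>) \<Longrightarrow> q \<in> J \<Longrightarrow>
      \<gamma> \<in> Cell2 T \<Longrightarrow> Dom2 T \<gamma> = u \<circ>1 q \<Longrightarrow> Cod2 T \<gamma> = i \<circ>1 p \<Longrightarrow>
      pushfwd q (P p $o Z) (P u $o A) ((P p $a w) \<cdot>\<^bsub>V (Dom1 T q)\<^esub> P2 \<gamma> A)"


section \<open>Projection formulas and external pairings\<close>

locale pairing_calculus =
  M: pushforwards T VM PM TM J uM pushfwdM + N: pushforwards T VN PN TN J uN pushfwdN +
  L: pushforwards T VL PL TL J uL pushfwdL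
  for T :: "('o, 'c, 't) twocat" (structure) and J :: "'c set"
    and VM :: "'o \<Rightarrow> ('a, 'm) cat" and PM TM uM pushfwdM
    and VN :: "'o \<Rightarrow> ('b, 'n) cat" and PN TN uN pushfwdN
    and VL :: "'o \<Rightarrow> ('d, 'l) cat" and PL TL uL pushfwdL +
  fixes bob :: "'o \<Rightarrow> 'a \<Rightarrow> 'b \<Rightarrow> 'd" and barr :: "'o \<Rightarrow> 'm \<Rightarrow> 'n \<Rightarrow> 'l" and bnat :: "'c \<Rightarrow> 'a \<Rightarrow> 'b \<Rightarrow> 'l"
  assumes bob_Ob [simp]: "G \<in> Obj T \<Longrightarrow> X \<in> Ob (VM G) \<Longrightarrow> Y \<in> Ob (VN G) \<Longrightarrow> bob G X Y \<in> Ob (VL G)"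
    and barr_Arr [simp]: "G \<in> Obj T \<Longrightarrow> f \<in> Arr (VM G) \<Longrightarrow> g \<in> Arr (VN G) \<Longrightarrow> barr G f g \<in> Arr (VL G)"
      "G \<in> Obj T \<Longrightarrow> f \<in> Arr (VM G) \<Longrightarrow> g \<in> Arr (VN G) \<Longrightarrow> Dom (VL G) (barr G f g) = bob G (Dom (VM G) f) (Dom (VN G) g)"
      "G \<in> Obj T \<Longrightarrow> f \<in> Arr (VM G) \<Longrightarrow> g \<in> Arr (VN G) \<Longrightarrow> Cod (VL G) (barr G f g) = bob G (Cod (VM G) f) (Cod (VN G) g)"
    and barr_Idt [simp]: "G \<in> Obj T \<Longrightarrow> X \<in> Ob (VM G) \<Longrightarrow> Y \<in> Ob (VN G) \<Longrightarrow>
      barr G (Idt (VM G) X) (Idt (VN G) Y) = Idt (VL G) (bob G X Y)"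
    and barr_comp [simp]: "G \<in> Obj T \<Longrightarrow> f \<in> Arr (VM G) \<Longrightarrow> g \<in> Arr (VN G) \<Longrightarrow> f' \<in> Arr (VM G) \<Longrightarrow> g' \<in> Arr (VN G) \<Longrightarrow>
      Dom (VM G) f' = Cod (VM G) f \<Longrightarrow> Dom (VN G) g' = Cod (VN G) g \<Longrightarrow>
      barr G f' g' \<cdot>\<^bsub>VL G\<^esub> barr G f g = barr G (f' \<cdot>\<^bsub>VM G\<^esub> f) (g' \<cdot>\<^bsub>VN G\<^esub> g)"
    and barr_U [simp]: "G \<in> Obj T \<Longrightarrow> f \<in> uM G \<Longrightarrow> g \<in> uN G \<Longrightarrow> barr G f g \<in> uL G"
    and bnat_U [simp]: "u \<in> Cell1 T \<Longrightarrow> Dom1 T u = H \<Longrightarrow> X \<in> Ob (VM (Cod1 T u)) \<Longrightarrow> Y \<in> Ob (VN (Cod1 T u)) \<Longrightarrow> bnat u X Y \<in> uL H"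
    and bnat_Dom [simp]: "u \<in> Cell1 T \<Longrightarrow> Dom1 T u = H \<Longrightarrow> X \<in> Ob (VM (Cod1 T u)) \<Longrightarrow> Y \<in> Ob (VN (Cod1 T u)) \<Longrightarrow>
        Dom (VL H) (bnat u X Y) = PL u $o bob (Cod1 T u) X Y"
    and bnat_Cod [simp]: "u \<in> Cell1 T \<Longrightarrow> Dom1 T u = H \<Longrightarrow> X \<in> Ob (VM (Cod1 T u)) \<Longrightarrow> Y \<in> Ob (VN (Cod1 T u)) \<Longrightarrow>
        Cod (VL H) (bnat u X Y) = bob H (PM u $o X) (PN u $o Y)"
    and bnat_natural [simp]: "u \<in> Cell1 T \<Longrightarrow> Dom1 T u = H \<Longrightarrow> Cod1 T u = G \<Longrightarrow> f \<in> Arr (VM G) \<Longrightarrow> g \<in> Arr (VN G) \<Longrightarrow>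
        Cod (VM G) f = X' \<Longrightarrow> Cod (VN G) g = Y' \<Longrightarrow>
        bnat u X' Y' \<cdot>\<^bsub>VL H\<^esub> (PL u $a barr G f g) =
        barr H (PM u $a f) (PN u $a g) \<cdot>\<^bsub>VL H\<^esub> bnat u (Dom (VM G) f) (Dom (VN G) g)"
    and bnat_Id1 [simp]: "G \<in> Obj T \<Longrightarrow> X \<in> Ob (VM G) \<Longrightarrow> Y \<in> Ob (VN G) \<Longrightarrow> bnat (Id1 T G) X Y = Idt (VL G) (bob G X Y)"
    and bnat_comp1 [simp]: "u \<in> Cell1 T \<Longrightarrow> v \<in> Cell1 T \<Longrightarrow> Dom1 T u = Cod1 T v \<Longrightarrow> X \<in> Ob (VM (Cod1 T u)) \<Longrightarrow> Y \<in> Ob (VN (Cod1 T u)) \<Longrightarrow>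
        bnat (u \<circ>1 v) X Y = bnat v (PM u $o X) (PN u $o Y) \<cdot>\<^bsub>VL (Dom1 T v)\<^esub> (PL v $a bnat u X Y)"
    and bnat_2cell: "\<alpha> \<in> Cell2 T \<Longrightarrow> Dom2 T \<alpha> = u \<Longrightarrow> Cod2 T \<alpha> = v \<Longrightarrow> Dom1 T u = H \<Longrightarrow> Cod1 T u = G \<Longrightarrow>
        X \<in> Ob (VM G) \<Longrightarrow> Y \<in> Ob (VN G) \<Longrightarrow>
        bnat v X Y \<cdot>\<^bsub>VL H\<^esub> TL \<alpha> (bob G X Y) = barr H (TM \<alpha> X) (TN \<alpha> Y) \<cdot>\<^bsub>VL H\<^esub> bnat u X Y"
begin

lemma barr_comp_extend [simp]:
  assumes "G \<in> Obj T" "f \<in> Arr (VM G)" "g \<in> Arr (VN G)" "f' \<in> Arr (VM G)" "g' \<in> Arr (VN G)"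
    "Dom (VM G) f' = Cod (VM G) f" "Dom (VN G) g' = Cod (VN G) g"
    "x \<in> Arr (VL G)" "Cod (VL G) x = bob G (Dom (VM G) f) (Dom (VN G) g)"
  shows "barr G f' g' \<cdot>\<^bsub>VL G\<^esub> (barr G f g \<cdot>\<^bsub>VL G\<^esub> x) = barr G (f' \<cdot>\<^bsub>VM G\<^esub> f) (g' \<cdot>\<^bsub>VN G\<^esub> g) \<cdot>\<^bsub>VL G\<^esub> x"
  by (rule comp_eq_extend[OF _ barr_comp]) (use assms in simp_all)

lemma bnat_natural_extend [simp]:
  assumes "u \<in> Cell1 T" "Dom1 T u = H" "Cod1 T u = G" "f \<in> Arr (VM G)" "g \<in> Arr (VN G)"
    "Cod (VM G) f = X'" "Cod (VN G) g = Y'"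
    "x \<in> Arr (VL H)" "Cod (VL H) x = PL u $o bob G (Dom (VM G) f) (Dom (VN G) g)"
  shows "bnat u X' Y' \<cdot>\<^bsub>VL H\<^esub> ((PL u $a barr G f g) \<cdot>\<^bsub>VL H\<^esub> x) =
    barr H (PM u $a f) (PN u $a g) \<cdot>\<^bsub>VL H\<^esub> (bnat u (Dom (VM G) f) (Dom (VN G) g) \<cdot>\<^bsub>VL H\<^esub> x)"
proof -
  have [simp]: "H \<in> Obj T" "G \<in> Obj T" using assms by auto
  have [simp]: "X' \<in> Ob (VM G)" "Y' \<in> Ob (VN G)" using assms by auto
  show ?thesis
    using comp_eq_extend[OF _ bnat_natural[of u H G f g X' Y'], of x] assms by simp
qed

text \<open>The projection formulas for every object that is presented as a pushforward, not only for the
  chosen one: below they are applied to objects that are pushforwards by base change.\<close>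

definition projection1 :: bool where
  "projection1 \<longleftrightarrow> (\<forall>i X Y A w. X \<in> Ob (VM (Cod1 T i)) \<and> pushfwdN i Y A w \<longrightarrow>
     pushfwdL i (bob (Dom1 T i) (PM i $o X) Y) (bob (Cod1 T i) X A)
       (barr (Dom1 T i) (Idt (VM (Dom1 T i)) (PM i $o X)) w \<cdot>\<^bsub>VL (Dom1 T i)\<^esub> bnat i X A))"

definition projection2 :: bool where
  "projection2 \<longleftrightarrow> (\<forall>i X Y A w. X \<in> Ob (VN (Cod1 T i)) \<and> pushfwdM i Y A w \<longrightarrow>
     pushfwdL i (bob (Dom1 T i) Y (PN i $o X)) (bob (Cod1 T i) A X)
       (barr (Dom1 T i) w (Idt (VN (Dom1 T i)) (PN i $o X)) \<cdot>\<^bsub>VL (Dom1 T i)\<^esub> bnat i A X))"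

text \<open>Two presentations of a pushforward differ by an element of \<open>U\<close>, so one of them decides.\<close>

lemma projection1_transport:
  assumes "X \<in> Ob (VM (Cod1 T i))" "pushfwdN i Y A w" "pushfwdN i Y A' w'"
    and A: "pushfwdL i (bob (Dom1 T i) (PM i $o X) Y) (bob (Cod1 T i) X A)
       (barr (Dom1 T i) (Idt (VM (Dom1 T i)) (PM i $o X)) w \<cdot>\<^bsub>VL (Dom1 T i)\<^esub> bnat i X A)"
  shows "pushfwdL i (bob (Dom1 T i) (PM i $o X) Y) (bob (Cod1 T i) X A')
       (barr (Dom1 T i) (Idt (VM (Dom1 T i)) (PM i $o X)) w' \<cdot>\<^bsub>VL (Dom1 T i)\<^esub> bnat i X A')"
proof -
  obtain a where a: "a \<in> uN (Cod1 T i)" "Dom (VN (Cod1 T i)) a = A" "Cod (VN (Cod1 T i)) a = A'"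
    and w: "w = w' \<cdot>\<^bsub>VN (Dom1 T i)\<^esub> (PN i $a a)"
    using N.pushfwd_unique[OF assms(2,3)] by blast
  note [simp] = N.pushfwdD[OF assms(2)] N.pushfwdD[OF assms(3)] a
  show ?thesis
    by (rule L.pushfwd_source[where a = "barr (Cod1 T i) (Idt (VM (Cod1 T i)) X) a", THEN iffD1])
      (use A assms(1) in \<open>simp_all add: w\<close>)
qed

lemma projection2_transport:
  assumes "X \<in> Ob (VN (Cod1 T i))" "pushfwdM i Y A w" "pushfwdM i Y A' w'"
    and A: "pushfwdL i (bob (Dom1 T i) Y (PN i $o X)) (bob (Cod1 T i) A X)
       (barr (Dom1 T i) w (Idt (VN (Dom1 T i)) (PN i $o X)) \<cdot>\<^bsub>VL (Dom1 T i)\<^esub> bnat i A X)"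
  shows "pushfwdL i (bob (Dom1 T i) Y (PN i $o X)) (bob (Cod1 T i) A' X)
       (barr (Dom1 T i) w' (Idt (VN (Dom1 T i)) (PN i $o X)) \<cdot>\<^bsub>VL (Dom1 T i)\<^esub> bnat i A' X)"
proof -
  obtain a where a: "a \<in> uM (Cod1 T i)" "Dom (VM (Cod1 T i)) a = A" "Cod (VM (Cod1 T i)) a = A'"
    and w: "w = w' \<cdot>\<^bsub>VM (Dom1 T i)\<^esub> (PM i $a a)"
    using M.pushfwd_unique[OF assms(2,3)] by blast
  note [simp] = M.pushfwdD[OF assms(2)] M.pushfwdD[OF assms(3)] a
  show ?thesis
    by (rule L.pushfwd_source[where a = "barr (Cod1 T i) a (Idt (VN (Cod1 T i)) X)", THEN iffD1])
      (use A assms(1) in \<open>simp_all add: w\<close>)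
qed

text \<open>By the second formula \<open>A1 \<odot> W\<close> is a pushforward of \<open>Z1 \<odot> i\<^sup>* W\<close> along \<open>i\<close>, and by the first one the latter
  is a pushforward of \<open>p\<^sup>* Z1 \<odot> Z2\<close> along \<open>p\<close>. The naturality cells of \<open>i\<close> and \<open>p\<close> combine to that of \<open>i p\<close>.\<close>

lemma pushfwd_projection_comp:
  assumes pf: projection1 projection2
    and 1: "pushfwdM i Z1 A1 w1" and W: "W \<in> Ob (VN (Cod1 T i))" and 2: "pushfwdN p Z2 (PN i $o W) w2"
    and ip: "Dom1 T i = Cod1 T p"
  shows "pushfwdL (i \<circ>1 p) (bob (Dom1 T p) (PM p $o Z1) Z2) (bob (Cod1 T i) A1 W)
    (barr (Dom1 T p) (PM p $a w1) w2 \<cdot>\<^bsub>VL (Dom1 T p)\<^esub> bnat (i \<circ>1 p) A1 W)"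
proof -
  note [simp] = M.pushfwdD[OF 1] N.pushfwdD[OF 2] W ip
  have Z1: "Z1 \<in> Ob (VM (Cod1 T p))" using M.pushfwdD(2)[OF 1] by simp
  have a: "pushfwdL i (bob (Dom1 T i) Z1 (PN i $o W)) (bob (Cod1 T i) A1 W)
       (barr (Dom1 T i) w1 (Idt (VN (Dom1 T i)) (PN i $o W)) \<cdot>\<^bsub>VL (Dom1 T i)\<^esub> bnat i A1 W)"
    using pf(2) 1 W unfolding projection2_def by blast
  have b: "pushfwdL p (bob (Dom1 T p) (PM p $o Z1) Z2) (bob (Cod1 T p) Z1 (PN i $o W))
       (barr (Dom1 T p) (Idt (VM (Dom1 T p)) (PM p $o Z1)) w2 \<cdot>\<^bsub>VL (Dom1 T p)\<^esub> bnat p Z1 (PN i $o W))"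
    using pf(1) 2 Z1 unfolding projection1_def by blast
  show ?thesis
    using L.pushfwd_comp[OF b a[unfolded ip] ip] Z1 M.pushfwdD[OF 1, unfolded ip] by simp
qed

end

locale cartesian_pairing_calculus = pairing_calculus +
  fixes S
  assumes product [simp]: "G \<in> Obj T \<Longrightarrow> H \<in> Obj T \<Longrightarrow> product_cone T (Pr1 S G H) (Pr2 S G H)"
    and Prod_Obj [simp]: "G \<in> Obj T \<Longrightarrow> H \<in> Obj T \<Longrightarrow> Prod S G H \<in> Obj T"
    and Pr_Cell1 [simp]: "G \<in> Obj T \<Longrightarrow> H \<in> Obj T \<Longrightarrow> Pr1 S G H \<in> Cell1 T"
      "G \<in> Obj T \<Longrightarrow> H \<in> Obj T \<Longrightarrow> Pr2 S G H \<in> Cell1 T"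
      "G \<in> Obj T \<Longrightarrow> H \<in> Obj T \<Longrightarrow> Dom1 T (Pr1 S G H) = Prod S G H"
      "G \<in> Obj T \<Longrightarrow> H \<in> Obj T \<Longrightarrow> Dom1 T (Pr2 S G H) = Prod S G H"
      "G \<in> Obj T \<Longrightarrow> H \<in> Obj T \<Longrightarrow> Cod1 T (Pr1 S G H) = G"
      "G \<in> Obj T \<Longrightarrow> H \<in> Obj T \<Longrightarrow> Cod1 T (Pr2 S G H) = H"
    and ProdMap_Cell1 [simp]: "u \<in> Cell1 T \<Longrightarrow> v \<in> Cell1 T \<Longrightarrow> ProdMap S u v \<in> Cell1 T"
      "u \<in> Cell1 T \<Longrightarrow> v \<in> Cell1 T \<Longrightarrow> Dom1 T (ProdMap S u v) = Prod S (Dom1 T u) (Dom1 T v)"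
      "u \<in> Cell1 T \<Longrightarrow> v \<in> Cell1 T \<Longrightarrow> Cod1 T (ProdMap S u v) = Prod S (Cod1 T u) (Cod1 T v)"
    and ProdMap_J [simp]: "i \<in> J \<Longrightarrow> j \<in> J \<Longrightarrow> ProdMap S i j \<in> J"
    and PrNat_Cell2 [simp]: "u \<in> Cell1 T \<Longrightarrow> v \<in> Cell1 T \<Longrightarrow> Pr1Nat S u v \<in> Cell2 T"
      "u \<in> Cell1 T \<Longrightarrow> v \<in> Cell1 T \<Longrightarrow> Pr2Nat S u v \<in> Cell2 T"
      "u \<in> Cell1 T \<Longrightarrow> v \<in> Cell1 T \<Longrightarrow> Dom2 T (Pr1Nat S u v) = Pr1 S (Cod1 T u) (Cod1 T v) \<circ>1 ProdMap S u v"
      "u \<in> Cell1 T \<Longrightarrow> v \<in> Cell1 T \<Longrightarrow> Dom2 T (Pr2Nat S u v) = Pr2 S (Cod1 T u) (Cod1 T v) \<circ>1 ProdMap S u v"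
      "u \<in> Cell1 T \<Longrightarrow> v \<in> Cell1 T \<Longrightarrow> Cod2 T (Pr1Nat S u v) = u \<circ>1 Pr1 S (Dom1 T u) (Dom1 T v)"
      "u \<in> Cell1 T \<Longrightarrow> v \<in> Cell1 T \<Longrightarrow> Cod2 T (Pr2Nat S u v) = v \<circ>1 Pr2 S (Dom1 T u) (Dom1 T v)"
begin

text \<open>These are \<open>X \<box> Y\<close>, \<open>f \<box> g\<close> and the isomorphism from \<open>(u1 \<times> u2)\<^sup>*(X \<box> Y)\<close> to \<open>u1\<^sup>* X \<box> u2\<^sup>* Y\<close>, where \<open>\<box>\<close> is
  the external pairing.\<close>

abbreviation "extob G1 G2 X Y \<equiv> bob (Prod S G1 G2) (PM (Pr1 S G1 G2) $o X) (PN (Pr2 S G1 G2) $o Y)"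
abbreviation "extarr G1 G2 f g \<equiv> barr (Prod S G1 G2) (PM (Pr1 S G1 G2) $a f) (PN (Pr2 S G1 G2) $a g)"
abbreviation "extnat u1 u2 X Y \<equiv>
  barr (Prod S (Dom1 T u1) (Dom1 T u2)) (TM (Pr1Nat S u1 u2) X) (TN (Pr2Nat S u1 u2) Y)
    \<cdot>\<^bsub>VL (Prod S (Dom1 T u1) (Dom1 T u2))\<^esub>
  bnat (ProdMap S u1 u2) (PM (Pr1 S (Cod1 T u1) (Cod1 T u2)) $o X) (PN (Pr2 S (Cod1 T u1) (Cod1 T u2)) $o Y)"

definition bimorphism :: bool where
  "bimorphism \<longleftrightarrow> (\<forall>i1 i2 X Y A1 A2 w1 w2. pushfwdM i1 X A1 w1 \<and> pushfwdN i2 Y A2 w2 \<longrightarrow>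
     pushfwdL (ProdMap S i1 i2) (extob (Dom1 T i1) (Dom1 T i2) X Y) (extob (Cod1 T i1) (Cod1 T i2) A1 A2)
       (extarr (Dom1 T i1) (Dom1 T i2) w1 w2 \<cdot>\<^bsub>VL (Prod S (Dom1 T i1) (Dom1 T i2))\<^esub> extnat i1 i2 A1 A2))"

lemma bimorphism_transport:
  assumes 1: "pushfwdM i1 X A1 w1" "pushfwdM i1 X A1' w1'" and 2: "pushfwdN i2 Y A2 w2" "pushfwdN i2 Y A2' w2'"
    and b: "pushfwdL (ProdMap S i1 i2) (extob (Dom1 T i1) (Dom1 T i2) X Y) (extob (Cod1 T i1) (Cod1 T i2) A1 A2)
       (extarr (Dom1 T i1) (Dom1 T i2) w1 w2 \<cdot>\<^bsub>VL (Prod S (Dom1 T i1) (Dom1 T i2))\<^esub> extnat i1 i2 A1 A2)"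
  shows "pushfwdL (ProdMap S i1 i2) (extob (Dom1 T i1) (Dom1 T i2) X Y) (extob (Cod1 T i1) (Cod1 T i2) A1' A2')
       (extarr (Dom1 T i1) (Dom1 T i2) w1' w2' \<cdot>\<^bsub>VL (Prod S (Dom1 T i1) (Dom1 T i2))\<^esub> extnat i1 i2 A1' A2')"
proof -
  obtain a1 where a1: "a1 \<in> uM (Cod1 T i1)" "Dom (VM (Cod1 T i1)) a1 = A1" "Cod (VM (Cod1 T i1)) a1 = A1'"
    and w1: "w1 = w1' \<cdot>\<^bsub>VM (Dom1 T i1)\<^esub> (PM i1 $a a1)"
    using M.pushfwd_unique[OF 1] by blast
  obtain a2 where a2: "a2 \<in> uN (Cod1 T i2)" "Dom (VN (Cod1 T i2)) a2 = A2" "Cod (VN (Cod1 T i2)) a2 = A2'"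
    and w2: "w2 = w2' \<cdot>\<^bsub>VN (Dom1 T i2)\<^esub> (PN i2 $a a2)"
    using N.pushfwd_unique[OF 2] by blast
  note [simp] = M.pushfwdD[OF 1(1)] M.pushfwdD[OF 1(2)] N.pushfwdD[OF 2(1)] N.pushfwdD[OF 2(2)] a1 a2
  let ?P = "Prod S (Dom1 T i1) (Dom1 T i2)"
  let ?W = "extarr (Dom1 T i1) (Dom1 T i2) w1' w2' \<cdot>\<^bsub>VL ?P\<^esub> extnat i1 i2 A1' A2'"
  let ?a = "extarr (Cod1 T i1) (Cod1 T i2) a1 a2"
  have n1: "TM (Pr1Nat S i1 i2) A1' \<cdot>\<^bsub>VM ?P\<^esub> (PM (ProdMap S i1 i2) $a PM (Pr1 S (Cod1 T i1) (Cod1 T i2)) $a a1)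
      = (PM (Pr1 S (Dom1 T i1) (Dom1 T i2)) $a PM i1 $a a1) \<cdot>\<^bsub>VM ?P\<^esub> TM (Pr1Nat S i1 i2) A1"
    using M.P2_natural[of "Pr1Nat S i1 i2" ?P a1 "Pr1 S (Cod1 T i1) (Cod1 T i2) \<circ>1 ProdMap S i1 i2"
      "i1 \<circ>1 Pr1 S (Dom1 T i1) (Dom1 T i2)" A1 A1'] by simp
  have n2: "TN (Pr2Nat S i1 i2) A2' \<cdot>\<^bsub>VN ?P\<^esub> (PN (ProdMap S i1 i2) $a PN (Pr2 S (Cod1 T i1) (Cod1 T i2)) $a a2)
      = (PN (Pr2 S (Dom1 T i1) (Dom1 T i2)) $a PN i2 $a a2) \<cdot>\<^bsub>VN ?P\<^esub> TN (Pr2Nat S i1 i2) A2"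
    using N.P2_natural[of "Pr2Nat S i1 i2" ?P a2 "Pr2 S (Cod1 T i1) (Cod1 T i2) \<circ>1 ProdMap S i1 i2"
      "i2 \<circ>1 Pr2 S (Dom1 T i1) (Dom1 T i2)" A2 A2'] by simp
  have eq: "extarr (Dom1 T i1) (Dom1 T i2) w1 w2 \<cdot>\<^bsub>VL ?P\<^esub> extnat i1 i2 A1 A2
      = ?W \<cdot>\<^bsub>VL (Dom1 T (ProdMap S i1 i2))\<^esub> (PL (ProdMap S i1 i2) $a ?a)"
    using n1 n2 by (simp add: w1 w2)
  show ?thesis
    by (rule L.pushfwd_source[THEN iffD1, OF _ _ _ _ _ _ b[unfolded eq]]) simp_all
qed

text \<open>Up to a 2-cell \<open>\<theta>\<close>, \<open>i1 \<times> i2\<close> is the composite of \<open>g = 1 \<times> i2\<close> and \<open>f = i1 \<times> 1\<close>. By base change along the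
  projections, \<open>\<pi>1\<^sup>* A1\<close> is a pushforward along \<open>f\<close> and \<open>\<pi>2\<^sup>* A2\<close>, restricted along \<open>f\<close>, one along \<open>g\<close>; the
  combined projection formula then treats their product. It remains to see that the resulting
  presentation is the prescribed one, which is a statement about 2-cells: \<open>\<theta>\<close> is defined by its
  two components, and these are composites of the cells of \<open>f\<close> and \<open>g\<close>.\<close>

lemma bimorphism_if_projections:
  assumes pf: projection1 projection2
  shows bimorphism
  unfolding bimorphism_def
proof (intro allI impI, elim conjE)
  fix i1 i2 X Y A1 A2 w1 w2
  assume 1: "pushfwdM i1 X A1 w1" and 2: "pushfwdN i2 Y A2 w2"
  note [simp] = M.pushfwdD[OF 1] N.pushfwdD[OF 2]
  define H1 where "H1 = Dom1 T i1"
  define H2 where "H2 = Dom1 T i2"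
  define G1 where "G1 = Cod1 T i1"
  define G2 where "G2 = Cod1 T i2"
  have D' [simp]: "H1 \<in> Obj T" "H2 \<in> Obj T" "G1 \<in> Obj T" "G2 \<in> Obj T"
    unfolding H1_def H2_def G1_def G2_def by simp_all
  have D [simp]: "Dom1 T i1 = H1" "Dom1 T i2 = H2" "Cod1 T i1 = G1" "Cod1 T i2 = G2"
    by (simp_all add: H1_def H2_def G1_def G2_def)
  note [simp] = M.pushfwdD[OF 1, simplified] N.pushfwdD[OF 2, simplified]
  let ?f = "ProdMap S i1 (Id1 T G2)" and ?g = "ProdMap S (Id1 T H1) i2" and ?t = "ProdMap S i1 i2"
  let ?\<nu>1 = "Pr1Nat S i1 (Id1 T G2)" and ?\<nu>2 = "Pr2Nat S i1 (Id1 T G2)"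
  let ?\<mu>1 = "Pr1Nat S (Id1 T H1) i2" and ?\<mu>2 = "Pr2Nat S (Id1 T H1) i2"
  have s1: "mackey_square T i1 (Pr1 S G1 G2) (Pr1 S H1 G2) ?f (inv_arr (Cells2 T) ?\<nu>1)"
    by (rule M.mackey_square_projection[where q' = "Pr2 S H1 G2" and ?\<pi>2.0 = "Pr2 S G1 G2" and \<delta> = ?\<nu>2]) simp_all
  have s2: "mackey_square T i2 (Pr2 S H1 G2) (Pr2 S H1 H2) ?g (inv_arr (Cells2 T) ?\<mu>2)"
    by (rule M.mackey_square_projection[where q' = "Pr1 S H1 H2" and ?\<pi>2.0 = "Pr1 S H1 G2" and \<delta> = ?\<mu>1])
      (simp_all add: M.product_cone_commute)
  let ?w1 = "(PM (Pr1 S H1 G2) $a w1) \<cdot>\<^bsub>VM (Prod S H1 G2)\<^esub> TM ?\<nu>1 A1"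
  let ?w2 = "(PN (Pr2 S H1 H2) $a w2) \<cdot>\<^bsub>VN (Prod S H1 H2)\<^esub> TN ?\<mu>2 A2"
  have a1: "pushfwdM ?f (PM (Pr1 S H1 G2) $o X) (PM (Pr1 S G1 G2) $o A1) ?w1"
    using M.pushfwd_base_change[OF 1 s1] by simp
  have a2: "pushfwdN ?g (PN (Pr2 S H1 H2) $o Y) (PN (Pr2 S H1 G2) $o A2) ?w2"
    using N.pushfwd_base_change[OF 2 s2] by simp
  \<comment> \<open>\<open>f\<^sup>* \<pi>2\<^sup>* A2\<close> is only isomorphic to \<open>\<pi>2\<^sup>* A2\<close>.\<close>
  let ?w2' = "?w2 \<cdot>\<^bsub>VN (Prod S H1 H2)\<^esub> (PN ?g $a TN ?\<nu>2 A2)"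
  have a2': "pushfwdN ?g (PN (Pr2 S H1 H2) $o Y) (PN ?f $o PN (Pr2 S G1 G2) $o A2) ?w2'"
    using N.pushfwd_source[THEN iffD2, OF _ _ _ _ _ _ a2, of "TN ?\<nu>2 A2" "PN ?f $o PN (Pr2 S G1 G2) $o A2"] by simp
  \<comment> \<open>Likewise \<open>g\<^sup>* \<pi>1\<^sup>* X\<close> is replaced by \<open>\<pi>1\<^sup>* X\<close>, through \<open>z\<close>.\<close>
  let ?z = "barr (Prod S H1 H2) (TM ?\<mu>1 X) (Idt (VN (Prod S H1 H2)) (PN (Pr2 S H1 H2) $o Y))"
  let ?w3 = "barr (Prod S H1 H2) (PM ?g $a ?w1) ?w2' \<cdot>\<^bsub>VL (Prod S H1 H2)\<^esub>
      bnat (?f \<circ>1 ?g) (PM (Pr1 S G1 G2) $o A1) (PN (Pr2 S G1 G2) $o A2)"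
  have a3: "pushfwdL (?f \<circ>1 ?g) (bob (Prod S H1 H2) (PM ?g $o PM (Pr1 S H1 G2) $o X) (PN (Pr2 S H1 H2) $o Y))
      (extob G1 G2 A1 A2) ?w3"
    using pushfwd_projection_comp[OF pf a1 _ a2'] by simp
  have a4: "pushfwdL (?f \<circ>1 ?g) (extob H1 H2 X Y) (extob G1 G2 A1 A2) (?z \<cdot>\<^bsub>VL (Prod S H1 H2)\<^esub> ?w3)"
    using L.pushfwd_target[OF a3, of ?z] by simp
  obtain \<theta> where \<theta>: "\<theta> \<in> Cell2 T" "Dom2 T \<theta> = ?f \<circ>1 ?g" "Cod2 T \<theta> = ?t"
    "lwhisker T (Pr1 S G1 G2) \<theta> = inv_arr (Cells2 T) (Pr1Nat S i1 i2) \<cdot>2 lwhisker T i1 ?\<mu>1 \<cdot>2 rwhisker T ?\<nu>1 ?g"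
    "lwhisker T (Pr2 S G1 G2) \<theta> = inv_arr (Cells2 T) (Pr2Nat S i1 i2) \<cdot>2 ?\<mu>2 \<cdot>2 rwhisker T ?\<nu>2 ?g"
    by (rule M.product_cone_cell[of "Pr1 S G1 G2" "Pr2 S G1 G2" "?f \<circ>1 ?g" ?t
      "inv_arr (Cells2 T) (Pr1Nat S i1 i2) \<cdot>2 lwhisker T i1 ?\<mu>1 \<cdot>2 rwhisker T ?\<nu>1 ?g"
      "inv_arr (Cells2 T) (Pr2Nat S i1 i2) \<cdot>2 ?\<mu>2 \<cdot>2 rwhisker T ?\<nu>2 ?g"]) simp_all
  let ?W = "extarr H1 H2 w1 w2 \<cdot>\<^bsub>VL (Prod S H1 H2)\<^esub> extnat i1 i2 A1 A2"
  have k1: "TM (Pr1Nat S i1 i2) A1 \<cdot>\<^bsub>VM (Prod S H1 H2)\<^esub> TM \<theta> (PM (Pr1 S G1 G2) $o A1)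
      = TM ?\<mu>1 (PM i1 $o A1) \<cdot>\<^bsub>VM (Prod S H1 H2)\<^esub> (PM ?g $a TM ?\<nu>1 A1)"
  proof -
    have "Pr1Nat S i1 i2 \<cdot>2 lwhisker T (Pr1 S G1 G2) \<theta> = lwhisker T i1 ?\<mu>1 \<cdot>2 rwhisker T ?\<nu>1 ?g"
      unfolding \<theta>(4) by simp
    from arg_cong[OF this, of "\<lambda>\<alpha>. TM \<alpha> A1"] \<theta>(1-3) show ?thesis by simp
  qed
  have k2: "TN (Pr2Nat S i1 i2) A2 \<cdot>\<^bsub>VN (Prod S H1 H2)\<^esub> TN \<theta> (PN (Pr2 S G1 G2) $o A2)
      = TN ?\<mu>2 A2 \<cdot>\<^bsub>VN (Prod S H1 H2)\<^esub> (PN ?g $a TN ?\<nu>2 A2)"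
  proof -
    have "Pr2Nat S i1 i2 \<cdot>2 lwhisker T (Pr2 S G1 G2) \<theta> = ?\<mu>2 \<cdot>2 rwhisker T ?\<nu>2 ?g"
      unfolding \<theta>(5) by simp
    from arg_cong[OF this, of "\<lambda>\<alpha>. TN \<alpha> A2"] \<theta>(1-3) show ?thesis by simp
  qed
  have k3: "TM ?\<mu>1 X \<cdot>\<^bsub>VM (Prod S H1 H2)\<^esub> (PM ?g $a PM (Pr1 S H1 G2) $a w1)
      = (PM (Pr1 S H1 H2) $a w1) \<cdot>\<^bsub>VM (Prod S H1 H2)\<^esub> TM ?\<mu>1 (PM i1 $o A1)"
    using M.P2_natural[of ?\<mu>1 "Prod S H1 H2" w1 "Pr1 S H1 G2 \<circ>1 ?g" "Pr1 S H1 H2" "PM i1 $o A1" X] by simp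
  have eq: "?z \<cdot>\<^bsub>VL (Prod S H1 H2)\<^esub> ?w3 = ?W \<cdot>\<^bsub>VL (Prod S H1 H2)\<^esub> TL \<theta> (extob G1 G2 A1 A2)"
    using \<theta>(1-3) bnat_2cell[of \<theta> "?f \<circ>1 ?g" ?t "Prod S H1 H2" "Prod S G1 G2" "PM (Pr1 S G1 G2) $o A1" "PN (Pr2 S G1 G2) $o A2"]
    using k1 k2 comp_eq_extend[OF _ k3] by simp
  have "pushfwdL ?t (extob H1 H2 X Y) (extob G1 G2 A1 A2)
      ((?W \<cdot>\<^bsub>VL (Prod S H1 H2)\<^esub> TL \<theta> (extob G1 G2 A1 A2)) \<cdot>\<^bsub>VL (Prod S H1 H2)\<^esub> TL (inv_arr (Cells2 T) \<theta>) (extob G1 G2 A1 A2))"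
    using L.pushfwd_2cell[OF a4, of ?t "inv_arr (Cells2 T) \<theta>"] \<theta>(1-3) unfolding eq by simp
  moreover have "TL \<theta> (extob G1 G2 A1 A2) \<cdot>\<^bsub>VL (Prod S H1 H2)\<^esub> TL (inv_arr (Cells2 T) \<theta>) (extob G1 G2 A1 A2)
      = Idt (VL (Prod S H1 H2)) (PL ?t $o extob G1 G2 A1 A2)"
    using L.P2_comp[of "inv_arr (Cells2 T) \<theta>" \<theta> "extob G1 G2 A1 A2"] \<theta>(1-3) by simp
  ultimately have "pushfwdL ?t (extob H1 H2 X Y) (extob G1 G2 A1 A2) ?W"
    using \<theta>(1-3) by simp
  then show "pushfwdL ?t (extob (Dom1 T i1) (Dom1 T i2) X Y) (extob (Cod1 T i1) (Cod1 T i2) A1 A2)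
     (extarr (Dom1 T i1) (Dom1 T i2) w1 w2 \<cdot>\<^bsub>VL (Prod S (Dom1 T i1) (Dom1 T i2))\<^esub> extnat i1 i2 A1 A2)"
    by simp
qed

text \<open>The internal product \<open>X \<odot> A\<close> is the restriction of the external one along a diagonal \<open>d\<close> of \<open>G\<close>. The
  external product is a pushforward of \<open>X \<box> Y\<close> along \<open>t = 1 \<times> i\<close>, as \<open>X\<close> is one of itself along the
  identity. Base change along \<open>d\<close> turns this into a pushforward along \<open>i\<close> of the restriction of \<open>X \<box> Y\<close>
  to the graph of \<open>i\<close>, which is \<open>i\<^sup>* X \<odot> Y\<close>.\<close>

lemma projection1_if_bimorphism:
  assumes bim: bimorphism
  shows projection1
  unfolding projection1_def
proof (intro allI impI, elim conjE)
  fix i X Y A w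
  assume X: "X \<in> Ob (VM (Cod1 T i))" and 1: "pushfwdN i Y A w"
  note [simp] = N.pushfwdD[OF 1] X
  define H where "H = Dom1 T i"
  define G where "G = Cod1 T i"
  have D' [simp]: "H \<in> Obj T" "G \<in> Obj T" unfolding H_def G_def by simp_all
  have D [simp]: "Dom1 T i = H" "Cod1 T i = G" by (simp_all add: H_def G_def)
  note [simp] = N.pushfwdD[OF 1, simplified] X[simplified]
  let ?t = "ProdMap S (Id1 T G) i" and ?\<nu>1 = "Pr1Nat S (Id1 T G) i" and ?\<nu>2 = "Pr2Nat S (Id1 T G) i"
  obtain d \<delta>1 \<delta>2 where d: "d \<in> Cell1 T" "Dom1 T d = G" "Cod1 T d = Prod S G G"
    and \<delta>: "\<delta>1 \<in> Cell2 T" "Dom2 T \<delta>1 = Pr1 S G G \<circ>1 d" "Cod2 T \<delta>1 = Id1 T G"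
      "\<delta>2 \<in> Cell2 T" "Dom2 T \<delta>2 = Pr2 S G G \<circ>1 d" "Cod2 T \<delta>2 = Id1 T G"
    by (rule M.product_cone_lift[of "Pr1 S G G" "Pr2 S G G" "Id1 T G" "Id1 T G"]) simp_all
  obtain p \<kappa> \<rho> where p: "p \<in> Cell1 T" "Dom1 T p = H" "Cod1 T p = Prod S G H"
    and \<kappa>: "\<kappa> \<in> Cell2 T" "Dom2 T \<kappa> = Pr1 S G H \<circ>1 p" "Cod2 T \<kappa> = i"
      "\<rho> \<in> Cell2 T" "Dom2 T \<rho> = Pr2 S G H \<circ>1 p" "Cod2 T \<rho> = Id1 T H"
    by (rule M.product_cone_lift[of "Pr1 S G H" "Pr2 S G H" i "Id1 T H"]) simp_all
  note [simp] = d \<delta> p \<kappa>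
  let ?c1 = "\<kappa> \<cdot>2 rwhisker T ?\<nu>1 p" and ?c2 = "lwhisker T i \<rho> \<cdot>2 rwhisker T ?\<nu>2 p"
  have c: "?c1 \<in> Cell2 T" "?c2 \<in> Cell2 T" by simp_all
  obtain \<gamma> where \<gamma>: "\<gamma> \<in> Cell2 T" "Dom2 T \<gamma> = d \<circ>1 i" "Cod2 T \<gamma> = ?t \<circ>1 p"
    and \<gamma>1: "lwhisker T (Pr1 S G G) \<gamma> = inv_arr (Cells2 T) ?c1 \<cdot>2 rwhisker T \<delta>1 i"
    and \<gamma>2: "lwhisker T (Pr2 S G G) \<gamma> = inv_arr (Cells2 T) ?c2 \<cdot>2 rwhisker T \<delta>2 i"
    by (rule M.product_cone_cell[of "Pr1 S G G" "Pr2 S G G" "d \<circ>1 i" "?t \<circ>1 p"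
      "inv_arr (Cells2 T) ?c1 \<cdot>2 rwhisker T \<delta>1 i" "inv_arr (Cells2 T) ?c2 \<cdot>2 rwhisker T \<delta>2 i"])
      (simp_all add: M.iso2[OF c(1)] M.iso2[OF c(2)])
  note [simp] = \<gamma>
  have e1: "\<kappa> \<cdot>2 rwhisker T ?\<nu>1 p \<cdot>2 lwhisker T (Pr1 S G G) \<gamma> = rwhisker T \<delta>1 i"
  proof -
    have "?c1 \<cdot>2 lwhisker T (Pr1 S G G) \<gamma> = rwhisker T \<delta>1 i"
      unfolding \<gamma>1 by (rule inv_arr_cancel(2)) (use M.iso2[OF c(1)] in simp_all)
    then show ?thesis by simp
  qed
  have e2: "lwhisker T i \<rho> \<cdot>2 rwhisker T ?\<nu>2 p \<cdot>2 lwhisker T (Pr2 S G G) \<gamma> = rwhisker T \<delta>2 i"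
  proof -
    have "?c2 \<cdot>2 lwhisker T (Pr2 S G G) \<gamma> = rwhisker T \<delta>2 i"
      unfolding \<gamma>2 by (rule inv_arr_cancel(2)) (use M.iso2[OF c(2)] in simp_all)
    then show ?thesis by simp
  qed
  have sq: "mackey_square T ?t d p i (inv_arr (Cells2 T) \<gamma>)"
    by (rule M.mackey_square_graph[where ?\<pi>1.0 = "Pr1 S G G" and ?\<pi>2.0 = "Pr2 S G G" and ?p1.0 = "Pr1 S G H" and ?p2.0 = "Pr2 S G H"
      and ?\<nu>1.0 = ?\<nu>1 and ?\<nu>2.0 = ?\<nu>2 and ?\<delta>1.0 = \<delta>1 and ?\<delta>2.0 = \<delta>2 and \<kappa> = \<kappa> and \<rho> = \<rho>])
      (use e1 e2 in simp_all)
  \<comment> \<open>\<open>z\<close> identifies the restriction of \<open>X \<box> Y\<close> to the graph, \<open>a\<close> that of \<open>X \<box> A\<close> to the diagonal.\<close>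
  let ?XA = "extob G G X A"
  let ?w1 = "extarr G H (Idt (VM G) X) w \<cdot>\<^bsub>VL (Prod S G H)\<^esub> extnat (Id1 T G) i X A"
  have a1: "pushfwdL ?t (extob G H X Y) ?XA ?w1"
    using bim[unfolded bimorphism_def, rule_format, of "Id1 T G" X X "Idt (VM G) X" i Y A w]
      M.pushfwd_Id1[of G X] 1 by simp
  let ?w2 = "(PL p $a ?w1) \<cdot>\<^bsub>VL H\<^esub> TL \<gamma> ?XA"
  have a2: "pushfwdL i (PL p $o extob G H X Y) (PL d $o ?XA) ?w2"
    using L.pushfwd_base_change[OF a1 sq] by simp
  let ?z = "barr H (TM \<kappa> X) (TN \<rho> Y) \<cdot>\<^bsub>VL H\<^esub> bnat p (PM (Pr1 S G H) $o X) (PN (Pr2 S G H) $o Y)"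
  have a3: "pushfwdL i (bob H (PM i $o X) Y) (PL d $o ?XA) (?z \<cdot>\<^bsub>VL H\<^esub> ?w2)"
    using L.pushfwd_target[OF a2, of ?z] by simp
  let ?a = "barr G (TM \<delta>1 X) (TN \<delta>2 A) \<cdot>\<^bsub>VL G\<^esub> bnat d (PM (Pr1 S G G) $o X) (PN (Pr2 S G G) $o A)"
  let ?W = "barr H (Idt (VM H) (PM i $o X)) w \<cdot>\<^bsub>VL H\<^esub> bnat i X A"
  have k1: "TM \<kappa> X \<cdot>\<^bsub>VM H\<^esub> ((PM p $a TM ?\<nu>1 X) \<cdot>\<^bsub>VM H\<^esub> TM \<gamma> (PM (Pr1 S G G) $o X)) = PM i $a TM \<delta>1 X"
    using arg_cong[OF e1, of "\<lambda>\<alpha>. TM \<alpha> X"] by simp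
  have k2: "TN \<rho> (PN i $o A) \<cdot>\<^bsub>VN H\<^esub> ((PN p $a TN ?\<nu>2 A) \<cdot>\<^bsub>VN H\<^esub> TN \<gamma> (PN (Pr2 S G G) $o A)) = PN i $a TN \<delta>2 A"
    using arg_cong[OF e2, of "\<lambda>\<alpha>. TN \<alpha> A"] by simp
  have k3: "TN \<rho> Y \<cdot>\<^bsub>VN H\<^esub> (PN p $a PN (Pr2 S G H) $a w) = w \<cdot>\<^bsub>VN H\<^esub> TN \<rho> (PN i $o A)"
    using N.P2_natural[of \<rho> H w "Pr2 S G H \<circ>1 p" "Id1 T H" "PN i $o A" Y] by simp
  have eq: "?z \<cdot>\<^bsub>VL H\<^esub> ?w2 = ?W \<cdot>\<^bsub>VL H\<^esub> (PL i $a ?a)"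
    using bnat_2cell[of \<gamma> "d \<circ>1 i" "?t \<circ>1 p" H "Prod S G G" "PM (Pr1 S G G) $o X" "PN (Pr2 S G G) $o A"]
    using k1 k2 comp_eq_extend[OF _ k3] by simp
  have "pushfwdL i (bob H (PM i $o X) Y) (bob G X A) ?W"
    by (rule L.pushfwd_source[THEN iffD1, OF _ _ _ _ _ _ a3[unfolded eq, folded D(1)], unfolded D]) simp_all
  then show "pushfwdL i (bob (Dom1 T i) (PM i $o X) Y) (bob (Cod1 T i) X A)
       (barr (Dom1 T i) (Idt (VM (Dom1 T i)) (PM i $o X)) w \<cdot>\<^bsub>VL (Dom1 T i)\<^esub> bnat i X A)" by simp
qed

text \<open>Bimorphisms are symmetric in the two factors: this is the preceding lemma for the opposite pairing.\<close>

lemma projection2_if_bimorphism: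
  assumes bim: bimorphism
  shows projection2
proof -
  let ?S = "\<lparr>Prod = \<lambda>G H. Prod S H G, Pr1 = \<lambda>G H. Pr2 S H G, Pr2 = \<lambda>G H. Pr1 S H G, ProdMap = \<lambda>u v. ProdMap S v u,
    Pr1Nat = \<lambda>u v. Pr2Nat S v u, Pr2Nat = \<lambda>u v. Pr1Nat S v u\<rparr>"
  interpret swap: cartesian_pairing_calculus T J VN PN TN uN pushfwdN VM PM TM uM pushfwdM VL PL TL uL pushfwdL
    "\<lambda>G Y X. bob G X Y" "\<lambda>G g f. barr G f g" "\<lambda>u Y X. bnat u X Y" ?S
    by unfold_locales (simp_all add: M.product_cone_commute bnat_2cell)
  have "swap.bimorphism"
    unfolding swap.bimorphism_def using bim unfolding bimorphism_def by simp
  from swap.projection1_if_bimorphism[OF this] show ?thesis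
    unfolding swap.projection1_def projection2_def by simp
qed

lemma projections_iff_bimorphism: "projection1 \<and> projection2 \<longleftrightarrow> bimorphism"
  using bimorphism_if_projections projection1_if_bimorphism projection2_if_bimorphism by blast

end


section \<open>The double of a category\<close>

text \<open>Left and right mates are given by dual formulas, in which units of \<open>i\<^sub>! \<stileturn> i\<^sup>*\<close> replace counits of \<open>i\<^sup>* \<stileturn> i\<^sub>*\<close>
  and inverses of structure isomorphisms replace the isomorphisms. In the double, an arrow from \<open>x\<close>
  to \<open>y\<close> is a pair of a morphism \<open>x \<rightarrow> y\<close> and a morphism \<open>y \<rightarrow> x\<close>, so each calculation is done for
  both at once.\<close>

definition double :: "('a, 'm, 'z) cat_scheme \<Rightarrow> ('a, 'm \<times> 'm) cat" where
  "double C =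
     \<lparr>Ob = Ob C, Arr = {(e, h). e \<in> Arr C \<and> h \<in> Hom C (Cod C e) (Dom C e)},
      Dom = (\<lambda>(e, h). Dom C e), Cod = (\<lambda>(e, h). Cod C e), Idt = (\<lambda>x. (Idt C x, Idt C x)),
      Comp = (\<lambda>(e', h') (e, h). (e' \<cdot>\<^bsub>C\<^esub> e, h \<cdot>\<^bsub>C\<^esub> h'))\<rparr>"

definition double_fctr :: "('a, 'm, 'b, 'n) fctr \<Rightarrow> ('a, 'm \<times> 'm, 'b, 'n \<times> 'n) fctr" where
  "double_fctr F = \<lparr>obj_map = obj_map F, arr_map = map_prod (arr_map F) (arr_map F)\<rparr>"

definition unitary :: "('a, 'm, 'z) cat_scheme \<Rightarrow> ('m \<times> 'm) set" where
  "unitary C = {(a, b). mutually_inverse C a b}"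

lemma double_simps [simp]:
  "Ob (double C) = Ob C"
  "(e, h) \<in> Arr (double C) \<longleftrightarrow> e \<in> Arr C \<and> h \<in> Arr C \<and> Dom C h = Cod C e \<and> Cod C h = Dom C e"
  "Dom (double C) (e, h) = Dom C e" "Cod (double C) (e, h) = Cod C e"
  "Idt (double C) x = (Idt C x, Idt C x)"
  "(e', h') \<cdot>\<^bsub>double C\<^esub> (e, h) = (e' \<cdot>\<^bsub>C\<^esub> e, h \<cdot>\<^bsub>C\<^esub> h')"
  by (auto simp: double_def)

lemma double_fctr_simps [simp]:
  "double_fctr F $o x = F $o x" "double_fctr F $a (e, h) = (F $a e, F $a h)"
  by (simp_all add: double_fctr_def)

lemma category_double: "category C \<Longrightarrow> category (double C)"
  by standard auto

context
  fixes C :: "('a, 'm, 'z) cat_scheme"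
  assumes C: "category C"
begin

lemma unitary_Arr: "a \<in> unitary C \<Longrightarrow> a \<in> Arr (double C)"
  by (auto simp: unitary_def mutually_inverse_def)

lemma unitary_Idt: "x \<in> Ob C \<Longrightarrow> Idt (double C) x \<in> unitary C"
  using C by (auto simp: unitary_def mutually_inverse_def)

lemma unitary_comp:
  "a \<in> unitary C \<Longrightarrow> b \<in> unitary C \<Longrightarrow> Dom (double C) b = Cod (double C) a \<Longrightarrow> b \<cdot>\<^bsub>double C\<^esub> a \<in> unitary C"
  using mutually_inverse_comp[OF C] by (auto simp: unitary_def)

lemma unitary_inverse:
  assumes "a \<in> unitary C"
  shows "\<exists>b \<in> unitary C. Dom (double C) b = Cod (double C) a \<and> Cod (double C) b = Dom (double C) a \<and>
    a \<cdot>\<^bsub>double C\<^esub> b = Idt (double C) (Cod (double C) a)"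
  by (rule bexI[of _ "prod.swap a"]) (use assms in \<open>auto simp: unitary_def mutually_inverse_def\<close>)

end

lemma functor_props:
  assumes "is_functor C D F" "category C"
  shows "x \<in> Ob C \<Longrightarrow> F $o x \<in> Ob D" "x \<in> Ob C \<Longrightarrow> F $a Idt C x = Idt D (F $o x)"
    "f \<in> Arr C \<Longrightarrow> F $a f \<in> Arr D" "f \<in> Arr C \<Longrightarrow> Dom D (F $a f) = F $o Dom C f"
    "f \<in> Arr C \<Longrightarrow> Cod D (F $a f) = F $o Cod C f"
    "f \<in> Arr C \<Longrightarrow> g \<in> Arr C \<Longrightarrow> Dom C g = Cod C f \<Longrightarrow> F $a (g \<cdot>\<^bsub>C\<^esub> f) = (F $a g) \<cdot>\<^bsub>D\<^esub> (F $a f)"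
  using assms unfolding is_functor_def by auto

lemma unitary_map:
  assumes F: "is_functor C D F" and C: "category C" and a: "a \<in> unitary C"
  shows "double_fctr F $a a \<in> unitary D"
proof -
  note P [simp] = functor_props[OF F C]
  obtain f g where a: "a = (f, g)" and fg: "mutually_inverse C f g"
    using a by (auto simp: unitary_def)
  have f: "f \<in> Arr C" "g \<in> Arr C" "Dom C g = Cod C f" "Cod C g = Dom C f"
    "g \<cdot>\<^bsub>C\<^esub> f = Idt C (Dom C f)" "f \<cdot>\<^bsub>C\<^esub> g = Idt C (Cod C f)"
    using fg unfolding mutually_inverse_def by auto
  have "(F $a g) \<cdot>\<^bsub>D\<^esub> (F $a f) = Idt D (F $o Dom C f)" "(F $a f) \<cdot>\<^bsub>D\<^esub> (F $a g) = Idt D (F $o Cod C f)"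
    using P(6)[of f g] P(6)[of g f] f C by simp_all
  then show ?thesis using a f by (simp add: unitary_def mutually_inverse_def)
qed

context indexed_category
begin

lemma P_inv_arr:
  assumes u: "u \<in> Cell1 T" "Cod1 T u = G" and f: "iso_arr (V G) f"
  shows "iso_arr (V (Dom1 T u)) (P u $a f)" "inv_arr (V (Dom1 T u)) (P u $a f) = P u $a inv_arr (V G) f"
proof -
  have [simp]: "G \<in> Obj T" using u by auto
  have [simp]: "f \<in> Arr (V G)" using iso_is_arr[OF _ f] by simp
  have "mutually_inverse (V (Dom1 T u)) (P u $a f) (P u $a inv_arr (V G) f)"
    using u f P_Comp[of u G f "inv_arr (V G) f"] P_Comp[of u G "inv_arr (V G) f" f]
    by (simp add: mutually_inverse_def del: P_Comp)
  then show "iso_arr (V (Dom1 T u)) (P u $a f)" "inv_arr (V (Dom1 T u)) (P u $a f) = P u $a inv_arr (V G) f"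
    using inv_arr_eqI[of "V (Dom1 T u)"] u(1) unfolding iso_arr_def by auto
qed

lemma inv_comp2 [simp]:
  assumes "\<alpha> \<in> Cell2 T" "\<beta> \<in> Cell2 T" "Dom2 T \<beta> = Cod2 T \<alpha>"
  shows "inv_arr (Cells2 T) (\<beta> \<cdot>2 \<alpha>) = inv_arr (Cells2 T) \<alpha> \<cdot>2 inv_arr (Cells2 T) \<beta>"
  by (rule inv_arr_eqI) (use assms in \<open>simp_all add: mutually_inverse_comp mutually_inverse_inv_arr\<close>)

lemma inv_Id2 [simp]: "f \<in> Cell1 T \<Longrightarrow> inv_arr (Cells2 T) (Id2 T f) = Id2 T f"
  by (rule inv_arr_eqI) (simp_all add: mutually_inverse_def)

text \<open>Since all 2-cells of \<open>T\<close> are invertible, a 2-functor acts on the doubles as well.\<close>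

lemma indexed_category_double:
  "indexed_category T (\<lambda>G. double (V G)) (\<lambda>u. double_fctr (P u))
     (\<lambda>\<alpha> X. (P2 \<alpha> X, P2 (inv_arr (Cells2 T) \<alpha>) X))"
  by unfold_locales (auto simp: category_double P2_natural simp del: lwhisker_inv rwhisker_inv
      simp flip: lwhisker_inv rwhisker_inv)

end


section \<open>Pushforwards for rectified Mackey 2-functors\<close>

locale rectified_mackey = two_one_category T
  for T :: "('o, 'c, 't) twocat" (structure) +
  fixes J :: "'c set" and M :: "('o, 'c, 't, 'a, 'm, 'k) mackey" and A :: target and k :: "'k ring"
  assumes rectified: "rectified_mackey_2_functor A k T J M"
    and J_Cell1 [simp]: "i \<in> J \<Longrightarrow> i \<in> Cell1 T"
    and J_Id1 [simp]: "G \<in> Obj T \<Longrightarrow> Id1 T G \<in> J"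
    and J_comp [simp]: "i \<in> J \<Longrightarrow> j \<in> J \<Longrightarrow> Dom1 T i = Cod1 T j \<Longrightarrow> i \<circ>1 j \<in> J"
begin

lemma two_functor: "is_two_functor A k T M"
  using rectified unfolding rectified_mackey_2_functor_def mackey_2_functor_def by blast

lemma Val_category: "G \<in> Obj T \<Longrightarrow> category (Val M G)"
  using two_functor unfolding is_two_functor_def
  by (cases A) (auto simp: additive_category_def linear_category_def)

lemma Pull_functor: "u \<in> Cell1 T \<Longrightarrow> is_functor (Val M (Cod1 T u)) (Val M (Dom1 T u)) (Pull M u)"
  using two_functor unfolding is_two_functor_def linear_functor_def by auto

lemma Pull_Id1: "G \<in> Obj T \<Longrightarrow> eq_fctr (Val M G) (Pull M (Id1 T G)) id_fctr"
  using two_functor unfolding is_two_functor_def by auto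

lemma Pull_comp1: "u \<in> Cell1 T \<Longrightarrow> v \<in> Cell1 T \<Longrightarrow> Dom1 T u = Cod1 T v \<Longrightarrow>
    eq_fctr (Val M (Cod1 T u)) (Pull M (u \<circ>1 v)) (comp_fctr (Pull M v) (Pull M u))"
  using two_functor unfolding is_two_functor_def by auto

lemma Pull2_nat_trans: "\<alpha> \<in> Cell2 T \<Longrightarrow>
    nat_trans (Val M (Cod1 T (Dom2 T \<alpha>))) (Val M (Dom1 T (Dom2 T \<alpha>))) (Pull M (Dom2 T \<alpha>)) (Pull M (Cod2 T \<alpha>)) (Pull2 M \<alpha>)"
  using two_functor unfolding is_two_functor_def by auto

lemma Pull2_Id2: "u \<in> Cell1 T \<Longrightarrow> X \<in> Ob (Val M (Cod1 T u)) \<Longrightarrow>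
    Pull2 M (Id2 T u) X = Idt (Val M (Dom1 T u)) (Pull M u $o X)"
  using two_functor unfolding is_two_functor_def by auto

lemma Pull2_vcomp:
  assumes "\<alpha> \<in> Cell2 T" "\<beta> \<in> Cell2 T" "Dom2 T \<beta> = Cod2 T \<alpha>" "X \<in> Ob (Val M (Cod1 T (Dom2 T \<alpha>)))"
  shows "Pull2 M (\<beta> \<cdot>2 \<alpha>) X = Pull2 M \<beta> X \<cdot>\<^bsub>Val M (Dom1 T (Dom2 T \<alpha>))\<^esub> Pull2 M \<alpha> X"
proof -
  have *: "\<forall>H G. \<forall>u \<in> Hom1 T H G. \<forall>v w. \<forall>\<alpha> \<in> Hom2 T u v. \<forall>\<beta> \<in> Hom2 T v w. \<forall>X \<in> Ob (Val M G).
        Pull2 M (\<beta> \<cdot>2 \<alpha>) X = Pull2 M \<beta> X \<cdot>\<^bsub>Val M H\<^esub> Pull2 M \<alpha> X"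
    using two_functor unfolding is_two_functor_def by blast
  show ?thesis
    by (rule *[rule_format, of "Dom2 T \<alpha>" _ "Cod1 T (Dom2 T \<alpha>)" _ "Cod2 T \<alpha>" _ "Cod2 T \<beta>"]) (use assms in auto)
qed

lemma Pull2_hcomp:
  assumes "\<alpha> \<in> Cell2 T" "\<beta> \<in> Cell2 T" "Dom1 T (Dom2 T \<alpha>) = Cod1 T (Dom2 T \<beta>)" "X \<in> Ob (Val M (Cod1 T (Dom2 T \<alpha>)))"
  shows "Pull2 M (\<alpha> \<star> \<beta>) X = Pull2 M \<beta> (Pull M (Cod2 T \<alpha>) $o X)
    \<cdot>\<^bsub>Val M (Dom1 T (Dom2 T \<beta>))\<^esub> (Pull M (Dom2 T \<beta>) $a Pull2 M \<alpha> X)"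
proof -
  have *: "\<forall>K H G. \<forall>u \<in> Hom1 T H G. \<forall>v \<in> Hom1 T K H. \<forall>u' v'.
        \<forall>\<alpha> \<in> Hom2 T u u'. \<forall>\<beta> \<in> Hom2 T v v'. \<forall>X \<in> Ob (Val M G).
        Pull2 M (\<alpha> \<star> \<beta>) X = Pull2 M \<beta> (Pull M u' $o X) \<cdot>\<^bsub>Val M K\<^esub> (Pull M v $a Pull2 M \<alpha> X)"
    using two_functor unfolding is_two_functor_def by blast
  show ?thesis
    by (rule *[rule_format, of "Dom2 T \<alpha>" "Cod1 T (Dom2 T \<beta>)" "Cod1 T (Dom2 T \<alpha>)" "Dom2 T \<beta>" _ _ "Cod2 T \<alpha>" _ "Cod2 T \<beta>"])
      (use assms in auto)
qed

sublocale base: indexed_category T "Val M" "Pull M" "Pull2 M"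
proof unfold_locales
  fix \<alpha> H f u v X Y
  assume a: "\<alpha> \<in> Cell2 T" "Dom1 T (Dom2 T \<alpha>) = H" "f \<in> Arr (Val M (Cod1 T (Dom2 T \<alpha>)))"
    "Dom2 T \<alpha> = u" "Cod2 T \<alpha> = v" "Dom (Val M (Cod1 T (Dom2 T \<alpha>))) f = X" "Cod (Val M (Cod1 T (Dom2 T \<alpha>))) f = Y"
  show "Pull2 M \<alpha> Y \<cdot>\<^bsub>Val M H\<^esub> (Pull M u $a f) = (Pull M v $a f) \<cdot>\<^bsub>Val M H\<^esub> Pull2 M \<alpha> X"
    using Pull2_nat_trans[OF a(1)] a unfolding nat_trans_def by auto
next
  fix u \<alpha> X
  assume a: "u \<in> Cell1 T" "\<alpha> \<in> Cell2 T" "Dom1 T u = Cod1 T (Dom2 T \<alpha>)" "X \<in> Ob (Val M (Cod1 T u))"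
  have "Pull M u $o X \<in> Ob (Val M (Cod1 T (Dom2 T \<alpha>)))"
    using functor_props(1)[OF Pull_functor[of u] Val_category, of X] a by simp
  then have "Pull2 M \<alpha> (Pull M u $o X) \<in> Hom (Val M (Dom1 T (Dom2 T \<alpha>))) (Pull M (Dom2 T \<alpha>) $o Pull M u $o X) (Pull M (Cod2 T \<alpha>) $o Pull M u $o X)"
    using Pull2_nat_trans[OF a(2)] unfolding nat_trans_def by auto
  then show "Pull2 M (lwhisker T u \<alpha>) X = Pull2 M \<alpha> (Pull M u $o X)"
    using Pull2_hcomp[of "Id2 T u" \<alpha> X] a functor_props[OF Pull_functor[of "Dom2 T \<alpha>"] Val_category]
      functor_props(1)[OF Pull_functor[of u] Val_category]
    by (simp add: lwhisker_def Pull2_Id2 Val_category)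
next
  fix u \<alpha> X
  assume a: "u \<in> Cell1 T" "\<alpha> \<in> Cell2 T" "Dom1 T (Dom2 T \<alpha>) = Cod1 T u" "X \<in> Ob (Val M (Cod1 T (Dom2 T \<alpha>)))"
  have "Pull2 M \<alpha> X \<in> Hom (Val M (Dom1 T (Dom2 T \<alpha>))) (Pull M (Dom2 T \<alpha>) $o X) (Pull M (Cod2 T \<alpha>) $o X)"
    using Pull2_nat_trans[OF a(2)] a unfolding nat_trans_def by auto
  then show "Pull2 M (rwhisker T \<alpha> u) X = Pull M u $a Pull2 M \<alpha> X"
    using Pull2_hcomp[of \<alpha> "Id2 T u" X] a functor_props[OF Pull_functor[of u] Val_category]
      functor_props(1)[OF Pull_functor[of "Cod2 T \<alpha>"] Val_category]
    by (simp add: rwhisker_def Pull2_Id2 Val_category)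
qed (use functor_props[OF Pull_functor Val_category] Pull_Id1 Pull_comp1 Pull2_nat_trans in
    \<open>auto simp: Val_category Pull2_vcomp Pull2_Id2 eq_fctr_def id_fctr_def comp_fctr_def nat_trans_def\<close>)

lemma adjunctions:
  assumes "i \<in> J"
  shows "adjunction (Val M (Dom1 T i)) (Val M (Cod1 T i)) (LPush M i) (Pull M i) (LUnit M i) (LCounit M i)"
    "adjunction (Val M (Cod1 T i)) (Val M (Dom1 T i)) (Pull M i) (RPush M i) (RUnit M i) (RCounit M i)"
  using rectified assms J_Cell1[OF assms] unfolding rectified_mackey_2_functor_def mackey_2_functor_def by auto

lemma LPush_RPush:
  assumes "i \<in> J"
  shows "Z \<in> Ob (Val M (Dom1 T i)) \<Longrightarrow> LPush M i $o Z = RPush M i $o Z"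
    "f \<in> Arr (Val M (Dom1 T i)) \<Longrightarrow> LPush M i $a f = RPush M i $a f"
  using rectified assms unfolding rectified_mackey_2_functor_def eq_fctr_def by auto

lemma RPush_props [simp]:
  assumes "i \<in> J" "Cod1 T i = G"
  shows "Z \<in> Ob (Val M H) \<Longrightarrow> Dom1 T i = H \<Longrightarrow> RPush M i $a Idt (Val M H) Z = Idt (Val M (Cod1 T i)) (RPush M i $o Z)"
    "Z \<in> Ob (Val M (Dom1 T i)) \<Longrightarrow> RPush M i $o Z \<in> Ob (Val M G)"
    "f \<in> Arr (Val M (Dom1 T i)) \<Longrightarrow> RPush M i $a f \<in> Arr (Val M G)"
    "f \<in> Arr (Val M (Dom1 T i)) \<Longrightarrow> Dom (Val M G) (RPush M i $a f) = RPush M i $o Dom (Val M (Dom1 T i)) f"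
    "f \<in> Arr (Val M (Dom1 T i)) \<Longrightarrow> Cod (Val M G) (RPush M i $a f) = RPush M i $o Cod (Val M (Dom1 T i)) f"
    "f \<in> Arr (Val M H) \<Longrightarrow> g \<in> Arr (Val M H) \<Longrightarrow> Dom (Val M H) g = Cod (Val M H) f \<Longrightarrow> Dom1 T i = H \<Longrightarrow>
       RPush M i $a (g \<cdot>\<^bsub>Val M H\<^esub> f) = (RPush M i $a g) \<cdot>\<^bsub>Val M (Cod1 T i)\<^esub> (RPush M i $a f)"
  using functor_props[of "Val M (Dom1 T i)" "Val M (Cod1 T i)" "RPush M i"] adjunctions[OF assms(1)] assms
  unfolding adjunction_def by auto

lemma unit_props [simp]:
  assumes "i \<in> J" "Cod1 T i = G" "Dom1 T i = H"
  shows "X \<in> Ob (Val M G) \<Longrightarrow> RUnit M i X \<in> Arr (Val M G)"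
    "X \<in> Ob (Val M G) \<Longrightarrow> Dom (Val M G) (RUnit M i X) = X"
    "X \<in> Ob (Val M G) \<Longrightarrow> Cod (Val M G) (RUnit M i X) = RPush M i $o Pull M i $o X"
    "Z \<in> Ob (Val M H) \<Longrightarrow> RCounit M i Z \<in> Arr (Val M H)"
    "Z \<in> Ob (Val M H) \<Longrightarrow> Dom (Val M H) (RCounit M i Z) = Pull M i $o RPush M i $o Z"
    "Z \<in> Ob (Val M H) \<Longrightarrow> Cod (Val M H) (RCounit M i Z) = Z"
    "Z \<in> Ob (Val M H) \<Longrightarrow> LUnit M i Z \<in> Arr (Val M H)"
    "Z \<in> Ob (Val M H) \<Longrightarrow> Dom (Val M H) (LUnit M i Z) = Z"
    "Z \<in> Ob (Val M H) \<Longrightarrow> Cod (Val M H) (LUnit M i Z) = Pull M i $o RPush M i $o Z"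
    "X \<in> Ob (Val M G) \<Longrightarrow> LCounit M i X \<in> Arr (Val M G)"
    "X \<in> Ob (Val M G) \<Longrightarrow> Dom (Val M G) (LCounit M i X) = RPush M i $o Pull M i $o X"
    "X \<in> Ob (Val M G) \<Longrightarrow> Cod (Val M G) (LCounit M i X) = X"
  using adjunctions[OF assms(1)] assms LPush_RPush[OF assms(1)] base.P_ob[of i X]
  unfolding adjunction_def nat_trans_def by (auto simp: id_fctr_def comp_fctr_def)

lemma triangles:
  assumes "i \<in> J"
  shows "X \<in> Ob (Val M (Cod1 T i)) \<Longrightarrow>
      RCounit M i (Pull M i $o X) \<cdot>\<^bsub>Val M (Dom1 T i)\<^esub> (Pull M i $a RUnit M i X) = Idt (Val M (Dom1 T i)) (Pull M i $o X)"
    "Z \<in> Ob (Val M (Dom1 T i)) \<Longrightarrow>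
      (RPush M i $a RCounit M i Z) \<cdot>\<^bsub>Val M (Cod1 T i)\<^esub> RUnit M i (RPush M i $o Z) = Idt (Val M (Cod1 T i)) (RPush M i $o Z)"
    "X \<in> Ob (Val M (Cod1 T i)) \<Longrightarrow>
      (Pull M i $a LCounit M i X) \<cdot>\<^bsub>Val M (Dom1 T i)\<^esub> LUnit M i (Pull M i $o X) = Idt (Val M (Dom1 T i)) (Pull M i $o X)"
    "Z \<in> Ob (Val M (Dom1 T i)) \<Longrightarrow>
      LCounit M i (RPush M i $o Z) \<cdot>\<^bsub>Val M (Cod1 T i)\<^esub> (RPush M i $a LUnit M i Z) = Idt (Val M (Cod1 T i)) (RPush M i $o Z)"
  using adjunctions[OF assms(1)] assms LPush_RPush[OF assms(1)] unfolding adjunction_def by auto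

lemma unit_natural:
  assumes i: "i \<in> J"
  shows "f \<in> Arr (Val M (Cod1 T i)) \<Longrightarrow> Cod (Val M (Cod1 T i)) f = Y \<Longrightarrow> RUnit M i Y \<cdot>\<^bsub>Val M (Cod1 T i)\<^esub> f
       = (RPush M i $a Pull M i $a f) \<cdot>\<^bsub>Val M (Cod1 T i)\<^esub> RUnit M i (Dom (Val M (Cod1 T i)) f)"
    "g \<in> Arr (Val M (Dom1 T i)) \<Longrightarrow> Cod (Val M (Dom1 T i)) g = Z \<Longrightarrow>
       RCounit M i Z \<cdot>\<^bsub>Val M (Dom1 T i)\<^esub> (Pull M i $a RPush M i $a g)
       = g \<cdot>\<^bsub>Val M (Dom1 T i)\<^esub> RCounit M i (Dom (Val M (Dom1 T i)) g)"
    "g \<in> Arr (Val M (Dom1 T i)) \<Longrightarrow> Cod (Val M (Dom1 T i)) g = Z \<Longrightarrow>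
       LUnit M i Z \<cdot>\<^bsub>Val M (Dom1 T i)\<^esub> g
       = (Pull M i $a RPush M i $a g) \<cdot>\<^bsub>Val M (Dom1 T i)\<^esub> LUnit M i (Dom (Val M (Dom1 T i)) g)"
    "f \<in> Arr (Val M (Cod1 T i)) \<Longrightarrow> Cod (Val M (Cod1 T i)) f = Y \<Longrightarrow>
       LCounit M i Y \<cdot>\<^bsub>Val M (Cod1 T i)\<^esub> (RPush M i $a Pull M i $a f)
       = f \<cdot>\<^bsub>Val M (Cod1 T i)\<^esub> LCounit M i (Dom (Val M (Cod1 T i)) f)"
  using adjunctions[OF i] LPush_RPush[OF i] base.P_arr[of i f] i
  unfolding adjunction_def nat_trans_def by (auto simp: id_fctr_def comp_fctr_def)

sublocale dbl: indexed_category T "\<lambda>G. double (Val M G)" "\<lambda>u. double_fctr (Pull M u)"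
  "\<lambda>\<alpha> X. (Pull2 M \<alpha> X, Pull2 M (inv_arr (Cells2 T) \<alpha>) X)"
  by (rule base.indexed_category_double)

text \<open>In the double, the counit of \<open>i\<^sup>*\<close> and \<open>i\<^sub>*\<close> and the unit of \<open>i\<^sub>!\<close> and \<open>i\<^sup>*\<close> are a single arrow \<open>dcounit i Z\<close> from
  \<open>i\<^sup>* i\<^sub>* Z\<close> to \<open>Z\<close>, as \<open>i\<^sub>!\<close> and \<open>i\<^sub>*\<close> agree. It presents the chosen pushforward, and the other presentations
  are those isomorphic to it.\<close>

abbreviation "DVal G \<equiv> double (Val M G)"
abbreviation "DPull u \<equiv> double_fctr (Pull M u)"
abbreviation "DPull2 \<alpha> X \<equiv> (Pull2 M \<alpha> X, Pull2 M (inv_arr (Cells2 T) \<alpha>) X)"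
abbreviation "dcounit i Z \<equiv> (RCounit M i Z, LUnit M i Z)"

definition pushfwd :: "'c \<Rightarrow> 'a \<Rightarrow> 'a \<Rightarrow> 'm \<times> 'm \<Rightarrow> bool" where
  "pushfwd i Z X w \<longleftrightarrow> i \<in> J \<and> Z \<in> Ob (Val M (Dom1 T i)) \<and> X \<in> Ob (Val M (Cod1 T i)) \<and>
     (\<exists>a \<in> unitary (Val M (Cod1 T i)). Dom (DVal (Cod1 T i)) a = X \<and>
        Cod (DVal (Cod1 T i)) a = RPush M i $o Z \<and>
        w = dcounit i Z \<cdot>\<^bsub>DVal (Dom1 T i)\<^esub> (DPull i $a a))"

text \<open>The transposes of \<open>w = dcounit i Z \<cdot> i\<^sup>* a\<close> are the two components of \<open>a\<close>, by the triangle
  identities. This is the form in which mates appear in the definitions of base change, of the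
  projection maps and of bimorphisms.\<close>

lemma pushfwd_iff:
  assumes [simp]: "i \<in> J" "Z \<in> Ob (Val M (Dom1 T i))" "X \<in> Ob (Val M (Cod1 T i))"
    and e [simp]: "e \<in> Arr (Val M (Dom1 T i))" "Dom (Val M (Dom1 T i)) e = Pull M i $o X" "Cod (Val M (Dom1 T i)) e = Z"
    and h [simp]: "h \<in> Arr (Val M (Dom1 T i))" "Dom (Val M (Dom1 T i)) h = Z" "Cod (Val M (Dom1 T i)) h = Pull M i $o X"
  shows "pushfwd i Z X (e, h) \<longleftrightarrow>
    mutually_inverse (Val M (Cod1 T i)) (LCounit M i X \<cdot>\<^bsub>Val M (Cod1 T i)\<^esub> (RPush M i $a h))
      ((RPush M i $a e) \<cdot>\<^bsub>Val M (Cod1 T i)\<^esub> RUnit M i X)"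
proof
  assume "pushfwd i Z X (e, h)"
  then obtain a b where ab: "mutually_inverse (Val M (Cod1 T i)) a b" "Dom (Val M (Cod1 T i)) a = X"
      "Cod (Val M (Cod1 T i)) a = RPush M i $o Z"
    and eh: "e = RCounit M i Z \<cdot>\<^bsub>Val M (Dom1 T i)\<^esub> (Pull M i $a a)" "h = (Pull M i $a b) \<cdot>\<^bsub>Val M (Dom1 T i)\<^esub> LUnit M i Z"
    unfolding pushfwd_def unitary_def by auto
  have [simp]: "a \<in> Arr (Val M (Cod1 T i))" "b \<in> Arr (Val M (Cod1 T i))" "Dom (Val M (Cod1 T i)) a = X"
    "Cod (Val M (Cod1 T i)) a = RPush M i $o Z" "Dom (Val M (Cod1 T i)) b = RPush M i $o Z" "Cod (Val M (Cod1 T i)) b = X"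
    using ab unfolding mutually_inverse_def by auto
  have "(RPush M i $a e) \<cdot>\<^bsub>Val M (Cod1 T i)\<^esub> RUnit M i X = a"
    using unit_natural(1)[of i a "RPush M i $o Z", symmetric] comp_eq_extend[OF _ triangles(2)[of i Z], of a]
    by (simp add: eh)
  moreover have "LCounit M i X \<cdot>\<^bsub>Val M (Cod1 T i)\<^esub> (RPush M i $a h) = b"
    using comp_eq_extend[OF _ unit_natural(4)[of i b X], of "RPush M i $a LUnit M i Z"] triangles(4)[of i Z]
    by (simp add: eh)
  ultimately show "mutually_inverse (Val M (Cod1 T i)) (LCounit M i X \<cdot>\<^bsub>Val M (Cod1 T i)\<^esub> (RPush M i $a h))
      ((RPush M i $a e) \<cdot>\<^bsub>Val M (Cod1 T i)\<^esub> RUnit M i X)"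
    using ab(1) mutually_inverse_sym[of "Val M (Cod1 T i)"] by simp
next
  let ?b = "LCounit M i X \<cdot>\<^bsub>Val M (Cod1 T i)\<^esub> (RPush M i $a h)" and ?a = "(RPush M i $a e) \<cdot>\<^bsub>Val M (Cod1 T i)\<^esub> RUnit M i X"
  assume inv: "mutually_inverse (Val M (Cod1 T i)) ?b ?a"
  then have "(?a, ?b) \<in> unitary (Val M (Cod1 T i))"
    using mutually_inverse_sym[of "Val M (Cod1 T i)"] by (simp add: unitary_def)
  moreover have "e = RCounit M i Z \<cdot>\<^bsub>Val M (Dom1 T i)\<^esub> (Pull M i $a ?a)"
    using comp_eq_extend[OF _ unit_natural(2)[of i e Z], of "Pull M i $a RUnit M i X"] triangles(1)[of i X]
    by simp
  moreover have "h = (Pull M i $a ?b) \<cdot>\<^bsub>Val M (Dom1 T i)\<^esub> LUnit M i Z"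
    using unit_natural(3)[of i h "Pull M i $o X", symmetric]
      comp_eq_extend[OF _ triangles(3)[of i X], of h] by simp
  ultimately show "pushfwd i Z X (e, h)"
    unfolding pushfwd_def by (intro conjI bexI[of _ "(?a, ?b)"]) simp_all
qed

lemma pushfwd_canonical:
  assumes [simp]: "i \<in> J" "Z \<in> Ob (Val M (Dom1 T i))"
  shows "pushfwd i Z (RPush M i $o Z) (dcounit i Z)"
  by (subst pushfwd_iff) (simp_all add: triangles mutually_inverse_def)

lemma pushfwd_source:
  assumes [simp]: "i \<in> J" and a: "a \<in> unitary (Val M (Cod1 T i))" "Dom (DVal (Cod1 T i)) a = X"
    "Cod (DVal (Cod1 T i)) a = X'"
    and w [simp]: "w \<in> Arr (DVal (Dom1 T i))" "Dom (DVal (Dom1 T i)) w = Pull M i $o X'"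
  shows "pushfwd i Z X (w \<cdot>\<^bsub>DVal (Dom1 T i)\<^esub> (DPull i $a a)) \<longleftrightarrow> pushfwd i Z X' w"
proof
  have [simp]: "a \<in> Arr (DVal (Cod1 T i))" "Dom (DVal (Cod1 T i)) a = X"
    "Cod (DVal (Cod1 T i)) a = X'" "X \<in> Ob (Val M (Cod1 T i))" "X' \<in> Ob (Val M (Cod1 T i))"
    using a unitary_Arr[of "Val M (Cod1 T i)" a] Dom_in_Ob[of "DVal (Cod1 T i)" a]
      Cod_in_Ob[of "DVal (Cod1 T i)" a] by auto
  obtain b where b: "b \<in> unitary (Val M (Cod1 T i))" "Dom (DVal (Cod1 T i)) b = X'"
    "Cod (DVal (Cod1 T i)) b = X"
    "a \<cdot>\<^bsub>DVal (Cod1 T i)\<^esub> b = Idt (DVal (Cod1 T i)) X'"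
    using unitary_inverse[of "Val M (Cod1 T i)" a] a by (simp del: double_simps) blast
  have [simp]: "b \<in> Arr (DVal (Cod1 T i))" using b unitary_Arr[of "Val M (Cod1 T i)" b] by auto
  note [simp] = b(2,3)
  {
    assume "pushfwd i Z X (w \<cdot>\<^bsub>DVal (Dom1 T i)\<^esub> (DPull i $a a))"
    then obtain c where [simp]: "Z \<in> Ob (Val M (Dom1 T i))" and c: "c \<in> unitary (Val M (Cod1 T i))"
      "Dom (DVal (Cod1 T i)) c = X" "Cod (DVal (Cod1 T i)) c = RPush M i $o Z"
      "w \<cdot>\<^bsub>DVal (Dom1 T i)\<^esub> (DPull i $a a) =
        dcounit i Z \<cdot>\<^bsub>DVal (Dom1 T i)\<^esub> (DPull i $a c)"
      unfolding pushfwd_def by auto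
    have [simp]: "c \<in> Arr (DVal (Cod1 T i))" using c unitary_Arr[of "Val M (Cod1 T i)" c] by auto
    note [simp] = c(2,3)
    have "w = w \<cdot>\<^bsub>DVal (Dom1 T i)\<^esub> (DPull i $a (a \<cdot>\<^bsub>DVal (Cod1 T i)\<^esub> b))"
      unfolding b(4) by (simp del: double_simps(5))
    also have "\<dots> = (w \<cdot>\<^bsub>DVal (Dom1 T i)\<^esub> (DPull i $a a)) \<cdot>\<^bsub>DVal (Dom1 T i)\<^esub> (DPull i $a b)"
      by simp
    also have "\<dots> = dcounit i Z \<cdot>\<^bsub>DVal (Dom1 T i)\<^esub>
        (DPull i $a (c \<cdot>\<^bsub>DVal (Cod1 T i)\<^esub> b))"
      unfolding c(4) by simp
    finally show "pushfwd i Z X' w"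
      unfolding pushfwd_def using c b unitary_comp[of "Val M (Cod1 T i)" b c]
      by (intro conjI bexI[of _ "c \<cdot>\<^bsub>DVal (Cod1 T i)\<^esub> b"]) simp_all
  next
    assume "pushfwd i Z X' w"
    then obtain c where [simp]: "Z \<in> Ob (Val M (Dom1 T i))" and c: "c \<in> unitary (Val M (Cod1 T i))"
      "Dom (DVal (Cod1 T i)) c = X'" "Cod (DVal (Cod1 T i)) c = RPush M i $o Z"
      "w = dcounit i Z \<cdot>\<^bsub>DVal (Dom1 T i)\<^esub> (DPull i $a c)"
      unfolding pushfwd_def by auto
    have [simp]: "c \<in> Arr (DVal (Cod1 T i))" using c unitary_Arr[of "Val M (Cod1 T i)" c] by auto
    note [simp] = c(2,3)
    show "pushfwd i Z X (w \<cdot>\<^bsub>DVal (Dom1 T i)\<^esub> (DPull i $a a))"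
      unfolding pushfwd_def using c a unitary_comp[of "Val M (Cod1 T i)" a c]
      by (intro conjI bexI[of _ "c \<cdot>\<^bsub>DVal (Cod1 T i)\<^esub> a"]) simp_all
  }
qed

lemma pushfwdE:
  assumes "pushfwd i Z X w"
  obtains a where "i \<in> J" "Z \<in> Ob (Val M (Dom1 T i))" "X \<in> Ob (Val M (Cod1 T i))"
    "RPush M i $o Z \<in> Ob (Val M (Cod1 T i))"
    "dcounit i Z \<in> Arr (DVal (Dom1 T i))"
    "a \<in> unitary (Val M (Cod1 T i))" "a \<in> Arr (DVal (Cod1 T i))"
    "Dom (DVal (Cod1 T i)) a = X" "Cod (DVal (Cod1 T i)) a = RPush M i $o Z"
    "w = dcounit i Z \<cdot>\<^bsub>DVal (Dom1 T i)\<^esub> (DPull i $a a)"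
  using assms unitary_Arr[of "Val M (Cod1 T i)"] unfolding pushfwd_def by (auto simp del: double_simps(6))

lemma RPush_unitary:
  assumes [simp]: "i \<in> J" and "z \<in> unitary (Val M (Dom1 T i))"
  shows "double_fctr (RPush M i) $a z \<in> unitary (Val M (Cod1 T i))"
  by (rule unitary_map) (use adjunctions(2)[of i] assms in \<open>auto simp: adjunction_def\<close>)

lemma RPush_double:
  assumes [simp]: "i \<in> J" and "z \<in> Arr (DVal (Dom1 T i))"
  shows "double_fctr (RPush M i) $a z \<in> Arr (DVal (Cod1 T i))"
    "Dom (DVal (Cod1 T i)) (double_fctr (RPush M i) $a z) = RPush M i $o Dom (DVal (Dom1 T i)) z"
    "Cod (DVal (Cod1 T i)) (double_fctr (RPush M i) $a z) = RPush M i $o Cod (DVal (Dom1 T i)) z"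
  using assms by (cases z; auto)+

lemma counit_double_natural:
  assumes [simp]: "i \<in> J" and "z \<in> Arr (DVal (Dom1 T i))"
    "Dom (DVal (Dom1 T i)) z = Z" "Cod (DVal (Dom1 T i)) z = Z'"
  shows "dcounit i Z' \<cdot>\<^bsub>DVal (Dom1 T i)\<^esub> (DPull i $a double_fctr (RPush M i) $a z)
    = z \<cdot>\<^bsub>DVal (Dom1 T i)\<^esub> (dcounit i Z)"
proof -
  obtain e h where z: "z = (e, h)" by (cases z)
  show ?thesis
    using assms unit_natural(2)[of i e Z'] unit_natural(3)[of i h Z]
    by (simp add: z)
qed

lemma pushfwd_target:
  assumes w: "pushfwd i Z X w" and z: "z \<in> unitary (Val M (Dom1 T i))" "Dom (DVal (Dom1 T i)) z = Z"
    "Cod (DVal (Dom1 T i)) z = Z'"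
  shows "pushfwd i Z' X (z \<cdot>\<^bsub>DVal (Dom1 T i)\<^esub> w)"
proof -
  obtain a where [simp]: "i \<in> J" "Z \<in> Ob (Val M (Dom1 T i))" "X \<in> Ob (Val M (Cod1 T i))"
    "a \<in> Arr (DVal (Cod1 T i))"
    "Dom (DVal (Cod1 T i)) a = X" "Cod (DVal (Cod1 T i)) a = RPush M i $o Z"
    and a: "a \<in> unitary (Val M (Cod1 T i))"
    "w = dcounit i Z \<cdot>\<^bsub>DVal (Dom1 T i)\<^esub> (DPull i $a a)"
    using w by (rule pushfwdE)
  have [simp]: "z \<in> Arr (DVal (Dom1 T i))" "Z' \<in> Ob (Val M (Dom1 T i))"
    using z unitary_Arr[of "Val M (Dom1 T i)" z] Cod_in_Ob[of "DVal (Dom1 T i)" z] by auto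
  note [simp] = z(2,3) RPush_double
  have "z \<cdot>\<^bsub>DVal (Dom1 T i)\<^esub> w = dcounit i Z' \<cdot>\<^bsub>DVal (Dom1 T i)\<^esub>
      (DPull i $a ((double_fctr (RPush M i) $a z) \<cdot>\<^bsub>DVal (Cod1 T i)\<^esub> a))"
    using comp_eq_extend[OF _ counit_double_natural[of i z Z Z'], of "DPull i $a a"] by (simp add: a)
  then show ?thesis
    unfolding pushfwd_def using z a RPush_unitary[of i z] unitary_comp[of "Val M (Cod1 T i)" a "double_fctr (RPush M i) $a z"]
    by (intro conjI bexI[of _ "(double_fctr (RPush M i) $a z) \<cdot>\<^bsub>DVal (Cod1 T i)\<^esub> a"]) simp_all
qed

lemma pushfwd_unique:
  assumes w: "pushfwd i Z X w" and w': "pushfwd i Z X' w'"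
  shows "\<exists>a \<in> unitary (Val M (Cod1 T i)). Dom (DVal (Cod1 T i)) a = X \<and> Cod (DVal (Cod1 T i)) a = X' \<and>
    w = w' \<cdot>\<^bsub>DVal (Dom1 T i)\<^esub> (DPull i $a a)"
proof -
  obtain a where [simp]: "i \<in> J" "Z \<in> Ob (Val M (Dom1 T i))" "X \<in> Ob (Val M (Cod1 T i))"
    "a \<in> Arr (DVal (Cod1 T i))"
    "Dom (DVal (Cod1 T i)) a = X" "Cod (DVal (Cod1 T i)) a = RPush M i $o Z"
    and a: "a \<in> unitary (Val M (Cod1 T i))"
    "w = dcounit i Z \<cdot>\<^bsub>DVal (Dom1 T i)\<^esub> (DPull i $a a)"
    using w by (rule pushfwdE)
  obtain b where [simp]: "X' \<in> Ob (Val M (Cod1 T i))"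
    "b \<in> Arr (DVal (Cod1 T i))"
    "Dom (DVal (Cod1 T i)) b = X'" "Cod (DVal (Cod1 T i)) b = RPush M i $o Z"
    and b: "b \<in> unitary (Val M (Cod1 T i))"
    "w' = dcounit i Z \<cdot>\<^bsub>DVal (Dom1 T i)\<^esub> (DPull i $a b)"
    using w' by (rule pushfwdE)
  obtain c where c: "c \<in> unitary (Val M (Cod1 T i))" "Dom (DVal (Cod1 T i)) c = RPush M i $o Z"
    "Cod (DVal (Cod1 T i)) c = X'"
    "b \<cdot>\<^bsub>DVal (Cod1 T i)\<^esub> c = Idt (DVal (Cod1 T i)) (RPush M i $o Z)"
    using unitary_inverse[of "Val M (Cod1 T i)" b] b by (simp del: double_simps) blast
  have [simp]: "c \<in> Arr (DVal (Cod1 T i))" using c unitary_Arr[of "Val M (Cod1 T i)" c] by auto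
  note [simp] = c(2,3)
  have "b \<cdot>\<^bsub>DVal (Cod1 T i)\<^esub> (c \<cdot>\<^bsub>DVal (Cod1 T i)\<^esub> a) = a"
    using comp_eq_extend[OF _ c(4), of a] by (simp del: double_simps(5))
  from arg_cong[OF this, of "arr_map (DPull i)"]
  have "w = w' \<cdot>\<^bsub>DVal (Dom1 T i)\<^esub> (DPull i $a (c \<cdot>\<^bsub>DVal (Cod1 T i)\<^esub> a))"
    by (simp add: a b)
  then show ?thesis
    using c a unitary_comp[of "Val M (Cod1 T i)" a c] by (intro bexI[of _ "c \<cdot>\<^bsub>DVal (Cod1 T i)\<^esub> a"]) simp_all
qed

lemma pushfwd_Id1:
  assumes [simp]: "G \<in> Obj T" "X \<in> Ob (Val M G)"
  shows "pushfwd (Id1 T G) X X (Idt (DVal G) X)"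
proof -
  have "mutually_inverse (Val M G) (LCounit M (Id1 T G) X) (RUnit M (Id1 T G) X)"
    using rectified unfolding rectified_mackey_2_functor_def by auto
  then show ?thesis
    unfolding double_simps by (subst pushfwd_iff) simp_all
qed

text \<open>The transposes are the structure maps of the pseudofunctors \<open>i \<mapsto> i\<^sub>!\<close> and \<open>i \<mapsto> i\<^sub>*\<close>, which rectification
  makes mutually inverse.\<close>

lemma pushfwd_comp_canonical:
  assumes [simp]: "i \<in> J" "j \<in> J" "Dom1 T i = Cod1 T j" "Z \<in> Ob (Val M (Dom1 T j))"
  shows "pushfwd (i \<circ>1 j) Z (RPush M i $o RPush M j $o Z)
    (dcounit j Z \<cdot>\<^bsub>DVal (Dom1 T j)\<^esub>
     (DPull j $a (dcounit i (RPush M j $o Z))))"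
proof -
  have "mutually_inverse (Val M (Cod1 T i)) (LPush_comp T M i j Z) (RPush_comp T M i j Z)"
    using rectified unfolding rectified_mackey_2_functor_def by auto
  then show ?thesis
    unfolding double_simps double_fctr_simps
    by (subst pushfwd_iff) (simp_all add: LPush_comp_def RPush_comp_def LPush_RPush)
qed

lemma pushfwd_comp:
  assumes 1: "pushfwd j Z X w" and 2: "pushfwd i X X' w'" and ij [simp]: "Dom1 T i = Cod1 T j"
  shows "pushfwd (i \<circ>1 j) Z X' (w \<cdot>\<^bsub>DVal (Dom1 T j)\<^esub> (DPull j $a w'))"
proof -
  obtain a where [simp]: "j \<in> J" "Z \<in> Ob (Val M (Dom1 T j))" "X \<in> Ob (Val M (Cod1 T j))"
    "dcounit j Z \<in> Arr (DVal (Dom1 T j))"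
    "a \<in> Arr (DVal (Cod1 T j))"
    "Dom (DVal (Cod1 T j)) a = X" "Cod (DVal (Cod1 T j)) a = RPush M j $o Z"
    and a: "a \<in> unitary (Val M (Cod1 T j))"
    "w = dcounit j Z \<cdot>\<^bsub>DVal (Dom1 T j)\<^esub> (DPull j $a a)"
    using 1 by (rule pushfwdE)
  obtain b where [simp]: "i \<in> J" "X' \<in> Ob (Val M (Cod1 T i))"
    "b \<in> Arr (DVal (Cod1 T i))"
    "Dom (DVal (Cod1 T i)) b = X'" "Cod (DVal (Cod1 T i)) b = RPush M i $o X"
    and b: "b \<in> unitary (Val M (Cod1 T i))"
    "w' = dcounit i X \<cdot>\<^bsub>DVal (Dom1 T i)\<^esub> (DPull i $a b)"
    using 2 by (rule pushfwdE)
  note [simp] = RPush_double[of i, simplified]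
  let ?c = "(double_fctr (RPush M i) $a a) \<cdot>\<^bsub>DVal (Cod1 T i)\<^esub> b"
  have c: "?c \<in> unitary (Val M (Cod1 T i))"
    by (rule unitary_comp) (use a b RPush_unitary[of i a] in simp_all)
  have n: "a \<cdot>\<^bsub>DVal (Cod1 T j)\<^esub> (dcounit i X \<cdot>\<^bsub>DVal (Cod1 T j)\<^esub> (DPull i $a b))
    = (dcounit i (RPush M j $o Z)) \<cdot>\<^bsub>DVal (Cod1 T j)\<^esub> (DPull i $a ?c)"
    using comp_eq_extend[OF _ counit_double_natural[of i a X "RPush M j $o Z"], of "DPull i $a b"] by simp
  have "w \<cdot>\<^bsub>DVal (Dom1 T j)\<^esub> (DPull j $a w')
      = (dcounit j Z \<cdot>\<^bsub>DVal (Dom1 T j)\<^esub>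
     (DPull j $a (dcounit i (RPush M j $o Z))))
      \<cdot>\<^bsub>DVal (Dom1 T j)\<^esub> (DPull (i \<circ>1 j) $a ?c)"
    using arg_cong[OF n, of "arr_map (DPull j)"] by (simp add: a b del: double_simps(6) double_fctr_simps(2))
  then show ?thesis
    using pushfwd_source[of "i \<circ>1 j" ?c X' "RPush M i $o RPush M j $o Z"
      "dcounit j Z \<cdot>\<^bsub>DVal (Dom1 T j)\<^esub>
     (DPull j $a (dcounit i (RPush M j $o Z)))" Z]
      c pushfwd_comp_canonical[of i j Z]
    by simp
qed

lemma LPush_2cell_transpose:
  assumes [simp]: "i \<in> J" "i' \<in> J" "\<alpha> \<in> Cell2 T" "Dom2 T \<alpha> = i" "Cod2 T \<alpha> = i'" "Z \<in> Ob (Val M (Dom1 T i))"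
  shows "LPush_2cell T M i i' \<alpha> Z \<in> Arr (Val M (Cod1 T i))"
    "Dom (Val M (Cod1 T i)) (LPush_2cell T M i i' \<alpha> Z) = RPush M i' $o Z"
    "Cod (Val M (Cod1 T i)) (LPush_2cell T M i i' \<alpha> Z) = RPush M i $o Z"
    "(Pull M i' $a LPush_2cell T M i i' \<alpha> Z) \<cdot>\<^bsub>Val M (Dom1 T i)\<^esub> LUnit M i' Z =
      Pull2 M \<alpha> (RPush M i $o Z) \<cdot>\<^bsub>Val M (Dom1 T i)\<^esub> LUnit M i Z"
proof -
  have [simp]: "Dom1 T i' = Dom1 T i" "Cod1 T i' = Cod1 T i" using cell2_arr(3,4)[of \<alpha>] by auto
  have eq: "LPush_2cell T M i i' \<alpha> Z = LCounit M i' (RPush M i $o Z) \<cdot>\<^bsub>Val M (Cod1 T i)\<^esub>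
      (RPush M i' $a (Pull2 M \<alpha> (RPush M i $o Z) \<cdot>\<^bsub>Val M (Dom1 T i)\<^esub> LUnit M i Z))"
    by (simp add: LPush_2cell_def LPush_RPush)
  show "LPush_2cell T M i i' \<alpha> Z \<in> Arr (Val M (Cod1 T i))"
    "Dom (Val M (Cod1 T i)) (LPush_2cell T M i i' \<alpha> Z) = RPush M i' $o Z"
    "Cod (Val M (Cod1 T i)) (LPush_2cell T M i i' \<alpha> Z) = RPush M i $o Z"
    unfolding eq by simp_all
  let ?g = "Pull2 M \<alpha> (RPush M i $o Z) \<cdot>\<^bsub>Val M (Dom1 T i)\<^esub> LUnit M i Z"
  have g: "?g \<in> Arr (Val M (Dom1 T i))" "Dom (Val M (Dom1 T i)) ?g = Z"
    "Cod (Val M (Dom1 T i)) ?g = Pull M i' $o RPush M i $o Z" by simp_all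
  have "(Pull M i' $a (LCounit M i' (RPush M i $o Z) \<cdot>\<^bsub>Val M (Cod1 T i)\<^esub> (RPush M i' $a ?g))) \<cdot>\<^bsub>Val M (Dom1 T i)\<^esub> LUnit M i' Z
      = (Pull M i' $a LCounit M i' (RPush M i $o Z)) \<cdot>\<^bsub>Val M (Dom1 T i)\<^esub>
        ((Pull M i' $a RPush M i' $a ?g) \<cdot>\<^bsub>Val M (Dom1 T i)\<^esub> LUnit M i' Z)"
    using g by (simp del: comp_arr) (simp)
  also have "(Pull M i' $a RPush M i' $a ?g) \<cdot>\<^bsub>Val M (Dom1 T i)\<^esub> LUnit M i' Z = LUnit M i' (Pull M i' $o RPush M i $o Z) \<cdot>\<^bsub>Val M (Dom1 T i)\<^esub> ?g"
    using unit_natural(3)[of i' ?g "Pull M i' $o RPush M i $o Z"] g by simp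
  also have "(Pull M i' $a LCounit M i' (RPush M i $o Z)) \<cdot>\<^bsub>Val M (Dom1 T i)\<^esub>
      (LUnit M i' (Pull M i' $o RPush M i $o Z) \<cdot>\<^bsub>Val M (Dom1 T i)\<^esub> ?g) = ?g"
    using comp_eq_extend[OF _ triangles(3)[of i' "RPush M i $o Z"], of ?g] g by simp
  finally show "(Pull M i' $a LPush_2cell T M i i' \<alpha> Z) \<cdot>\<^bsub>Val M (Dom1 T i)\<^esub> LUnit M i' Z = ?g"
    unfolding eq .
qed

lemma LUnit_transpose_inject:
  assumes [simp]: "i \<in> J" "Z \<in> Ob (Val M (Dom1 T i))"
    and f: "f \<in> Arr (Val M (Cod1 T i))" "Dom (Val M (Cod1 T i)) f = RPush M i $o Z"
    and g: "g \<in> Arr (Val M (Cod1 T i))" "Dom (Val M (Cod1 T i)) g = RPush M i $o Z"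
      "Cod (Val M (Cod1 T i)) g = Cod (Val M (Cod1 T i)) f"
    and eq: "(Pull M i $a f) \<cdot>\<^bsub>Val M (Dom1 T i)\<^esub> LUnit M i Z = (Pull M i $a g) \<cdot>\<^bsub>Val M (Dom1 T i)\<^esub> LUnit M i Z"
  shows "f = g"
proof -
  have r: "x = LCounit M i (Cod (Val M (Cod1 T i)) x) \<cdot>\<^bsub>Val M (Cod1 T i)\<^esub> (RPush M i $a ((Pull M i $a x) \<cdot>\<^bsub>Val M (Dom1 T i)\<^esub> LUnit M i Z))"
    if "x \<in> Arr (Val M (Cod1 T i))" "Dom (Val M (Cod1 T i)) x = RPush M i $o Z" for x
    using that comp_eq_extend[OF _ unit_natural(4)[of i x "Cod (Val M (Cod1 T i)) x"], of "RPush M i $a LUnit M i Z"] triangles(4)[of i Z]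
    by simp
  show ?thesis using r[OF f] r[OF g(1,2)] eq g(3) by simp
qed

text \<open>Functoriality of \<open>\<alpha> \<mapsto> \<alpha>\<^sub>!\<close> for a 2-cell and its inverse, seen on transposes along \<open>i\<close>.\<close>

lemma LPush_2cell_inverse:
  assumes [simp]: "i \<in> J" "i' \<in> J" "\<alpha> \<in> Cell2 T" "Dom2 T \<alpha> = i" "Cod2 T \<alpha> = i'" "Z \<in> Ob (Val M (Dom1 T i))"
  shows "LPush_2cell T M i i' \<alpha> Z \<cdot>\<^bsub>Val M (Cod1 T i)\<^esub> LPush_2cell T M i' i (inv_arr (Cells2 T) \<alpha>) Z = Idt (Val M (Cod1 T i)) (RPush M i $o Z)"
proof -
  have [simp]: "Dom1 T i' = Dom1 T i" "Cod1 T i' = Cod1 T i" using cell2_arr(3,4)[of \<alpha>] by auto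
  let ?\<beta> = "inv_arr (Cells2 T) \<alpha>"
  let ?f = "LPush_2cell T M i i' \<alpha> Z" and ?g = "LPush_2cell T M i' i ?\<beta> Z"
  note f [simp] = LPush_2cell_transpose(1-3)[of i i' \<alpha> Z, simplified]
  note g [simp] = LPush_2cell_transpose(1-3)[of i' i ?\<beta> Z, simplified]
  note tf = LPush_2cell_transpose(4)[of i i' \<alpha> Z, simplified]
  note tg = LPush_2cell_transpose(4)[of i' i ?\<beta> Z, simplified]
  have n: "(Pull M i $a ?f) \<cdot>\<^bsub>Val M (Dom1 T i)\<^esub> Pull2 M ?\<beta> (RPush M i' $o Z) = Pull2 M ?\<beta> (RPush M i $o Z) \<cdot>\<^bsub>Val M (Dom1 T i)\<^esub> (Pull M i' $a ?f)"
    using base.P2_natural[of ?\<beta> "Dom1 T i" ?f i' i "RPush M i' $o Z" "RPush M i $o Z"] by simp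
  have c: "Pull2 M ?\<beta> (RPush M i $o Z) \<cdot>\<^bsub>Val M (Dom1 T i)\<^esub> Pull2 M \<alpha> (RPush M i $o Z) = Idt (Val M (Dom1 T i)) (Pull M i $o RPush M i $o Z)"
    using base.P2_comp[of \<alpha> ?\<beta> "RPush M i $o Z"] by simp
  show ?thesis
  proof (rule LUnit_transpose_inject[of i Z])
    show "(Pull M i $a (?f \<cdot>\<^bsub>Val M (Cod1 T i)\<^esub> ?g)) \<cdot>\<^bsub>Val M (Dom1 T i)\<^esub> LUnit M i Z =
      (Pull M i $a Idt (Val M (Cod1 T i)) (RPush M i $o Z)) \<cdot>\<^bsub>Val M (Dom1 T i)\<^esub> LUnit M i Z"
      using tf tg comp_eq_extend[OF _ n, of "LUnit M i' Z"] comp_eq_extend[OF _ c, of "LUnit M i Z"] by simp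
  qed simp_all
qed

text \<open>The transposes are \<open>\<alpha>\<^sub>*\<close> and \<open>(\<alpha>\<inverse>)\<^sub>!\<close>. These are inverse to each other, because rectification gives
  \<open>\<alpha>\<^sub>* = \<alpha>\<^sub>!\<close>.\<close>

lemma pushfwd_2cell_canonical:
  assumes [simp]: "i \<in> J" "i' \<in> J" "\<alpha> \<in> Cell2 T" "Dom2 T \<alpha> = i'" "Cod2 T \<alpha> = i" "Z \<in> Ob (Val M (Dom1 T i))"
  shows "pushfwd i' Z (RPush M i $o Z) (dcounit i Z \<cdot>\<^bsub>DVal (Dom1 T i)\<^esub>
     (DPull2 \<alpha> (RPush M i $o Z)))"
proof -
  have [simp]: "Dom1 T i' = Dom1 T i" "Cod1 T i' = Cod1 T i" using cell2_arr(3,4)[of \<alpha>] by auto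
  let ?\<beta> = "inv_arr (Cells2 T) \<alpha>"
  let ?l = "LPush_2cell T M i i' ?\<beta> Z" and ?r = "LPush_2cell T M i' i \<alpha> Z"
  have r: "?r = RPush_2cell T M i' i \<alpha> Z"
    using rectified unfolding rectified_mackey_2_functor_def by simp
  have "mutually_inverse (Val M (Cod1 T i)) ?l ?r"
    unfolding mutually_inverse_def
    using LPush_2cell_transpose(1-3)[of i i' ?\<beta> Z, simplified] LPush_2cell_transpose(1-3)[of i' i \<alpha> Z, simplified]
      LPush_2cell_inverse[of i' i \<alpha> Z] LPush_2cell_inverse[of i i' ?\<beta> Z] by simp
  then show ?thesis
    unfolding double_simps r
    by (subst pushfwd_iff) (simp_all add: LPush_2cell_def RPush_2cell_def LPush_RPush)
qed

lemma pushfwd_2cell: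
  assumes 1: "pushfwd i Z X w" and 2 [simp]: "i' \<in> J" "\<alpha> \<in> Cell2 T" "Dom2 T \<alpha> = i'" "Cod2 T \<alpha> = i"
  shows "pushfwd i' Z X (w \<cdot>\<^bsub>DVal (Dom1 T i)\<^esub> (DPull2 \<alpha> X))"
proof -
  have [simp]: "Dom1 T i' = Dom1 T i" "Cod1 T i' = Cod1 T i" using cell2_arr(3,4)[of \<alpha>] by auto
  obtain a where [simp]: "i \<in> J" "Z \<in> Ob (Val M (Dom1 T i))" "X \<in> Ob (Val M (Cod1 T i))"
    "dcounit i Z \<in> Arr (DVal (Dom1 T i))"
    "a \<in> Arr (DVal (Cod1 T i))"
    "Dom (DVal (Cod1 T i)) a = X" "Cod (DVal (Cod1 T i)) a = RPush M i $o Z"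
    and a: "a \<in> unitary (Val M (Cod1 T i))"
    "w = dcounit i Z \<cdot>\<^bsub>DVal (Dom1 T i)\<^esub> (DPull i $a a)"
    using 1 by (rule pushfwdE)
  let ?A = "DPull2 \<alpha>"
  have n: "?A (RPush M i $o Z) \<cdot>\<^bsub>DVal (Dom1 T i)\<^esub> (double_fctr (Pull M i') $a a)
    = (DPull i $a a) \<cdot>\<^bsub>DVal (Dom1 T i)\<^esub> ?A X"
    using dbl.P2_natural[of \<alpha> "Dom1 T i" a i' i X "RPush M i $o Z"] by simp
  have A [simp]: "?A X \<in> Arr (DVal (Dom1 T i))" "Dom (DVal (Dom1 T i)) (?A X) = Pull M i' $o X"
    "Cod (DVal (Dom1 T i)) (?A X) = Pull M i $o X"
    "?A (RPush M i $o Z) \<in> Arr (DVal (Dom1 T i))" "Dom (DVal (Dom1 T i)) (?A (RPush M i $o Z)) = Pull M i' $o RPush M i $o Z"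
    "Cod (DVal (Dom1 T i)) (?A (RPush M i $o Z)) = Pull M i $o RPush M i $o Z" by simp_all
  let ?w = "dcounit i Z \<cdot>\<^bsub>DVal (Dom1 T i)\<^esub> ?A (RPush M i $o Z)"
  have "w \<cdot>\<^bsub>DVal (Dom1 T i)\<^esub> ?A X = ?w \<cdot>\<^bsub>DVal (Dom1 T i)\<^esub> (double_fctr (Pull M i') $a a)"
    unfolding a using n A by (simp del: double_simps(6))
  then show ?thesis
    using pushfwd_source[of i' a X "RPush M i $o Z" ?w Z] a pushfwd_2cell_canonical[of i i' \<alpha> Z] by simp
qed

text \<open>The transposes are the two base change maps.\<close>

lemma pushfwd_base_change_canonical:
  assumes sq: "mackey_square T i u p q (inv_arr (Cells2 T) \<gamma>)" and [simp]: "i \<in> J" "q \<in> J"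
      "\<gamma> \<in> Cell2 T" "Dom2 T \<gamma> = u \<circ>1 q" "Cod2 T \<gamma> = i \<circ>1 p" "Z \<in> Ob (Val M (Dom1 T i))"
  shows "pushfwd q (Pull M p $o Z) (Pull M u $o RPush M i $o Z)
    ((DPull p $a (dcounit i Z)) \<cdot>\<^bsub>DVal (Dom1 T q)\<^esub>
     (DPull2 \<gamma> (RPush M i $o Z)))"
proof -
  have [simp]: "u \<in> Cell1 T" "p \<in> Cell1 T" "Cod1 T u = Cod1 T i" "Dom1 T u = Cod1 T q" "Cod1 T p = Dom1 T i" "Dom1 T p = Dom1 T q"
    using sq unfolding mackey_square_def by auto
  have "mutually_inverse (Val M (Cod1 T q)) (left_base_change T M i u p q (inv_arr (Cells2 T) \<gamma>) Z)
      (right_base_change T M i u p q (inv_arr (Cells2 T) \<gamma>) Z)"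
    using rectified sq unfolding rectified_mackey_2_functor_def by auto
  then show ?thesis
    unfolding double_simps double_fctr_simps
    by (subst pushfwd_iff) (simp_all add: left_base_change_def right_base_change_def LPush_RPush)
qed

lemma pushfwd_base_change:
  assumes 1: "pushfwd i Z X w" and sq: "mackey_square T i u p q (inv_arr (Cells2 T) \<gamma>)" and [simp]: "q \<in> J"
      "\<gamma> \<in> Cell2 T" "Dom2 T \<gamma> = u \<circ>1 q" "Cod2 T \<gamma> = i \<circ>1 p"
  shows "pushfwd q (Pull M p $o Z) (Pull M u $o X)
    ((DPull p $a w) \<cdot>\<^bsub>DVal (Dom1 T q)\<^esub> (DPull2 \<gamma> X))"
proof -
  have [simp]: "u \<in> Cell1 T" "p \<in> Cell1 T" "Cod1 T u = Cod1 T i" "Dom1 T u = Cod1 T q" "Cod1 T p = Dom1 T i" "Dom1 T p = Dom1 T q"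
    using sq unfolding mackey_square_def by auto
  obtain a where [simp]: "i \<in> J" "Z \<in> Ob (Val M (Dom1 T i))" "X \<in> Ob (Val M (Cod1 T i))"
    "RPush M i $o Z \<in> Ob (Val M (Cod1 T i))"
    "dcounit i Z \<in> Arr (DVal (Dom1 T i))"
    "a \<in> Arr (DVal (Cod1 T i))"
    "Dom (DVal (Cod1 T i)) a = X" "Cod (DVal (Cod1 T i)) a = RPush M i $o Z"
    and a: "a \<in> unitary (Val M (Cod1 T i))"
    "w = dcounit i Z \<cdot>\<^bsub>DVal (Dom1 T i)\<^esub> (DPull i $a a)"
    using 1 by (rule pushfwdE)
  let ?A = "DPull2 \<gamma>"
  let ?D = "DVal (Dom1 T q)"
  have n: "?A (RPush M i $o Z) \<cdot>\<^bsub>?D\<^esub> (DPull q $a DPull u $a a)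
    = (DPull p $a DPull i $a a) \<cdot>\<^bsub>?D\<^esub> ?A X"
    using dbl.P2_natural[of \<gamma> "Dom1 T q" a "u \<circ>1 q" "i \<circ>1 p" X "RPush M i $o Z"] by simp
  have A [simp]: "?A X \<in> Arr ?D" "Dom ?D (?A X) = Pull M q $o Pull M u $o X"
    "Cod ?D (?A X) = Pull M p $o Pull M i $o X"
    "?A (RPush M i $o Z) \<in> Arr ?D" "Dom ?D (?A (RPush M i $o Z)) = Pull M q $o Pull M u $o RPush M i $o Z"
    "Cod ?D (?A (RPush M i $o Z)) = Pull M p $o Pull M i $o RPush M i $o Z" by simp_all
  let ?w = "(DPull p $a (dcounit i Z)) \<cdot>\<^bsub>?D\<^esub> ?A (RPush M i $o Z)"
  have "(DPull p $a w) \<cdot>\<^bsub>?D\<^esub> ?A X = ?w \<cdot>\<^bsub>?D\<^esub> (DPull q $a DPull u $a a)"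
    unfolding a using n A by (simp del: double_simps(6) double_fctr_simps(2))
  moreover have "DPull u $a a \<in> unitary (Val M (Cod1 T q))"
    using unitary_map[OF Pull_functor[of u] _ a(1)[folded \<open>Cod1 T u = Cod1 T i\<close>]] by simp
  ultimately show ?thesis
    using pushfwd_source[of q "DPull u $a a" "Pull M u $o X" "Pull M u $o RPush M i $o Z" ?w "Pull M p $o Z"]
      pushfwd_base_change_canonical[OF sq, of Z] by simp
qed

sublocale pushforwards T "\<lambda>G. DVal G" "\<lambda>u. DPull u"
  "\<lambda>\<alpha> X. DPull2 \<alpha> X" J "\<lambda>G. unitary (Val M G)" pushfwd
proof unfold_locales
  fix u a H assume "u \<in> Cell1 T" "a \<in> unitary (Val M (Cod1 T u))" "Dom1 T u = H"
  then show "DPull u $a a \<in> unitary (Val M H)"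
    using unitary_map[OF Pull_functor[of u]] by simp
next
  fix \<alpha> H X assume a: "\<alpha> \<in> Cell2 T" "Dom1 T (Dom2 T \<alpha>) = H" "X \<in> Ob (DVal (Cod1 T (Dom2 T \<alpha>)))"
  have "Pull2 M \<alpha> X \<cdot>\<^bsub>Val M H\<^esub> Pull2 M (inv_arr (Cells2 T) \<alpha>) X = Idt (Val M H) (Pull M (Cod2 T \<alpha>) $o X)"
    "Pull2 M (inv_arr (Cells2 T) \<alpha>) X \<cdot>\<^bsub>Val M H\<^esub> Pull2 M \<alpha> X = Idt (Val M H) (Pull M (Dom2 T \<alpha>) $o X)"
    using base.P2_comp[of "inv_arr (Cells2 T) \<alpha>" \<alpha> X] base.P2_comp[of \<alpha> "inv_arr (Cells2 T) \<alpha>" X] a by simp_all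
  then show "DPull2 \<alpha> X \<in> unitary (Val M H)"
    using a by (simp add: unitary_def mutually_inverse_def)
next
  fix i Z X w assume "pushfwd i Z X w"
  then obtain a where a [simp]: "i \<in> J" "Z \<in> Ob (Val M (Dom1 T i))" "X \<in> Ob (Val M (Cod1 T i))"
    "dcounit i Z \<in> Arr (DVal (Dom1 T i))"
    "a \<in> Arr (DVal (Cod1 T i))"
    "Dom (DVal (Cod1 T i)) a = X" "Cod (DVal (Cod1 T i)) a = RPush M i $o Z"
    "w = dcounit i Z \<cdot>\<^bsub>DVal (Dom1 T i)\<^esub> (DPull i $a a)"
    by (rule pushfwdE)
  show "i \<in> J" "Z \<in> Ob (DVal (Dom1 T i))" "X \<in> Ob (DVal (Cod1 T i))"
    "w \<in> Arr (DVal (Dom1 T i))" "Dom (DVal (Dom1 T i)) w = DPull i $o X"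
    "Cod (DVal (Dom1 T i)) w = Z"
    by simp_all
qed (use pushfwd_unique pushfwd_source pushfwd_target pushfwd_Id1 pushfwd_comp pushfwd_2cell pushfwd_base_change
      unitary_Arr[OF Val_category] unitary_Idt[OF Val_category] unitary_comp[OF Val_category] in \<open>simp_all del: double_simps(2-6) double_fctr_simps(2)\<close>)

end


section \<open>Pairings of Mackey 2-functors\<close>

locale mackey_pairing =
  M: rectified_mackey T J M A k + N: rectified_mackey T J N A k + L: rectified_mackey T J L A k
  for T :: "('o, 'c, 't) twocat" (structure) and J :: "'c set" and A :: target and k :: "'k ring"
    and M :: "('o, 'c, 't, 'a, 'm, 'k) mackey"
    and N :: "('o, 'c, 't, 'b, 'n, 'k) mackey"
    and L :: "('o, 'c, 't, 'd, 'l, 'k) mackey" +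
  fixes B :: "('o, 'c, 'a, 'm, 'b, 'n, 'd, 'l) pairing" and S :: "('o, 'c, 't) prods"
  assumes pairing: "is_pairing k T M N L B"
    and products: "binary_products T S"
    and ProdMap_J: "i \<in> J \<Longrightarrow> j \<in> J \<Longrightarrow> ProdMap S i j \<in> J"
begin

lemma PArr_props [simp]:
  assumes "G \<in> Obj T"
  shows "X \<in> Ob (Val M G) \<Longrightarrow> Y \<in> Ob (Val N G) \<Longrightarrow> POb B G X Y \<in> Ob (Val L G)"
    "X \<in> Ob (Val M G) \<Longrightarrow> Y \<in> Ob (Val N G) \<Longrightarrow> PArr B G (Idt (Val M G) X) (Idt (Val N G) Y) = Idt (Val L G) (POb B G X Y)"
    "f \<in> Arr (Val M G) \<Longrightarrow> g \<in> Arr (Val N G) \<Longrightarrow> PArr B G f g \<in> Arr (Val L G)"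
    "f \<in> Arr (Val M G) \<Longrightarrow> g \<in> Arr (Val N G) \<Longrightarrow> Dom (Val L G) (PArr B G f g) = POb B G (Dom (Val M G) f) (Dom (Val N G) g)"
    "f \<in> Arr (Val M G) \<Longrightarrow> g \<in> Arr (Val N G) \<Longrightarrow> Cod (Val L G) (PArr B G f g) = POb B G (Cod (Val M G) f) (Cod (Val N G) g)"
    "f \<in> Arr (Val M G) \<Longrightarrow> g \<in> Arr (Val N G) \<Longrightarrow> f' \<in> Arr (Val M G) \<Longrightarrow> g' \<in> Arr (Val N G) \<Longrightarrow>
      Dom (Val M G) f' = Cod (Val M G) f \<Longrightarrow> Dom (Val N G) g' = Cod (Val N G) g \<Longrightarrow>
      PArr B G f' g' \<cdot>\<^bsub>Val L G\<^esub> PArr B G f g = PArr B G (f' \<cdot>\<^bsub>Val M G\<^esub> f) (g' \<cdot>\<^bsub>Val N G\<^esub> g)"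
proof -
  let ?C = "pair_cat (Val M G) (Val N G)"
  let ?F = "\<lparr>obj_map = \<lambda>(x, y). POb B G x y, arr_map = \<lambda>(f, g). PArr B G f g\<rparr>"
  have "bilinear_functor k (Val M G) (Val N G) (Val L G) (POb B G) (PArr B G)"
    using pairing assms unfolding is_pairing_def by simp
  then have F: "is_functor ?C (Val L G) ?F"
    unfolding bilinear_functor_def by (rule conjunct1)
  have C: "category ?C"
    using assms by unfold_locales (auto simp: pair_cat_def)
  note props = functor_props[OF F C, simplified]
  show "X \<in> Ob (Val M G) \<Longrightarrow> Y \<in> Ob (Val N G) \<Longrightarrow> POb B G X Y \<in> Ob (Val L G)"
    "X \<in> Ob (Val M G) \<Longrightarrow> Y \<in> Ob (Val N G) \<Longrightarrow> PArr B G (Idt (Val M G) X) (Idt (Val N G) Y) = Idt (Val L G) (POb B G X Y)"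
    "f \<in> Arr (Val M G) \<Longrightarrow> g \<in> Arr (Val N G) \<Longrightarrow> PArr B G f g \<in> Arr (Val L G)"
    "f \<in> Arr (Val M G) \<Longrightarrow> g \<in> Arr (Val N G) \<Longrightarrow> Dom (Val L G) (PArr B G f g) = POb B G (Dom (Val M G) f) (Dom (Val N G) g)"
    "f \<in> Arr (Val M G) \<Longrightarrow> g \<in> Arr (Val N G) \<Longrightarrow> Cod (Val L G) (PArr B G f g) = POb B G (Cod (Val M G) f) (Cod (Val N G) g)"
    using props(1,2)[of "(X, Y)"] props(3-5)[of "(f, g)"] by (simp_all add: pair_cat_def)
  show "PArr B G f' g' \<cdot>\<^bsub>Val L G\<^esub> PArr B G f g = PArr B G (f' \<cdot>\<^bsub>Val M G\<^esub> f) (g' \<cdot>\<^bsub>Val N G\<^esub> g)"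
    if "f \<in> Arr (Val M G)" "g \<in> Arr (Val N G)" "f' \<in> Arr (Val M G)" "g' \<in> Arr (Val N G)"
      "Dom (Val M G) f' = Cod (Val M G) f" "Dom (Val N G) g' = Cod (Val N G) g"
    using props(6)[of "(f, g)" "(f', g')"] that by (simp add: pair_cat_def)
qed

lemma PNat_props [simp]:
  assumes "u \<in> Cell1 T" "Dom1 T u = H" "X \<in> Ob (Val M (Cod1 T u))" "Y \<in> Ob (Val N (Cod1 T u))"
  shows "iso_arr (Val L H) (PNat B u X Y)" "PNat B u X Y \<in> Arr (Val L H)"
    "Dom (Val L H) (PNat B u X Y) = Pull L u $o POb B (Cod1 T u) X Y"
    "Cod (Val L H) (PNat B u X Y) = POb B H (Pull M u $o X) (Pull N u $o Y)"
  using pairing assms unfolding is_pairing_def by auto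

lemma PNat_natural:
  assumes "u \<in> Cell1 T" "f \<in> Arr (Val M (Cod1 T u))" "g \<in> Arr (Val N (Cod1 T u))"
  shows "PNat B u (Cod (Val M (Cod1 T u)) f) (Cod (Val N (Cod1 T u)) g) \<cdot>\<^bsub>Val L (Dom1 T u)\<^esub> (Pull L u $a PArr B (Cod1 T u) f g) =
    PArr B (Dom1 T u) (Pull M u $a f) (Pull N u $a g) \<cdot>\<^bsub>Val L (Dom1 T u)\<^esub> PNat B u (Dom (Val M (Cod1 T u)) f) (Dom (Val N (Cod1 T u)) g)"
  using pairing assms unfolding is_pairing_def by auto

lemma PNat_natural_inv:
  assumes "u \<in> Cell1 T" "f \<in> Arr (Val M (Cod1 T u))" "g \<in> Arr (Val N (Cod1 T u))"
  shows "(Pull L u $a PArr B (Cod1 T u) f g) \<cdot>\<^bsub>Val L (Dom1 T u)\<^esub>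
      inv_arr (Val L (Dom1 T u)) (PNat B u (Dom (Val M (Cod1 T u)) f) (Dom (Val N (Cod1 T u)) g)) =
    inv_arr (Val L (Dom1 T u)) (PNat B u (Cod (Val M (Cod1 T u)) f) (Cod (Val N (Cod1 T u)) g)) \<cdot>\<^bsub>Val L (Dom1 T u)\<^esub>
      PArr B (Dom1 T u) (Pull M u $a f) (Pull N u $a g)"
  by (rule inv_arr_square) (use assms PNat_natural[OF assms] in simp_all)

lemma PNat_comp1:
  assumes "u \<in> Cell1 T" "v \<in> Cell1 T" "Dom1 T u = Cod1 T v" "X \<in> Ob (Val M (Cod1 T u))" "Y \<in> Ob (Val N (Cod1 T u))"
  shows "PNat B (u \<circ>1 v) X Y = PNat B v (Pull M u $o X) (Pull N u $o Y) \<cdot>\<^bsub>Val L (Dom1 T v)\<^esub> (Pull L v $a PNat B u X Y)"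
  using pairing assms unfolding is_pairing_def by auto

lemma PNat_2cell:
  assumes "\<alpha> \<in> Cell2 T" "X \<in> Ob (Val M (Cod1 T (Dom2 T \<alpha>)))" "Y \<in> Ob (Val N (Cod1 T (Dom2 T \<alpha>)))"
    "Dom1 T (Dom2 T \<alpha>) = H" "Cod1 T (Dom2 T \<alpha>) = G"
  shows "PNat B (Cod2 T \<alpha>) X Y \<cdot>\<^bsub>Val L H\<^esub> Pull2 L \<alpha> (POb B G X Y) =
        PArr B H (Pull2 M \<alpha> X) (Pull2 N \<alpha> Y) \<cdot>\<^bsub>Val L H\<^esub> PNat B (Dom2 T \<alpha>) X Y"
  using pairing assms unfolding is_pairing_def by auto

sublocale dbl: cartesian_pairing_calculus T J
  "\<lambda>G. double (Val M G)" "\<lambda>u. double_fctr (Pull M u)" "\<lambda>\<alpha> X. (Pull2 M \<alpha> X, Pull2 M (inv_arr (Cells2 T) \<alpha>) X)"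
    "\<lambda>G. unitary (Val M G)" M.pushfwd
  "\<lambda>G. double (Val N G)" "\<lambda>u. double_fctr (Pull N u)" "\<lambda>\<alpha> X. (Pull2 N \<alpha> X, Pull2 N (inv_arr (Cells2 T) \<alpha>) X)"
    "\<lambda>G. unitary (Val N G)" N.pushfwd
  "\<lambda>G. double (Val L G)" "\<lambda>u. double_fctr (Pull L u)" "\<lambda>\<alpha> X. (Pull2 L \<alpha> X, Pull2 L (inv_arr (Cells2 T) \<alpha>) X)"
    "\<lambda>G. unitary (Val L G)" L.pushfwd
  "POb B" "\<lambda>G (e, h) (e', h'). (PArr B G e e', PArr B G h h')"
  "\<lambda>u X Y. (PNat B u X Y, inv_arr (Val L (Dom1 T u)) (PNat B u X Y))" S
proof unfold_locales
  fix G f g assume G: "G \<in> Obj T" and f: "f \<in> unitary (Val M G)" and g: "g \<in> unitary (Val N G)"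
  then show "(case f of (e, h) \<Rightarrow> \<lambda>(e', h'). (PArr B G e e', PArr B G h h')) g \<in> unitary (Val L G)"
    by (auto simp: unitary_def mutually_inverse_def)
next
  fix u H X Y assume "u \<in> Cell1 T" "Dom1 T u = H" "X \<in> Ob (double (Val M (Cod1 T u)))" "Y \<in> Ob (double (Val N (Cod1 T u)))"
  then show "(PNat B u X Y, inv_arr (Val L (Dom1 T u)) (PNat B u X Y)) \<in> unitary (Val L H)"
    using mutually_inverse_inv_arr[of "Val L H" "PNat B u X Y"] by (auto simp: unitary_def)
next
  fix u H G f g X' Y'
  assume "u \<in> Cell1 T" "Dom1 T u = H" "Cod1 T u = G" "f \<in> Arr (double (Val M G))" "g \<in> Arr (double (Val N G))"
    "Cod (double (Val M G)) f = X'" "Cod (double (Val N G)) g = Y'"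
  then show "(PNat B u X' Y', inv_arr (Val L (Dom1 T u)) (PNat B u X' Y')) \<cdot>\<^bsub>double (Val L H)\<^esub>
      (double_fctr (Pull L u) $a (case f of (e, h) \<Rightarrow> \<lambda>(e', h'). (PArr B G e e', PArr B G h h')) g) =
     (case double_fctr (Pull M u) $a f of (e, h) \<Rightarrow> \<lambda>(e', h'). (PArr B H e e', PArr B H h h')) (double_fctr (Pull N u) $a g) \<cdot>\<^bsub>double (Val L H)\<^esub>
       (PNat B u (Dom (double (Val M G)) f) (Dom (double (Val N G)) g),
        inv_arr (Val L (Dom1 T u)) (PNat B u (Dom (double (Val M G)) f) (Dom (double (Val N G)) g)))"
    using PNat_natural[of u "fst f" "fst g"] PNat_natural_inv[of u "snd f" "snd g"]
    by (cases f; cases g) auto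
next
  fix G X Y assume "G \<in> Obj T" "X \<in> Ob (double (Val M G))" "Y \<in> Ob (double (Val N G))"
  then have "PNat B (Id1 T G) X Y = Idt (Val L G) (POb B G X Y)" "inv_arr (Val L G) (Idt (Val L G) (POb B G X Y)) = Idt (Val L G) (POb B G X Y)"
    using pairing inv_arr_eqI[of "Val L G" "Idt (Val L G) (POb B G X Y)" "Idt (Val L G) (POb B G X Y)"]
    unfolding is_pairing_def by (auto simp: mutually_inverse_def)
  then show "(PNat B (Id1 T G) X Y, inv_arr (Val L (Dom1 T (Id1 T G))) (PNat B (Id1 T G) X Y)) = Idt (double (Val L G)) (POb B G X Y)"
    using \<open>G \<in> Obj T\<close> by simp
next
  fix u v X Y
  assume a: "u \<in> Cell1 T" "v \<in> Cell1 T" "Dom1 T u = Cod1 T v" "X \<in> Ob (double (Val M (Cod1 T u)))" "Y \<in> Ob (double (Val N (Cod1 T u)))"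
  have i: "iso_arr (Val L (Dom1 T v)) (Pull L v $a PNat B u X Y)"
    "inv_arr (Val L (Dom1 T v)) (Pull L v $a PNat B u X Y) = Pull L v $a inv_arr (Val L (Dom1 T u)) (PNat B u X Y)"
    using L.base.P_inv_arr[of v "Dom1 T u" "PNat B u X Y"] a by simp_all
  show "(PNat B (u \<circ>1 v) X Y, inv_arr (Val L (Dom1 T (u \<circ>1 v))) (PNat B (u \<circ>1 v) X Y)) =
     (PNat B v (double_fctr (Pull M u) $o X) (double_fctr (Pull N u) $o Y),
       inv_arr (Val L (Dom1 T v)) (PNat B v (double_fctr (Pull M u) $o X) (double_fctr (Pull N u) $o Y)))
      \<cdot>\<^bsub>double (Val L (Dom1 T v))\<^esub> (double_fctr (Pull L v) $a (PNat B u X Y, inv_arr (Val L (Dom1 T u)) (PNat B u X Y)))"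
    using a PNat_comp1[of u v X Y] i inv_arr_comp[of "Val L (Dom1 T v)" "Pull L v $a PNat B u X Y" "PNat B v (Pull M u $o X) (Pull N u $o Y)"]
    by simp
next
  fix \<alpha> u v H G X Y
  assume a: "\<alpha> \<in> Cell2 T" "Dom2 T \<alpha> = u" "Cod2 T \<alpha> = v" "Dom1 T u = H" "Cod1 T u = G"
    "X \<in> Ob (double (Val M G))" "Y \<in> Ob (double (Val N G))"
  have [simp]: "Dom1 T v = H" "Cod1 T v = G" "u \<in> Cell1 T" "v \<in> Cell1 T"
    using M.cell2_arr[of \<alpha>] a by auto
  have "Pull2 L (inv_arr (Cells2 T) \<alpha>) (POb B G X Y) \<cdot>\<^bsub>Val L H\<^esub> inv_arr (Val L H) (PNat B v X Y)
     = inv_arr (Val L H) (PNat B u X Y) \<cdot>\<^bsub>Val L H\<^esub> PArr B H (Pull2 M (inv_arr (Cells2 T) \<alpha>) X) (Pull2 N (inv_arr (Cells2 T) \<alpha>) Y)"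
    by (rule inv_arr_square) (use a PNat_2cell[of "inv_arr (Cells2 T) \<alpha>" X Y H G] in auto)
  then show "(PNat B v X Y, inv_arr (Val L (Dom1 T v)) (PNat B v X Y)) \<cdot>\<^bsub>double (Val L H)\<^esub>
      (Pull2 L \<alpha> (POb B G X Y), Pull2 L (inv_arr (Cells2 T) \<alpha>) (POb B G X Y)) =
     (case (Pull2 M \<alpha> X, Pull2 M (inv_arr (Cells2 T) \<alpha>) X) of (e, h) \<Rightarrow> \<lambda>(e', h'). (PArr B H e e', PArr B H h h'))
       (Pull2 N \<alpha> Y, Pull2 N (inv_arr (Cells2 T) \<alpha>) Y) \<cdot>\<^bsub>double (Val L H)\<^esub>
      (PNat B u X Y, inv_arr (Val L (Dom1 T u)) (PNat B u X Y))"
    using PNat_2cell[of \<alpha> X Y H G] a by simp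
next
  fix G H assume "G \<in> Obj T" "H \<in> Obj T"
  then have p: "is_product T [G, H] (Prod S G H) [Pr1 S G H, Pr2 S G H]"
    using products unfolding binary_products_def by blast
  then show "product_cone T (Pr1 S G H) (Pr2 S G H)" by (rule M.product_cone_if_is_product)
  show "Prod S G H \<in> Obj T" "Pr1 S G H \<in> Cell1 T" "Pr2 S G H \<in> Cell1 T" "Dom1 T (Pr1 S G H) = Prod S G H"
      "Dom1 T (Pr2 S G H) = Prod S G H" "Cod1 T (Pr1 S G H) = G" "Cod1 T (Pr2 S G H) = H"
    using p unfolding is_product_def by auto
next
  fix u v assume "u \<in> Cell1 T" "v \<in> Cell1 T"
  then show "ProdMap S u v \<in> Cell1 T" "Dom1 T (ProdMap S u v) = Prod S (Dom1 T u) (Dom1 T v)"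
      "Cod1 T (ProdMap S u v) = Prod S (Cod1 T u) (Cod1 T v)"
      "Pr1Nat S u v \<in> Cell2 T" "Pr2Nat S u v \<in> Cell2 T"
      "Dom2 T (Pr1Nat S u v) = Pr1 S (Cod1 T u) (Cod1 T v) \<circ>1 ProdMap S u v"
      "Dom2 T (Pr2Nat S u v) = Pr2 S (Cod1 T u) (Cod1 T v) \<circ>1 ProdMap S u v"
      "Cod2 T (Pr1Nat S u v) = u \<circ>1 Pr1 S (Dom1 T u) (Dom1 T v)"
      "Cod2 T (Pr2Nat S u v) = v \<circ>1 Pr2 S (Dom1 T u) (Dom1 T v)"
    using products unfolding binary_products_def by auto
next
  fix i j assume "i \<in> J" "j \<in> J" then show "ProdMap S i j \<in> J" by (rule ProdMap_J)
qed auto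

text \<open>The two projection maps are the transposes of one arrow of the double.\<close>

lemma Lp1_Rp1_iff:
  assumes [simp]: "i \<in> J" "X \<in> Ob (Val M (Cod1 T i))" "Y \<in> Ob (Val N (Dom1 T i))"
  shows "mutually_inverse (Val L (Cod1 T i)) (Lp1 T M N L B i X Y) (Rp1 T M N L B i X Y) \<longleftrightarrow>
    L.pushfwd i (POb B (Dom1 T i) (Pull M i $o X) Y) (POb B (Cod1 T i) X (RPush N i $o Y))
      ((PArr B (Dom1 T i) (Idt (Val M (Dom1 T i)) (Pull M i $o X)) (RCounit N i Y),
        PArr B (Dom1 T i) (Idt (Val M (Dom1 T i)) (Pull M i $o X)) (LUnit N i Y)) \<cdot>\<^bsub>double (Val L (Dom1 T i))\<^esub>
       (PNat B i X (RPush N i $o Y), inv_arr (Val L (Dom1 T i)) (PNat B i X (RPush N i $o Y))))"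
  unfolding double_simps
  by (subst L.pushfwd_iff) (simp_all add: Lp1_def Rp1_def Let_def N.LPush_RPush L.LPush_RPush)

lemma Lp2_Rp2_iff:
  assumes [simp]: "i \<in> J" "X \<in> Ob (Val N (Cod1 T i))" "Y \<in> Ob (Val M (Dom1 T i))"
  shows "mutually_inverse (Val L (Cod1 T i)) (Lp2 T M N L B i Y X) (Rp2 T M N L B i Y X) \<longleftrightarrow>
    L.pushfwd i (POb B (Dom1 T i) Y (Pull N i $o X)) (POb B (Cod1 T i) (RPush M i $o Y) X)
      ((PArr B (Dom1 T i) (RCounit M i Y) (Idt (Val N (Dom1 T i)) (Pull N i $o X)),
        PArr B (Dom1 T i) (LUnit M i Y) (Idt (Val N (Dom1 T i)) (Pull N i $o X))) \<cdot>\<^bsub>double (Val L (Dom1 T i))\<^esub>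
       (PNat B i (RPush M i $o Y) X, inv_arr (Val L (Dom1 T i)) (PNat B i (RPush M i $o Y) X)))"
  unfolding double_simps
  by (subst L.pushfwd_iff) (simp_all add: Lp2_def Rp2_def Let_def M.LPush_RPush L.LPush_RPush)

lemma projection_formulas_iff: "projection_formulas T J M N L B \<longleftrightarrow> dbl.projection1 \<and> dbl.projection2"
proof
  assume pf: "projection_formulas T J M N L B"
  have dbl.projection1
    unfolding dbl.projection1_def
  proof (intro allI impI, elim conjE)
    fix i X Y A w assume X: "X \<in> Ob (double (Val M (Cod1 T i)))" and A: "N.pushfwd i Y A w"
    have i [simp]: "i \<in> J" "Y \<in> Ob (Val N (Dom1 T i))" using N.pushfwdD[OF A] by auto
    show "L.pushfwd i (POb B (Dom1 T i) (double_fctr (Pull M i) $o X) Y) (POb B (Cod1 T i) X A)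
       ((case Idt (double (Val M (Dom1 T i))) (double_fctr (Pull M i) $o X) of (e, h) \<Rightarrow>
           \<lambda>(e', h'). (PArr B (Dom1 T i) e e', PArr B (Dom1 T i) h h')) w \<cdot>\<^bsub>double (Val L (Dom1 T i))\<^esub>
        (PNat B i X A, inv_arr (Val L (Dom1 T i)) (PNat B i X A)))"
    proof (rule dbl.projection1_transport[OF X N.pushfwd_canonical A])
      show "L.pushfwd i (POb B (Dom1 T i) (double_fctr (Pull M i) $o X) Y) (POb B (Cod1 T i) X (RPush N i $o Y))
       ((case Idt (double (Val M (Dom1 T i))) (double_fctr (Pull M i) $o X) of (e, h) \<Rightarrow>
           \<lambda>(e', h'). (PArr B (Dom1 T i) e e', PArr B (Dom1 T i) h h')) (RCounit N i Y, LUnit N i Y) \<cdot>\<^bsub>double (Val L (Dom1 T i))\<^esub>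
        (PNat B i X (RPush N i $o Y), inv_arr (Val L (Dom1 T i)) (PNat B i X (RPush N i $o Y))))"
        using Lp1_Rp1_iff[of i X Y] pf X unfolding projection_formulas_def by simp
    qed simp_all
  qed
  moreover have dbl.projection2
    unfolding dbl.projection2_def
  proof (intro allI impI, elim conjE)
    fix i X Y A w assume X: "X \<in> Ob (double (Val N (Cod1 T i)))" and A: "M.pushfwd i Y A w"
    have i [simp]: "i \<in> J" "Y \<in> Ob (Val M (Dom1 T i))" using M.pushfwdD[OF A] by auto
    show "L.pushfwd i (POb B (Dom1 T i) Y (double_fctr (Pull N i) $o X)) (POb B (Cod1 T i) A X)
       ((case w of (e, h) \<Rightarrow> \<lambda>(e', h'). (PArr B (Dom1 T i) e e', PArr B (Dom1 T i) h h'))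
          (Idt (double (Val N (Dom1 T i))) (double_fctr (Pull N i) $o X)) \<cdot>\<^bsub>double (Val L (Dom1 T i))\<^esub>
        (PNat B i A X, inv_arr (Val L (Dom1 T i)) (PNat B i A X)))"
    proof (rule dbl.projection2_transport[OF X M.pushfwd_canonical A])
      show "L.pushfwd i (POb B (Dom1 T i) Y (double_fctr (Pull N i) $o X)) (POb B (Cod1 T i) (RPush M i $o Y) X)
       ((case (RCounit M i Y, LUnit M i Y) of (e, h) \<Rightarrow> \<lambda>(e', h'). (PArr B (Dom1 T i) e e', PArr B (Dom1 T i) h h'))
          (Idt (double (Val N (Dom1 T i))) (double_fctr (Pull N i) $o X)) \<cdot>\<^bsub>double (Val L (Dom1 T i))\<^esub>
        (PNat B i (RPush M i $o Y) X, inv_arr (Val L (Dom1 T i)) (PNat B i (RPush M i $o Y) X)))"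
        using Lp2_Rp2_iff[of i X Y] pf X unfolding projection_formulas_def by simp
    qed simp_all
  qed
  ultimately show "dbl.projection1 \<and> dbl.projection2" ..
next
  assume "dbl.projection1 \<and> dbl.projection2"
  then have 1: dbl.projection1 and 2: dbl.projection2 by auto
  show "projection_formulas T J M N L B"
    unfolding projection_formulas_def
  proof (intro allI ballI conjI)
    fix H G i X Y assume i: "i \<in> J \<inter> Hom1 T H G" and X: "X \<in> Ob (Val M G)" "Y \<in> Ob (Val N H)"
    then show "mutually_inverse (Val L G) (Lp1 T M N L B i X Y) (Rp1 T M N L B i X Y)"
      using Lp1_Rp1_iff[of i X Y] 1[unfolded dbl.projection1_def, rule_format, of X i Y "RPush N i $o Y" "(RCounit N i Y, LUnit N i Y)"]
        N.pushfwd_canonical[of i Y] by simp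
  next
    fix H G i X Y assume i: "i \<in> J \<inter> Hom1 T H G" and X: "X \<in> Ob (Val N G)" "Y \<in> Ob (Val M H)"
    then show "mutually_inverse (Val L G) (Lp2 T M N L B i Y X) (Rp2 T M N L B i Y X)"
      using Lp2_Rp2_iff[of i X Y] 2[unfolded dbl.projection2_def, rule_format, of X i Y "RPush M i $o Y" "(RCounit M i Y, LUnit M i Y)"]
        M.pushfwd_canonical[of i Y] by simp
  qed
qed

lemma inv_ExtNat:
  assumes "u \<in> Cell1 T" "v \<in> Cell1 T" "X \<in> Ob (Val M (Cod1 T u))" "Y \<in> Ob (Val N (Cod1 T v))"
  shows "inv_arr (Val L (Prod S (Dom1 T u) (Dom1 T v))) (ExtNat T S M N L B u v X Y) =
    inv_arr (Val L (Prod S (Dom1 T u) (Dom1 T v))) (PNat B (ProdMap S u v) (Pull M (Pr1 S (Cod1 T u) (Cod1 T v)) $o X)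
        (Pull N (Pr2 S (Cod1 T u) (Cod1 T v)) $o Y)) \<cdot>\<^bsub>Val L (Prod S (Dom1 T u) (Dom1 T v))\<^esub>
    PArr B (Prod S (Dom1 T u) (Dom1 T v)) (Pull2 M (inv_arr (Cells2 T) (Pr1Nat S u v)) X) (Pull2 N (inv_arr (Cells2 T) (Pr2Nat S u v)) Y)"
proof -
  let ?P = "Prod S (Dom1 T u) (Dom1 T v)"
  have 1: "(PArr B ?P (Pull2 M (Pr1Nat S u v) X) (Pull2 N (Pr2Nat S u v) Y),
      PArr B ?P (Pull2 M (inv_arr (Cells2 T) (Pr1Nat S u v)) X) (Pull2 N (inv_arr (Cells2 T) (Pr2Nat S u v)) Y)) \<in> unitary (Val L ?P)"
    using dbl.barr_U[of ?P "(Pull2 M (Pr1Nat S u v) X, Pull2 M (inv_arr (Cells2 T) (Pr1Nat S u v)) X)"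
        "(Pull2 N (Pr2Nat S u v) Y, Pull2 N (inv_arr (Cells2 T) (Pr2Nat S u v)) Y)"]
      M.U_P2[of "Pr1Nat S u v" ?P X] N.U_P2[of "Pr2Nat S u v" ?P Y] assms by simp
  have 2: "(PNat B (ProdMap S u v) (Pull M (Pr1 S (Cod1 T u) (Cod1 T v)) $o X) (Pull N (Pr2 S (Cod1 T u) (Cod1 T v)) $o Y),
      inv_arr (Val L ?P) (PNat B (ProdMap S u v) (Pull M (Pr1 S (Cod1 T u) (Cod1 T v)) $o X) (Pull N (Pr2 S (Cod1 T u) (Cod1 T v)) $o Y)))
      \<in> unitary (Val L ?P)"
    using dbl.bnat_U[of "ProdMap S u v" ?P "Pull M (Pr1 S (Cod1 T u) (Cod1 T v)) $o X" "Pull N (Pr2 S (Cod1 T u) (Cod1 T v)) $o Y"]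
      assms by simp
  have "dbl.extnat u v X Y \<in> unitary (Val L ?P)"
    using L.U_comp[OF _ 2 1] assms by simp
  then show ?thesis
    using inv_arr_eqI[of "Val L ?P"] assms by (simp add: ExtNat_def Let_def unitary_def)
qed

text \<open>The left and the right mate are the transposes of one arrow of the double.\<close>

lemma mates_iff:
  assumes [simp]: "i1 \<in> J" "i2 \<in> J" "X \<in> Ob (Val M (Dom1 T i1))" "Y \<in> Ob (Val N (Dom1 T i2))"
  shows "mutually_inverse (Val L (Prod S (Cod1 T i1) (Cod1 T i2))) (left_mate T S M N L B i1 i2 X Y) (right_mate T S M N L B i1 i2 X Y) \<longleftrightarrow>
    L.pushfwd (ProdMap S i1 i2) (dbl.extob (Dom1 T i1) (Dom1 T i2) X Y) (dbl.extob (Cod1 T i1) (Cod1 T i2) (RPush M i1 $o X) (RPush N i2 $o Y))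
      (dbl.extarr (Dom1 T i1) (Dom1 T i2) (RCounit M i1 X, LUnit M i1 X) (RCounit N i2 Y, LUnit N i2 Y)
        \<cdot>\<^bsub>double (Val L (Prod S (Dom1 T i1) (Dom1 T i2)))\<^esub> dbl.extnat i1 i2 (RPush M i1 $o X) (RPush N i2 $o Y))"
  unfolding double_simps double_fctr_simps prod.case
  by (subst L.pushfwd_iff)
    (simp_all add: left_mate_def right_mate_def ExtOb_def ExtArr_def Let_def inv_ExtNat M.LPush_RPush N.LPush_RPush L.LPush_RPush del: PArr_props(6),
     simp_all add: ExtNat_def Let_def del: PArr_props(6))

lemma is_bimorphism_iff: "is_bimorphism T J S M N L B \<longleftrightarrow> dbl.bimorphism"
proof
  assume b: "is_bimorphism T J S M N L B"
  show dbl.bimorphism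
    unfolding dbl.bimorphism_def
  proof (intro allI impI, elim conjE)
    fix i1 i2 X Y A1 A2 w1 w2 assume 1: "M.pushfwd i1 X A1 w1" and 2: "N.pushfwd i2 Y A2 w2"
    have [simp]: "i1 \<in> J" "X \<in> Ob (Val M (Dom1 T i1))" "i2 \<in> J" "Y \<in> Ob (Val N (Dom1 T i2))"
      using M.pushfwdD[OF 1] N.pushfwdD[OF 2] by auto
    have "mutually_inverse (Val L (Prod S (Cod1 T i1) (Cod1 T i2))) (left_mate T S M N L B i1 i2 X Y) (right_mate T S M N L B i1 i2 X Y)"
      using b unfolding is_bimorphism_def by simp
    then show "L.pushfwd (ProdMap S i1 i2) (dbl.extob (Dom1 T i1) (Dom1 T i2) X Y) (dbl.extob (Cod1 T i1) (Cod1 T i2) A1 A2)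
       (dbl.extarr (Dom1 T i1) (Dom1 T i2) w1 w2 \<cdot>\<^bsub>double (Val L (Prod S (Dom1 T i1) (Dom1 T i2)))\<^esub> dbl.extnat i1 i2 A1 A2)"
      by (intro dbl.bimorphism_transport[OF M.pushfwd_canonical 1 N.pushfwd_canonical 2] mates_iff[THEN iffD1]) simp_all
  qed
next
  assume b: dbl.bimorphism
  show "is_bimorphism T J S M N L B"
    unfolding is_bimorphism_def
  proof (intro allI ballI)
    fix H1 G1 H2 G2 i1 i2 X Y
    assume i: "i1 \<in> J \<inter> Hom1 T H1 G1" "i2 \<in> J \<inter> Hom1 T H2 G2" and X: "X \<in> Ob (Val M H1)" "Y \<in> Ob (Val N H2)"
    have D: "G1 = Cod1 T i1" "G2 = Cod1 T i2" using i by auto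
    show "mutually_inverse (Val L (Prod S G1 G2)) (left_mate T S M N L B i1 i2 X Y) (right_mate T S M N L B i1 i2 X Y)"
      unfolding D
      by (intro mates_iff[THEN iffD2] b[unfolded dbl.bimorphism_def, rule_format] conjI M.pushfwd_canonical N.pushfwd_canonical)
        (use i X in auto)
  qed
qed

end

theorem theorem6p11:
  fixes A :: target
    and k :: "'k ring"
    and T :: "('o, 'c, 't) twocat"
    and J :: "'c set"
    and S :: "('o, 'c, 't) prods"
    and M :: "('o, 'c, 't, 'a, 'm, 'k) mackey"
    and N :: "('o, 'c, 't, 'b, 'n, 'k) mackey"
    and L :: "('o, 'c, 't, 'd, 'l, 'k) mackey"
    and B :: "('o, 'c, 'a, 'm, 'b, 'n, 'd, 'l) pairing"
  assumes "cring k"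
    and "cartesian_spannable_pair T J S"
    and "rectified_mackey_2_functor A k T J M"
    and "rectified_mackey_2_functor A k T J N"
    and "rectified_mackey_2_functor A k T J L"
    and "is_pairing k T M N L B"
  shows "projection_formulas T J M N L B \<longleftrightarrow> is_bimorphism T J S M N L B"
proof -
  have J: "is_21_category T" "J \<subseteq> Cell1 T" "\<And>i j. i \<in> J \<Longrightarrow> j \<in> J \<Longrightarrow> Dom1 T i = Cod1 T j \<Longrightarrow> i \<circ>1\<^bsub>T\<^esub> j \<in> J"
    "\<And>e. is_equivalence1 T e \<Longrightarrow> e \<in> J" "binary_products T S" "\<And>i j. i \<in> J \<Longrightarrow> j \<in> J \<Longrightarrow> ProdMap S i j \<in> J"
    using assms(2) unfolding cartesian_spannable_pair_def spannable_pair_def by blast+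
  interpret two_one_category T using J(1) by (rule two_one_categoryI)
  interpret mackey_pairing T J A k M N L B S
    by unfold_locales (use assms J Id1_is_equivalence1 in auto)
  show ?thesis
    unfolding projection_formulas_iff is_bimorphism_iff by (rule dbl.projections_iff_bimorphism)
qed

end
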